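(* Let $R$ be a field of characteristic different from $2$ and $3$, made into a $\mathbb{Z}[\delta^{\pm1}]$-algebra by sending $\delta$ to some nonzero element of $R$. Then ${\rm Br}({\rm G}_2)\otimes_{\mathbb{Z}[\delta^{\pm1}]}R$ is a cellularly stratified algebra.
   Context: Let $\delta$ be an indeterminate. ${\rm Br}({\rm G}_2)$ is the $\mathbb{Z}[\delta^{\pm1}]$-algebra generated by $r_0,r_1,e_0,e_1$ subject to the following relations: - $r_0^2=r_1^2=1$; - $r_ie_i=e_ir_i=e_i$ for $i=0,1$; - $e_0^2=\delta^3e_0$ and $e_1^2=\delta e_1$; - $r_0e_1e_0=r_1e_0$ and $e_0e_1r_0=e_0r_1$; - $e_1r_0e_1r_0e_1=e_1$ and $e_1r_0e_1r_0r_1=e_1r_0r_1r_0$; - $e_0r_1e_0=\delta^2e_0$; - $r_1r_0e_1r_0e_1=r_0r_1r_0e_1$; - $(r_1r_0)^6=1$. "Cellularly stratified" is in the sense of Hartmann, Henke, Koenig and Paget. A finite-dimensional algebra $A$ with an anti-involution is cellularly stratified if the following hold. - $A$ is an iterated inflation of cellular algebras $B_1,\dots,B_n$ along vector spaces $V_1,\dots,V_n$. In particular, as a vector space $A=\bigoplus_l V_l\otimes V_l\otimes B_l$, and the partial sums over an initial segment of the layers are two-sided ideals. - For each $l$ there are nonzero $u_l,v_l\in V_l$ such that $e_l=u_l\otimes v_l\otimes 1_{B_l}$ is an idempotent. - $e_le_m=e_m=e_me_l$ whenever $l>m$. *)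

theory Defs
  imports "HOL-Algebra.Module" "HOL-Algebra.Ideal"
begin

definition kring :: "'k::field ring" where
  "kring = \<lparr>carrier = UNIV, monoid.mult = (*), one = 1, zero = 0, add = (+)\<rparr>"

definition kalg :: "('k::field, 'a) module \<Rightarrow> bool" where
  "kalg A \<longleftrightarrow> ring A \<and> module kring A \<and>
     (\<forall>c x y. x \<in> carrier A \<longrightarrow> y \<in> carrier A \<longrightarrow>
        c \<odot>\<^bsub>A\<^esub> (x \<otimes>\<^bsub>A\<^esub> y) = (c \<odot>\<^bsub>A\<^esub> x) \<otimes>\<^bsub>A\<^esub> y \<and>
        c \<odot>\<^bsub>A\<^esub> (x \<otimes>\<^bsub>A\<^esub> y) = x \<otimes>\<^bsub>A\<^esub> (c \<odot>\<^bsub>A\<^esub> y))"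

definition span_fam :: "('k::field, 'a) module \<Rightarrow> ('i \<Rightarrow> 'a) \<Rightarrow> 'i set \<Rightarrow> 'a set" where
  "span_fam A b I = {finsum A (\<lambda>i. c i \<odot>\<^bsub>A\<^esub> b i) F | c F. finite F \<and> F \<subseteq> I}"

definition lin_indep_fam :: "('k::field, 'a) module \<Rightarrow> ('i \<Rightarrow> 'a) \<Rightarrow> 'i set \<Rightarrow> bool" where
  "lin_indep_fam A b I \<longleftrightarrow>
     (\<forall>c F. finite F \<and> F \<subseteq> I \<and> finsum A (\<lambda>i. c i \<odot>\<^bsub>A\<^esub> b i) F = \<zero>\<^bsub>A\<^esub>
        \<longrightarrow> (\<forall>i\<in>F. c i = 0))"

definition basis_fam :: "('k::field, 'a) module \<Rightarrow> ('i \<Rightarrow> 'a) \<Rightarrow> 'i set \<Rightarrow> bool" where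
  "basis_fam A b I \<longleftrightarrow> b ` I \<subseteq> carrier A \<and> lin_indep_fam A b I \<and> span_fam A b I = carrier A"

definition fin_dim :: "('k::field, 'a) module \<Rightarrow> bool" where
  "fin_dim A \<longleftrightarrow> (\<exists>S. finite S \<and> S \<subseteq> carrier A \<and> span_fam A id S = carrier A)"

definition lin_map :: "('k::field, 'a) module \<Rightarrow> ('k, 'b) module \<Rightarrow> ('a \<Rightarrow> 'b) \<Rightarrow> bool" where
  "lin_map A B f \<longleftrightarrow> f \<in> carrier A \<rightarrow> carrier B \<and>
     (\<forall>x\<in>carrier A. \<forall>y\<in>carrier A. f (x \<oplus>\<^bsub>A\<^esub> y) = f x \<oplus>\<^bsub>B\<^esub> f y) \<and>
     (\<forall>c. \<forall>x\<in>carrier A. f (c \<odot>\<^bsub>A\<^esub> x) = c \<odot>\<^bsub>B\<^esub> f x)"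

definition anti_inv :: "('k::field, 'a) module \<Rightarrow> ('a \<Rightarrow> 'a) \<Rightarrow> bool" where
  "anti_inv A i \<longleftrightarrow> lin_map A A i \<and>
     (\<forall>x\<in>carrier A. \<forall>y\<in>carrier A. i (x \<otimes>\<^bsub>A\<^esub> y) = i y \<otimes>\<^bsub>A\<^esub> i x) \<and>
     (\<forall>x\<in>carrier A. i (i x) = x)"

text \<open>Finite poset (Lam, le), finite index sets M lam, cellular basis C lam S T.
  Index sets are taken inside nat (no loss of generality, everything is finite).\<close>
definition cellular :: "('k::field, 'b) module \<Rightarrow> ('b \<Rightarrow> 'b) \<Rightarrow> bool" where
  "cellular B j \<longleftrightarrow> kalg B \<and> anti_inv B j \<and>
   (\<exists>(Lam::nat set) (le::nat \<Rightarrow> nat \<Rightarrow> bool) (M::nat \<Rightarrow> nat set) (C::nat \<Rightarrow> nat \<Rightarrow> nat \<Rightarrow> 'b).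
      finite Lam \<and>
      (\<forall>x\<in>Lam. le x x) \<and>
      (\<forall>x\<in>Lam. \<forall>y\<in>Lam. le x y \<and> le y x \<longrightarrow> x = y) \<and>
      (\<forall>x\<in>Lam. \<forall>y\<in>Lam. \<forall>z\<in>Lam. le x y \<and> le y z \<longrightarrow> le x z) \<and>
      (\<forall>lam\<in>Lam. finite (M lam)) \<and>
      basis_fam B (\<lambda>(lam, S, T). C lam S T) {(lam, S, T). lam \<in> Lam \<and> S \<in> M lam \<and> T \<in> M lam} \<and>
      (\<forall>lam\<in>Lam. \<forall>S\<in>M lam. \<forall>T\<in>M lam. j (C lam S T) = C lam T S) \<and>
      (\<forall>a\<in>carrier B. \<forall>lam\<in>Lam. \<forall>S\<in>M lam. \<exists>r::nat \<Rightarrow> 'k. \<forall>T\<in>M lam.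
         a \<otimes>\<^bsub>B\<^esub> C lam S T \<ominus>\<^bsub>B\<^esub> finsum B (\<lambda>S'. r S' \<odot>\<^bsub>B\<^esub> C lam S' T) (M lam)
           \<in> span_fam B (\<lambda>(mu, U, V). C mu U V)
               {(mu, U, V). mu \<in> Lam \<and> le mu lam \<and> mu \<noteq> lam \<and> U \<in> M mu \<and> V \<in> M mu}))"

text \<open>Layers l = 1..n.  V_l is taken with a finite basis indexed by P l, so that
  V_l (x) V_l (x) B_l is identified with families indexed by P l x P l with entries in B_l;
  Theta l p q x is the element of A corresponding to v_p (x) v_q (x) x.
  Phi l p q = phi_l(v_p, v_q) is the bilinear form of the inflation.
  u l, v l are the coordinate vectors of u_l, v_l in V_l.
  The algebras B_l are realised on carriers of type nat => 'k (any finite dimensional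
  algebra is isomorphic to one of these).\<close>
definition cell_strat :: "('k::field, 'a) module \<Rightarrow> ('a \<Rightarrow> 'a) \<Rightarrow> bool" where
  "cell_strat A i \<longleftrightarrow> kalg A \<and> anti_inv A i \<and> fin_dim A \<and>
   (\<exists>(n::nat) (B::nat \<Rightarrow> ('k, nat \<Rightarrow> 'k) module) (j::nat \<Rightarrow> (nat \<Rightarrow> 'k) \<Rightarrow> (nat \<Rightarrow> 'k))
      (P::nat \<Rightarrow> nat set) (Phi::nat \<Rightarrow> nat \<Rightarrow> nat \<Rightarrow> (nat \<Rightarrow> 'k))
      (Theta::nat \<Rightarrow> nat \<Rightarrow> nat \<Rightarrow> (nat \<Rightarrow> 'k) \<Rightarrow> 'a) (u::nat \<Rightarrow> nat \<Rightarrow> 'k) (v::nat \<Rightarrow> nat \<Rightarrow> 'k).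
    let J = (\<lambda>l. span_fam A (\<lambda>(m, p, q, x). Theta m p q x)
                  {(m, p, q, x). 1 \<le> m \<and> m \<le> l \<and> p \<in> P m \<and> q \<in> P m \<and> x \<in> carrier (B m)});
        Idx = {(l, p, q). l \<in> {1..n} \<and> p \<in> P l \<and> q \<in> P l};
        e = (\<lambda>l. finsum A (\<lambda>(p, q). Theta l p q ((u l p * v l q) \<odot>\<^bsub>B l\<^esub> \<one>\<^bsub>B l\<^esub>)) (P l \<times> P l))
    in
    \<comment> \<open>data: cellular B_l, finite-dimensional V_l, symmetric bilinear forms, linear embeddings\<close>
    (\<forall>l\<in>{1..n}. cellular (B l) (j l) \<and> finite (P l) \<and>
       (\<forall>p\<in>P l. \<forall>q\<in>P l. Phi l p q \<in> carrier (B l) \<and> j l (Phi l p q) = Phi l q p) \<and>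
       (\<forall>p\<in>P l. \<forall>q\<in>P l. lin_map (B l) A (Theta l p q))) \<and>
    \<comment> \<open>A = direct sum of the V_l (x) V_l (x) B_l as vector spaces\<close>
    (\<forall>a\<in>carrier A. \<exists>X. (\<forall>(l, p, q)\<in>Idx. X l p q \<in> carrier (B l)) \<and>
        a = finsum A (\<lambda>(l, p, q). Theta l p q (X l p q)) Idx) \<and>
    (\<forall>X. (\<forall>(l, p, q)\<in>Idx. X l p q \<in> carrier (B l)) \<and>
        finsum A (\<lambda>(l, p, q). Theta l p q (X l p q)) Idx = \<zero>\<^bsub>A\<^esub>
        \<longrightarrow> (\<forall>(l, p, q)\<in>Idx. X l p q = \<zero>\<^bsub>B l\<^esub>)) \<and>
    \<comment> \<open>partial sums over initial segments of layers are two-sided ideals\<close>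
    (\<forall>l\<in>{0..n}. ideal (J l) A) \<and>
    \<comment> \<open>inflation multiplication within a layer, modulo lower layers\<close>
    (\<forall>l\<in>{1..n}. \<forall>p\<in>P l. \<forall>q\<in>P l. \<forall>p'\<in>P l. \<forall>q'\<in>P l. \<forall>x\<in>carrier (B l). \<forall>y\<in>carrier (B l).
       Theta l p q x \<otimes>\<^bsub>A\<^esub> Theta l p' q' y \<ominus>\<^bsub>A\<^esub>
         Theta l p q' (x \<otimes>\<^bsub>B l\<^esub> Phi l q p' \<otimes>\<^bsub>B l\<^esub> y) \<in> J (l - 1)) \<and>
    \<comment> \<open>left action of A on a layer (modulo lower layers) does not touch the second V-factor
        and is right B_l-linear\<close>
    (\<forall>a\<in>carrier A. \<forall>l\<in>{1..n}. \<forall>p\<in>P l. \<exists>y::nat \<Rightarrow> (nat \<Rightarrow> 'k).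
       (\<forall>p'\<in>P l. y p' \<in> carrier (B l)) \<and>
       (\<forall>q\<in>P l. \<forall>x\<in>carrier (B l).
          a \<otimes>\<^bsub>A\<^esub> Theta l p q x \<ominus>\<^bsub>A\<^esub>
            finsum A (\<lambda>p'. Theta l p' q (y p' \<otimes>\<^bsub>B l\<^esub> x)) (P l) \<in> J (l - 1))) \<and>
    \<comment> \<open>the anti-involution is the inflation involution on each layer, modulo lower layers\<close>
    (\<forall>l\<in>{1..n}. \<forall>p\<in>P l. \<forall>q\<in>P l. \<forall>x\<in>carrier (B l).
       i (Theta l p q x) \<ominus>\<^bsub>A\<^esub> Theta l q p (j l x) \<in> J (l - 1)) \<and>
    \<comment> \<open>idempotents e_l = u_l (x) v_l (x) 1 with u_l, v_l nonzero\<close>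
    (\<forall>l\<in>{1..n}. (\<exists>p\<in>P l. u l p \<noteq> 0) \<and> (\<exists>q\<in>P l. v l q \<noteq> 0) \<and>
       e l \<otimes>\<^bsub>A\<^esub> e l = e l) \<and>
    (\<forall>l\<in>{1..n}. \<forall>m\<in>{1..n}. m < l \<longrightarrow>
       e l \<otimes>\<^bsub>A\<^esub> e m = e m \<and> e m \<otimes>\<^bsub>A\<^esub> e l = e m))"

datatype gen = R0 | R1 | E0 | E1

text \<open>Free associative 'k-algebra on gen: finitely supported functions on words.\<close>
definition fa_carrier :: "(gen list \<Rightarrow> 'k::field) set" where
  "fa_carrier = {f. finite {w. f w \<noteq> 0}}"

definition fa_add :: "(gen list \<Rightarrow> 'k::field) \<Rightarrow> (gen list \<Rightarrow> 'k) \<Rightarrow> (gen list \<Rightarrow> 'k)" where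
  "fa_add f g = (\<lambda>w. f w + g w)"

definition fa_smul :: "'k::field \<Rightarrow> (gen list \<Rightarrow> 'k) \<Rightarrow> (gen list \<Rightarrow> 'k)" where
  "fa_smul c f = (\<lambda>w. c * f w)"

definition fa_mul :: "(gen list \<Rightarrow> 'k::field) \<Rightarrow> (gen list \<Rightarrow> 'k) \<Rightarrow> (gen list \<Rightarrow> 'k)" where
  "fa_mul f g = (\<lambda>w. \<Sum>(x, y)\<in>{(x, y). x @ y = w}. f x * g y)"

definition fa_word :: "gen list \<Rightarrow> (gen list \<Rightarrow> 'k::field)" where
  "fa_word w = (\<lambda>x. if x = w then 1 else 0)"

definition fa_zero :: "gen list \<Rightarrow> 'k::field" where
  "fa_zero = (\<lambda>w. 0)"

definition fa_rev :: "(gen list \<Rightarrow> 'k::field) \<Rightarrow> (gen list \<Rightarrow> 'k)" where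
  "fa_rev f = (\<lambda>w. f (rev w))"

text \<open>Defining relations of Br(G2), with delta specialised to d.  Each pair (x, y) means x = y.\<close>
definition br_rels :: "'k::field \<Rightarrow> ((gen list \<Rightarrow> 'k) \<times> (gen list \<Rightarrow> 'k)) list" where
  "br_rels d = [
     (fa_word [R0, R0], fa_word []),
     (fa_word [R1, R1], fa_word []),
     (fa_word [R0, E0], fa_word [E0]),
     (fa_word [E0, R0], fa_word [E0]),
     (fa_word [R1, E1], fa_word [E1]),
     (fa_word [E1, R1], fa_word [E1]),
     (fa_word [E0, E0], fa_smul (d ^ 3) (fa_word [E0])),
     (fa_word [E1, E1], fa_smul d (fa_word [E1])),
     (fa_word [R0, E1, E0], fa_word [R1, E0]),
     (fa_word [E0, E1, R0], fa_word [E0, R1]),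
     (fa_word [E1, R0, E1, R0, E1], fa_word [E1]),
     (fa_word [E1, R0, E1, R0, R1], fa_word [E1, R0, R1, R0]),
     (fa_word [E0, R1, E0], fa_smul (d ^ 2) (fa_word [E0])),
     (fa_word [R1, R0, E1, R0, E1], fa_word [R0, R1, R0, E1]),
     (fa_word (concat (replicate 6 [R1, R0])), fa_word [])]"

inductive_set br_ideal :: "'k::field \<Rightarrow> (gen list \<Rightarrow> 'k) set" for d :: "'k" where
  rel: "(x, y) \<in> set (br_rels d) \<Longrightarrow> fa_add x (fa_smul (-1) y) \<in> br_ideal d"
| zero: "fa_zero \<in> br_ideal d"
| add: "a \<in> br_ideal d \<Longrightarrow> b \<in> br_ideal d \<Longrightarrow> fa_add a b \<in> br_ideal d"
| lmul: "f \<in> fa_carrier \<Longrightarrow> a \<in> br_ideal d \<Longrightarrow> fa_mul f a \<in> br_ideal d"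
| rmul: "f \<in> fa_carrier \<Longrightarrow> a \<in> br_ideal d \<Longrightarrow> fa_mul a f \<in> br_ideal d"

definition br_cls :: "'k::field \<Rightarrow> (gen list \<Rightarrow> 'k) \<Rightarrow> (gen list \<Rightarrow> 'k) set" where
  "br_cls d f = {g \<in> fa_carrier. fa_add f (fa_smul (-1) g) \<in> br_ideal d}"

definition br_rep :: "'k::field \<Rightarrow> (gen list \<Rightarrow> 'k) set \<Rightarrow> (gen list \<Rightarrow> 'k)" where
  "br_rep d X = (SOME f. f \<in> fa_carrier \<and> X = br_cls d f)"

text \<open>Br(G2) (x)_{Z[delta^{+-1}]} R as the quotient R-algebra (delta mapped to d).\<close>
definition BrG2 :: "'k::field \<Rightarrow> ('k, (gen list \<Rightarrow> 'k) set) module" where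
  "BrG2 d = \<lparr>carrier = br_cls d ` fa_carrier,
     monoid.mult = (\<lambda>X Y. br_cls d (fa_mul (br_rep d X) (br_rep d Y))),
     one = br_cls d (fa_word []),
     zero = br_cls d fa_zero,
     add = (\<lambda>X Y. br_cls d (fa_add (br_rep d X) (br_rep d Y))),
     smult = (\<lambda>c X. br_cls d (fa_smul c (br_rep d X)))\<rparr>"

definition br_inv :: "'k::field \<Rightarrow> (gen list \<Rightarrow> 'k) set \<Rightarrow> (gen list \<Rightarrow> 'k) set" where
  "br_inv d X = br_cls d (fa_rev (br_rep d X))"

end

theory Submission
  imports Defs
begin

text \<open>Completing the presentation to a confluent rewriting system shows that the algebra has a basis
  of 39 words, the product of two of them being a power of \<open>d\<close> times a third. These words fall into
  three layers. The first is spanned by the conjugates \<open>v E0 v'\<^sup>-\<^sup>1\<close> (a \<open>3 \<times> 3\<close> inflation of the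
  ground field), the second by the \<open>w E1 z\<^sup>h w'\<^sup>-\<^sup>1\<close>, where \<open>z\<close> is the central involution of the Weyl
  group (a \<open>3 \<times> 3\<close> inflation of the group algebra of \<open>\<int>/2\<close>), and the third is the group algebra of
  the Weyl group \<open>S\<^sub>3 \<times> \<int>/2\<close> itself. The Kazhdan-Lusztig basis makes these group algebras cellular,
  and \<open>d\<^sup>-\<^sup>3 R0 R1 E0 R1 R0\<close>, \<open>d\<^sup>-\<^sup>1 E1\<close> and \<open>1\<close> are the required idempotents.\<close>

section \<open>Twisted monoid algebras\<close>

text \<open>The carrier of \<open>BrG2 d\<close> consists of classes of functions and its operations
  choose representatives, so nothing can be evaluated there directly. Everything is therefore moved
  along a linear bijection to functions on 39 indices, where multiplication is given by a table of
  indices and a table of exponents; each clause of the goal becomes a condition on indices, handled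
  once in a general locale. Confluence is not established as such. Rewriting with the added rules
  only shows that the words span; their independence comes from the opposite side, by checking that
  the tables define an associative algebra in which the defining relations hold. Scalars enter these
  tables only as powers of \<open>d\<close>, recorded as natural numbers, so that the finite checks
  are free of field arithmetic.\<close>

lemma kring_simps [simp]:
  "carrier kring = UNIV" "x \<otimes>\<^bsub>kring\<^esub> y = x * y" "x \<oplus>\<^bsub>kring\<^esub> y = x + y"
  "\<one>\<^bsub>kring\<^esub> = 1" "\<zero>\<^bsub>kring\<^esub> = 0"
  by (simp_all add: kring_def)

lemma cring_kring: "cring (kring :: 'k::field ring)"
proof (rule cringI)
  show "abelian_group (kring :: 'k ring)"
    by (rule abelian_groupI) (auto simp: algebra_simps intro: exI[of _ "- x" for x])
  show "comm_monoid (kring :: 'k ring)"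
    by (rule comm_monoidI) auto
qed (auto simp: algebra_simps)

definition fsupp :: "nat \<Rightarrow> (nat \<Rightarrow> 'k::zero) set" where
  "fsupp N = {f. \<forall>t\<ge>N. f t = 0}"

definition delta :: "nat \<Rightarrow> nat \<Rightarrow> 'k::zero_neq_one" where
  "delta s = (\<lambda>t. if t = s then 1 else 0)"

definition tmul :: "nat \<Rightarrow> (nat \<Rightarrow> nat \<Rightarrow> nat) \<Rightarrow> (nat \<Rightarrow> nat \<Rightarrow> 'k::field)
    \<Rightarrow> (nat \<Rightarrow> 'k) \<Rightarrow> (nat \<Rightarrow> 'k) \<Rightarrow> nat \<Rightarrow> 'k" where
  "tmul N m \<kappa> f g = (\<lambda>u. \<Sum>s<N. \<Sum>t<N. if m s t = u then \<kappa> s t * f s * g t else 0)"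

definition talg :: "nat \<Rightarrow> (nat \<Rightarrow> nat \<Rightarrow> nat) \<Rightarrow> (nat \<Rightarrow> nat \<Rightarrow> 'k::field) \<Rightarrow> ('k, nat \<Rightarrow> 'k) module" where
  "talg N m \<kappa> = \<lparr>carrier = fsupp N, monoid.mult = tmul N m \<kappa>, one = delta 0,
     zero = (\<lambda>_. 0), add = (\<lambda>f g t. f t + g t), smult = (\<lambda>c f t. c * f t)\<rparr>"

lemma talg_simps [simp]:
  "carrier (talg N m \<kappa>) = fsupp N" "x \<otimes>\<^bsub>talg N m \<kappa>\<^esub> y = tmul N m \<kappa> x y"
  "\<one>\<^bsub>talg N m \<kappa>\<^esub> = delta 0" "\<zero>\<^bsub>talg N m \<kappa>\<^esub> = (\<lambda>_. 0)"
  "x \<oplus>\<^bsub>talg N m \<kappa>\<^esub> y = (\<lambda>t. x t + y t)" "a \<odot>\<^bsub>talg N m \<kappa>\<^esub> x = (\<lambda>t. a * x t)"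
  by (simp_all add: talg_def)

locale twisted_monoid =
  fixes N :: nat and m :: "nat \<Rightarrow> nat \<Rightarrow> nat" and \<kappa> :: "nat \<Rightarrow> nat \<Rightarrow> 'k::field"
  assumes N_pos: "0 < N"
    and m_less: "\<lbrakk>s < N; t < N\<rbrakk> \<Longrightarrow> m s t < N"
    and m_assoc: "\<lbrakk>s < N; t < N; u < N\<rbrakk> \<Longrightarrow> m (m s t) u = m s (m t u)"
    and cocycle: "\<lbrakk>s < N; t < N; u < N\<rbrakk> \<Longrightarrow> \<kappa> s t * \<kappa> (m s t) u = \<kappa> t u * \<kappa> s (m t u)"
    and m_unit: "t < N \<Longrightarrow> m 0 t = t" "t < N \<Longrightarrow> m t 0 = t"
    and kappa_unit: "t < N \<Longrightarrow> \<kappa> 0 t = 1" "t < N \<Longrightarrow> \<kappa> t 0 = 1"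
begin

text \<open>Pairing a product with a test function \<open>F\<close> removes the condition
  \<open>m s t = u\<close>. This change of variables is behind associativity and behind the
  coefficients of products in the cellular basis.\<close>

lemma sum_tmul:
  "(\<Sum>u<N. tmul N m \<kappa> f g u * F u) = (\<Sum>s<N. \<Sum>t<N. \<kappa> s t * f s * g t * F (m s t))"
proof -
  have "(\<Sum>u<N. tmul N m \<kappa> f g u * F u) =
      (\<Sum>u<N. \<Sum>s<N. \<Sum>t<N. if m s t = u then \<kappa> s t * f s * g t * F u else 0)"
    unfolding tmul_def sum_distrib_right by (intro sum.cong refl) auto
  also have "\<dots> = (\<Sum>s<N. \<Sum>u<N. \<Sum>t<N. if m s t = u then \<kappa> s t * f s * g t * F u else 0)"
    by (rule sum.swap)
  also have "\<dots> = (\<Sum>s<N. \<Sum>t<N. \<Sum>u<N. if m s t = u then \<kappa> s t * f s * g t * F u else 0)"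
    by (intro sum.cong refl sum.swap)
  also have "\<dots> = (\<Sum>s<N. \<Sum>t<N. \<kappa> s t * f s * g t * F (m s t))"
    by (intro sum.cong refl) (simp add: m_less)
  finally show ?thesis .
qed

text \<open>Both bracketings become one triple sum over basis indices; associativity of
  \<open>m\<close> matches the conditions and the cocycle identity matches the scalars.\<close>

lemma tmul_assoc: "tmul N m \<kappa> (tmul N m \<kappa> f g) h = tmul N m \<kappa> f (tmul N m \<kappa> g h)"
proof
  fix v
  have "tmul N m \<kappa> (tmul N m \<kappa> f g) h v =
      (\<Sum>s<N. tmul N m \<kappa> f g s * (\<Sum>t<N. if m s t = v then \<kappa> s t * h t else 0))"
    unfolding tmul_def[of _ _ _ "tmul N m \<kappa> f g"] sum_distrib_left by (intro sum.cong refl) auto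
  also have "\<dots> = (\<Sum>a<N. \<Sum>b<N. \<Sum>t<N.
      if m (m a b) t = v then \<kappa> a b * \<kappa> (m a b) t * f a * g b * h t else 0)"
    unfolding sum_tmul by (intro sum.cong refl) (auto simp: sum_distrib_left intro!: sum.cong)
  also have "\<dots> = (\<Sum>a<N. \<Sum>b<N. \<Sum>t<N.
      if m a (m b t) = v then \<kappa> b t * \<kappa> a (m b t) * f a * g b * h t else 0)"
    by (intro sum.cong refl) (simp add: m_assoc cocycle)
  also have "\<dots> = (\<Sum>a<N. \<Sum>b<N. \<Sum>t<N. \<kappa> b t * g b * h t *
      (if m a (m b t) = v then \<kappa> a (m b t) * f a else 0))"
    by (intro sum.cong refl) auto
  also have "\<dots> = (\<Sum>a<N. \<Sum>s<N. tmul N m \<kappa> g h s * (if m a s = v then \<kappa> a s * f a else 0))"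
    by (simp only: sum_tmul)
  also have "\<dots> = tmul N m \<kappa> f (tmul N m \<kappa> g h) v"
    unfolding tmul_def[of _ _ _ f "tmul N m \<kappa> g h"] by (intro sum.cong refl) auto
  finally show "tmul N m \<kappa> (tmul N m \<kappa> f g) h v = tmul N m \<kappa> f (tmul N m \<kappa> g h) v" .
qed

lemma tmul_in: "tmul N m \<kappa> f g \<in> fsupp N"
  unfolding fsupp_def tmul_def using m_less by (auto intro!: sum.neutral) (metis not_le)

lemma delta_in: "s < N \<Longrightarrow> delta s \<in> fsupp N"
  by (auto simp: fsupp_def delta_def)

lemma tmul_delta_left:
  assumes "s < N"
  shows "tmul N m \<kappa> (delta s) g u = (\<Sum>t<N. if m s t = u then \<kappa> s t * g t else 0)"
proof -
  have "tmul N m \<kappa> (delta s) g u =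
      (\<Sum>s'<N. if s' = s then (\<Sum>t<N. if m s t = u then \<kappa> s t * g t else 0) else 0)"
    unfolding tmul_def delta_def by (intro sum.cong refl) (auto intro!: sum.cong sum.neutral)
  then show ?thesis using assms by simp
qed

lemma tmul_delta_right:
  assumes "t < N"
  shows "tmul N m \<kappa> g (delta t) u = (\<Sum>s<N. if m s t = u then \<kappa> s t * g s else 0)"
  unfolding tmul_def
proof (intro sum.cong refl)
  fix s
  have "(\<Sum>t'<N. if m s t' = u then \<kappa> s t' * g s * delta t t' else 0)
      = (\<Sum>t'<N. if t' = t then (if m s t = u then \<kappa> s t * g s else 0) else 0)"
    unfolding delta_def by (intro sum.cong refl) auto
  then show "(\<Sum>t'<N. if m s t' = u then \<kappa> s t' * g s * delta t t' else 0)
      = (if m s t = u then \<kappa> s t * g s else 0)" using assms by simp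
qed

lemma tmul_delta_delta:
  assumes "s < N" "t < N"
  shows "tmul N m \<kappa> (delta s) (delta t) = (\<lambda>u. \<kappa> s t * delta (m s t) u)"
proof
  fix u
  have "tmul N m \<kappa> (delta s) (delta t) u =
      (\<Sum>s'<N. if s' = s then (if m s t = u then \<kappa> s t else 0) else 0)"
    unfolding tmul_delta_right[OF assms(2)] by (intro sum.cong refl) (auto simp: delta_def)
  then show "tmul N m \<kappa> (delta s) (delta t) u = \<kappa> s t * delta (m s t) u"
    using assms by (auto simp: delta_def)
qed

lemma tmul_one_left: "f \<in> fsupp N \<Longrightarrow> tmul N m \<kappa> (delta 0) f = f"
proof
  fix u assume "f \<in> fsupp N"
  moreover have "tmul N m \<kappa> (delta 0) f u = (\<Sum>t<N. if t = u then f t else 0)"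
    unfolding tmul_delta_left[OF N_pos] by (intro sum.cong refl) (simp add: m_unit kappa_unit)
  ultimately show "tmul N m \<kappa> (delta 0) f u = f u" by (auto simp: fsupp_def)
qed

lemma tmul_one_right: "f \<in> fsupp N \<Longrightarrow> tmul N m \<kappa> f (delta 0) = f"
proof
  fix u assume "f \<in> fsupp N"
  moreover have "tmul N m \<kappa> f (delta 0) u = (\<Sum>t<N. if t = u then f t else 0)"
    unfolding tmul_delta_right[OF N_pos] by (intro sum.cong refl) (simp add: m_unit kappa_unit)
  ultimately show "tmul N m \<kappa> f (delta 0) u = f u" by (auto simp: fsupp_def)
qed

end

lemma tmul_linear:
  "tmul N m \<kappa> (\<lambda>t. f t + f' t) g = (\<lambda>u. tmul N m \<kappa> f g u + tmul N m \<kappa> f' g u)"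
  "tmul N m \<kappa> f (\<lambda>t. g t + g' t) = (\<lambda>u. tmul N m \<kappa> f g u + tmul N m \<kappa> f g' u)"
  "tmul N m \<kappa> (\<lambda>t. a * f t) g = (\<lambda>u. a * tmul N m \<kappa> f g u)"
  "tmul N m \<kappa> f (\<lambda>t. a * g t) = (\<lambda>u. a * tmul N m \<kappa> f g u)"
  unfolding tmul_def sum_distrib_left sum.distrib[symmetric]
  by (rule ext, intro sum.cong refl, simp add: algebra_simps)+

lemma tmul_zero:
  "tmul N m \<kappa> (\<lambda>_. 0) g = (\<lambda>_. 0)" "tmul N m \<kappa> f (\<lambda>_. 0) = (\<lambda>_. 0)"
  unfolding tmul_def by (auto intro!: sum.neutral)

lemma tmul_sum_left:
  "finite S \<Longrightarrow> tmul N m \<kappa> (\<lambda>t. \<Sum>x\<in>S. a x * f x t) g = (\<lambda>u. \<Sum>x\<in>S. a x * tmul N m \<kappa> (f x) g u)"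
  by (induction S rule: finite_induct) (simp_all add: tmul_zero tmul_linear)

lemma tmul_sum_right:
  "finite S \<Longrightarrow> tmul N m \<kappa> f (\<lambda>t. \<Sum>x\<in>S. a x * g x t) = (\<lambda>u. \<Sum>x\<in>S. a x * tmul N m \<kappa> f (g x) u)"
  by (induction S rule: finite_induct) (simp_all add: tmul_zero tmul_linear)

text \<open>The algebra \<open>A\<close> is seen only through the bijection \<open>c\<close>.
  Closure is assumed separately because the transport equations say nothing about membership in the
  carrier. Ring and module laws are then read off coordinatewise by \<open>c_eqI\<close>.\<close>

locale coord_alg = twisted_monoid N m \<kappa> for N m and \<kappa> :: "nat \<Rightarrow> nat \<Rightarrow> 'k::field" +
  fixes A :: "('k, 'a) module" and c :: "'a \<Rightarrow> nat \<Rightarrow> 'k"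
  assumes c_bij: "bij_betw c (carrier A) (fsupp N)"
    and closed: "\<zero>\<^bsub>A\<^esub> \<in> carrier A" "\<one>\<^bsub>A\<^esub> \<in> carrier A"
      "\<lbrakk>x \<in> carrier A; y \<in> carrier A\<rbrakk> \<Longrightarrow> x \<oplus>\<^bsub>A\<^esub> y \<in> carrier A"
      "\<lbrakk>x \<in> carrier A; y \<in> carrier A\<rbrakk> \<Longrightarrow> x \<otimes>\<^bsub>A\<^esub> y \<in> carrier A"
      "x \<in> carrier A \<Longrightarrow> a \<odot>\<^bsub>A\<^esub> x \<in> carrier A"
    and c_zero: "c \<zero>\<^bsub>A\<^esub> = (\<lambda>_. 0)" and c_one: "c \<one>\<^bsub>A\<^esub> = delta 0"
    and c_add: "\<lbrakk>x \<in> carrier A; y \<in> carrier A\<rbrakk> \<Longrightarrow> c (x \<oplus>\<^bsub>A\<^esub> y) = (\<lambda>t. c x t + c y t)"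
    and c_mult: "\<lbrakk>x \<in> carrier A; y \<in> carrier A\<rbrakk> \<Longrightarrow> c (x \<otimes>\<^bsub>A\<^esub> y) = tmul N m \<kappa> (c x) (c y)"
    and c_smult: "x \<in> carrier A \<Longrightarrow> c (a \<odot>\<^bsub>A\<^esub> x) = (\<lambda>t. a * c x t)"
begin

lemma c_in: "x \<in> carrier A \<Longrightarrow> c x \<in> fsupp N"
  using c_bij by (auto simp: bij_betw_def)

lemma c_eqI: "\<lbrakk>x \<in> carrier A; y \<in> carrier A; \<And>t. t < N \<Longrightarrow> c x t = c y t\<rbrakk> \<Longrightarrow> x = y"
proof -
  assume xy: "x \<in> carrier A" "y \<in> carrier A" and eq: "\<And>t. t < N \<Longrightarrow> c x t = c y t"
  have "c x = c y"
  proof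
    fix t show "c x t = c y t"
      using c_in[OF xy(1)] c_in[OF xy(2)] eq by (cases "t < N") (simp_all add: fsupp_def)
  qed
  then show "x = y" using c_bij xy by (auto simp: bij_betw_def inj_on_def)
qed

lemmas c_simps = closed c_zero c_one c_add c_mult c_smult

lemma abelian_group_A: "abelian_group A"
proof (rule abelian_groupI)
  fix x assume x: "x \<in> carrier A"
  have "(-1) \<odot>\<^bsub>A\<^esub> x \<oplus>\<^bsub>A\<^esub> x = \<zero>\<^bsub>A\<^esub>"
    using x by (intro c_eqI) (auto simp: c_simps)
  then show "\<exists>y\<in>carrier A. y \<oplus>\<^bsub>A\<^esub> x = \<zero>\<^bsub>A\<^esub>"
    using closed x by blast
qed (auto intro!: c_eqI simp: c_simps algebra_simps)

lemma ring_A: "ring A"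
proof (rule ringI[OF abelian_group_A])
  show "monoid A"
    by (rule monoidI)
      (auto intro!: c_eqI simp: c_simps tmul_assoc tmul_one_left tmul_one_right c_in)
qed (auto intro!: c_eqI simp: c_simps tmul_linear)

lemma module_A: "module kring A"
  by (rule module.intro[OF cring_kring abelian_group_A], unfold_locales)
    (auto intro!: c_eqI simp: c_simps algebra_simps)

lemma kalg_A: "kalg A"
  unfolding kalg_def using ring_A module_A
  by (auto intro!: c_eqI simp: c_simps tmul_linear)

lemma c_finsum:
  assumes "f \<in> S \<rightarrow> carrier A"
  shows "c (finsum A f S) t = (\<Sum>x\<in>S. c (f x) t)"
proof -
  interpret abelian_group A by (rule abelian_group_A)
  show ?thesis
  proof (cases "finite S")
    case True
    then show ?thesis using assms
      by (induction S) (auto simp: c_simps Pi_def intro!: finsum_closed)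
  next
    \<comment> \<open>Over an infinite index set both \<open>finsum\<close> and the sum in the field
      default to zero.\<close>
    case False
    then show ?thesis by (simp add: finsum_infinite c_zero)
  qed
qed

lemma finsum_in: "f \<in> S \<rightarrow> carrier A \<Longrightarrow> finsum A f S \<in> carrier A"
  using abelian_group_A by (simp add: abelian_group.axioms abelian_monoid.finsum_closed)

lemma c_minus:
  assumes x: "x \<in> carrier A" and y: "y \<in> carrier A"
  shows "c (x \<ominus>\<^bsub>A\<^esub> y) t = c x t - c y t"
proof -
  interpret abelian_group A by (rule abelian_group_A)
  have "c (\<ominus>\<^bsub>A\<^esub> y) t + c y t = c (\<ominus>\<^bsub>A\<^esub> y \<oplus>\<^bsub>A\<^esub> y) t"
    using y by (simp add: c_add)
  also have "\<dots> = 0" using y by (simp add: l_neg c_zero)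
  finally show ?thesis using x y
    by (simp add: a_minus_def c_add eq_neg_iff_add_eq_0 algebra_simps)
qed

lemma minus_in: "\<lbrakk>x \<in> carrier A; y \<in> carrier A\<rbrakk> \<Longrightarrow> x \<ominus>\<^bsub>A\<^esub> y \<in> carrier A"
  using abelian_group_A by (simp add: abelian_group.minus_closed)

definition vec :: "(nat \<Rightarrow> 'k) \<Rightarrow> 'a" where
  "vec f = inv_into (carrier A) c f"

lemma vec: "f \<in> fsupp N \<Longrightarrow> vec f \<in> carrier A" "f \<in> fsupp N \<Longrightarrow> c (vec f) = f"
  unfolding vec_def using c_bij
  by (auto simp: bij_betw_def inv_into_into f_inv_into_f)

end

text \<open>The function algebra is its own coordinate model, so the layer algebras are covered by
  the same machinery.\<close>

lemma (in twisted_monoid) coord_alg_talg: "coord_alg N m \<kappa> (talg N m \<kappa>) (\<lambda>x. x)"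
  using tmul_in delta_in[OF N_pos] by unfold_locales (auto simp: fsupp_def bij_betw_def)

lemma span_famI:
  "\<lbrakk>finite F; F \<subseteq> I; x = finsum A (\<lambda>k. r k \<odot>\<^bsub>A\<^esub> b k) F\<rbrakk> \<Longrightarrow> x \<in> span_fam A b I"
  unfolding span_fam_def by auto

context coord_alg
begin

text \<open>Swapping the two summations and substituting \<open>\<iota>\<close> in each variable
  turns the convolution of \<open>c x\<close> and \<open>c y\<close> at \<open>\<iota> u\<close>
  into the reversed convolution at \<open>u\<close>.\<close>

lemma anti_inv_coordI:
  assumes i_in: "\<And>x. x \<in> carrier A \<Longrightarrow> i x \<in> carrier A"
    and c_i: "\<And>x t. \<lbrakk>x \<in> carrier A; t < N\<rbrakk> \<Longrightarrow> c (i x) t = c x (\<iota> t)"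
    and iota_less: "\<And>t. t < N \<Longrightarrow> \<iota> t < N" and iota_iota: "\<And>t. t < N \<Longrightarrow> \<iota> (\<iota> t) = t"
    and iota_m: "\<And>s t. \<lbrakk>s < N; t < N\<rbrakk> \<Longrightarrow> \<iota> (m s t) = m (\<iota> t) (\<iota> s)"
    and iota_kappa: "\<And>s t. \<lbrakk>s < N; t < N\<rbrakk> \<Longrightarrow> \<kappa> (\<iota> t) (\<iota> s) = \<kappa> s t"
  shows "anti_inv A i"
proof -
  have bij: "bij_betw \<iota> {..<N} {..<N}"
    using iota_less iota_iota by (intro bij_betw_byWitness[where f' = \<iota>]) auto
  have "i (x \<otimes>\<^bsub>A\<^esub> y) = i y \<otimes>\<^bsub>A\<^esub> i x" if x: "x \<in> carrier A" and y: "y \<in> carrier A" for x y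
  proof (rule c_eqI)
    fix u assume u: "u < N"
    have eq: "m s t = \<iota> u \<longleftrightarrow> m (\<iota> t) (\<iota> s) = u" if "s < N" "t < N" for s t
      using that u iota_m iota_iota m_less by metis
    have "c (i (x \<otimes>\<^bsub>A\<^esub> y)) u = (\<Sum>s<N. \<Sum>t<N. if m s t = \<iota> u then \<kappa> s t * c x s * c y t else 0)"
      using x y u by (simp add: c_i c_simps tmul_def)
    also have "\<dots> = (\<Sum>t<N. \<Sum>s<N. if m s t = \<iota> u then \<kappa> s t * c x s * c y t else 0)"
      by (rule sum.swap)
    also have "\<dots> = (\<Sum>t<N. \<Sum>s<N. if m (\<iota> t) (\<iota> s) = u
        then \<kappa> (\<iota> t) (\<iota> s) * c y (\<iota> (\<iota> t)) * c x (\<iota> (\<iota> s)) else 0)"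
      by (intro sum.cong refl) (simp add: eq iota_kappa iota_iota)
    also have "\<dots> = (\<Sum>t<N. \<Sum>s<N. if m (\<iota> t) s = u then \<kappa> (\<iota> t) s * c y (\<iota> (\<iota> t)) * c x (\<iota> s) else 0)"
      by (intro sum.cong refl sum.reindex_bij_betw[OF bij, where g =
          "\<lambda>s. if m (\<iota> t) s = u then \<kappa> (\<iota> t) s * c y (\<iota> (\<iota> t)) * c x (\<iota> s) else 0" for t])
    also have "\<dots> = (\<Sum>t<N. \<Sum>s<N. if m t s = u then \<kappa> t s * c y (\<iota> t) * c x (\<iota> s) else 0)"
      by (rule sum.reindex_bij_betw[OF bij, where g =
          "\<lambda>t. \<Sum>s<N. if m t s = u then \<kappa> t s * c y (\<iota> t) * c x (\<iota> s) else 0"])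
    also have "\<dots> = c (i y \<otimes>\<^bsub>A\<^esub> i x) u"
      using x y by (simp add: c_mult tmul_def i_in) (intro sum.cong refl, simp add: c_i)
    finally show "c (i (x \<otimes>\<^bsub>A\<^esub> y)) u = c (i y \<otimes>\<^bsub>A\<^esub> i x) u" .
  qed (use x y in \<open>simp_all add: i_in closed\<close>)
  then show ?thesis
    unfolding anti_inv_def lin_map_def
    by (auto intro!: c_eqI simp: i_in c_i c_simps iota_less iota_iota)
qed

lemma fin_dim_A: "fin_dim A"
proof -
  let ?b = "\<lambda>t. vec (delta t)"
  let ?S = "?b ` {..<N}"
  have b: "?b t \<in> carrier A" "c (?b t) = delta t" if "t < N" for t
    using vec[OF delta_in[OF that]] .
  \<comment> \<open>\<open>fin_dim\<close> asks for a span of the identity family over a set of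
    elements, so a coefficient has to be found from the element itself; injectivity recovers its
    index.\<close>
  have inj: "inj_on ?b {..<N}"
  proof (rule inj_onI)
    fix s t assume "s \<in> {..<N}" "t \<in> {..<N}" "?b s = ?b t"
    then have "(delta s :: nat \<Rightarrow> 'k) = delta t" using b(2) by (metis lessThan_iff)
    then have "(delta s s :: 'k) = delta t s" by simp
    then show "s = t" by (simp add: delta_def split: if_splits)
  qed
  have "x \<in> span_fam A id ?S" if x: "x \<in> carrier A" for x
  proof -
    let ?f = "\<lambda>y. c x (inv_into {..<N} ?b y)"
    have "x = finsum A (\<lambda>y. ?f y \<odot>\<^bsub>A\<^esub> id y) ?S"
    proof (rule c_eqI[OF x finsum_in])
      fix t assume t: "t < N"
      have "c (finsum A (\<lambda>y. ?f y \<odot>\<^bsub>A\<^esub> id y) ?S) t = (\<Sum>y\<in>?S. ?f y * c y t)"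
        by (subst c_finsum) (auto simp: c_simps b intro!: sum.cong)
      also have "\<dots> = (\<Sum>s<N. c x s * delta s t)"
        by (subst sum.reindex[OF inj]) (auto simp: b inv_into_f_f[OF inj])
      also have "\<dots> = (\<Sum>s<N. if s = t then c x t else 0)"
        by (intro sum.cong) (auto simp: delta_def)
      also have "\<dots> = c x t" using t by simp
      finally show "c x t = c (finsum A (\<lambda>y. ?f y \<odot>\<^bsub>A\<^esub> id y) ?S) t" by simp
    qed (auto simp: closed b)
    then show ?thesis by (intro span_famI[where r = ?f and F = ?S]) auto
  qed
  moreover have "span_fam A id ?S \<subseteq> carrier A"
    unfolding span_fam_def by (auto intro!: finsum_in simp: closed b subset_iff image_iff)
  ultimately show ?thesis
    unfolding fin_dim_def using b by (intro exI[of _ ?S]) auto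
qed

end

section \<open>Iterated inflations\<close>

text \<open>The inflation data on basis indices: \<open>ix l p q h\<close> stands for
  \<open>v_p (x) v_q (x) h\<close>, with inverse coordinates \<open>lay\<close>, \<open>pp\<close>,
  \<open>qq\<close>, \<open>hh\<close>. By \<open>left\<close>, a left factor either moves the
  element out of layer \<open>l\<close>, or it keeps \<open>q\<close>, multiplies \<open>h\<close>
  on the left, and does so in a way depending on \<open>p\<close> alone. The scalar
  \<open>w l\<close> is the one in the square of the base element \<open>ix l 0 0 0\<close>.\<close>

locale layered_alg = coord_alg N m \<kappa> A c
  for N m and \<kappa> :: "nat \<Rightarrow> nat \<Rightarrow> 'k::field" and A :: "('k, 'a) module" and c +
  fixes i :: "'a \<Rightarrow> 'a" and \<iota> jb :: "nat \<Rightarrow> nat" and mb :: "nat \<Rightarrow> nat \<Rightarrow> nat"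
    and n :: nat and np nb :: "nat \<Rightarrow> nat"
    and ix :: "nat \<Rightarrow> nat \<Rightarrow> nat \<Rightarrow> nat \<Rightarrow> nat" and lay pp qq hh :: "nat \<Rightarrow> nat" and w :: "nat \<Rightarrow> 'k"
  assumes anti_inv: "anti_inv A i"
    and c_i: "\<And>x t. \<lbrakk>x \<in> carrier A; t < N\<rbrakk> \<Longrightarrow> c (i x) t = c x (\<iota> t)"
    and iota_m: "\<And>s t. \<lbrakk>s < N; t < N\<rbrakk> \<Longrightarrow> \<iota> (m s t) = m (\<iota> t) (\<iota> s)"
    and iota_kappa: "\<And>s t. \<lbrakk>s < N; t < N\<rbrakk> \<Longrightarrow> \<kappa> (\<iota> t) (\<iota> s) = \<kappa> s t"
    and jb: "\<And>l h. \<lbrakk>1 \<le> l; l \<le> n; h < nb l\<rbrakk> \<Longrightarrow> jb h < nb l \<and> jb (jb h) = h" and jb_0: "jb 0 = 0"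
    and jb_mb: "\<And>l h h'. \<lbrakk>1 \<le> l; l \<le> n; h < nb l; h' < nb l\<rbrakk> \<Longrightarrow> jb (mb h h') = mb (jb h') (jb h)"
    and B_monoid: "\<And>l. \<lbrakk>1 \<le> l; l \<le> n\<rbrakk> \<Longrightarrow> twisted_monoid (nb l) mb (\<lambda>_ _. 1 :: 'k)"
    and B_cellular: "\<And>l. \<lbrakk>1 \<le> l; l \<le> n\<rbrakk> \<Longrightarrow>
      cellular (talg (nb l) mb (\<lambda>_ _. 1 :: 'k)) (\<lambda>x h. if h < nb l then x (jb h) else 0)"
    and np_pos: "\<And>l. \<lbrakk>1 \<le> l; l \<le> n\<rbrakk> \<Longrightarrow> 0 < np l"
    and ix: "\<And>l p q h. \<lbrakk>1 \<le> l; l \<le> n; p < np l; q < np l; h < nb l\<rbrakk> \<Longrightarrow> ix l p q h < N \<and>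
      lay (ix l p q h) = l \<and> pp (ix l p q h) = p \<and> qq (ix l p q h) = q \<and> hh (ix l p q h) = h"
    and co: "\<And>t. t < N \<Longrightarrow> 1 \<le> lay t \<and> lay t \<le> n \<and> pp t < np (lay t) \<and> qq t < np (lay t) \<and>
      hh t < nb (lay t) \<and> ix (lay t) (pp t) (qq t) (hh t) = t"
    and iota_ix: "\<And>l p q h. \<lbrakk>1 \<le> l; l \<le> n; p < np l; q < np l; h < nb l\<rbrakk> \<Longrightarrow>
      \<iota> (ix l p q h) = ix l q p (jb h)"
    and lay_m: "\<And>s t. \<lbrakk>s < N; t < N\<rbrakk> \<Longrightarrow> lay (m s t) \<le> lay s \<and> lay (m s t) \<le> lay t"
    and left: "\<And>s l p q h. \<lbrakk>s < N; 1 \<le> l; l \<le> n; p < np l; q < np l; h < nb l\<rbrakk> \<Longrightarrow>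
      (if lay (m s (ix l p 0 0)) = l
       then m s (ix l p q h) = ix l (pp (m s (ix l p 0 0))) q (mb (hh (m s (ix l p 0 0))) h) \<and>
            \<kappa> s (ix l p q h) = \<kappa> s (ix l p 0 0)
       else lay (m s (ix l p q h)) \<noteq> l)"
    and w_nonzero: "\<And>l. w l \<noteq> 0"
    and idem: "\<And>k l. \<lbrakk>1 \<le> k; k \<le> l; l \<le> n\<rbrakk> \<Longrightarrow>
      m (ix l 0 0 0) (ix k 0 0 0) = ix k 0 0 0 \<and> m (ix k 0 0 0) (ix l 0 0 0) = ix k 0 0 0 \<and>
      \<kappa> (ix l 0 0 0) (ix k 0 0 0) = w l \<and> \<kappa> (ix k 0 0 0) (ix l 0 0 0) = w l"
begin

abbreviation B :: "nat \<Rightarrow> ('k, nat \<Rightarrow> 'k) module" where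
  "B l \<equiv> talg (nb l) mb (\<lambda>_ _. 1)"

abbreviation bm :: "nat \<Rightarrow> (nat \<Rightarrow> 'k) \<Rightarrow> (nat \<Rightarrow> 'k) \<Rightarrow> nat \<Rightarrow> 'k" where
  "bm l \<equiv> tmul (nb l) mb (\<lambda>_ _. 1)"

definition j :: "nat \<Rightarrow> (nat \<Rightarrow> 'k) \<Rightarrow> nat \<Rightarrow> 'k" where
  "j l x = (\<lambda>h. if h < nb l then x (jb h) else 0)"

definition Theta :: "nat \<Rightarrow> nat \<Rightarrow> nat \<Rightarrow> (nat \<Rightarrow> 'k) \<Rightarrow> 'a" where
  "Theta l p q x = vec (\<lambda>t. if t < N \<and> lay t = l \<and> pp t = p \<and> qq t = q then x (hh t) else 0)"

text \<open>The form is read off from the product of \<open>v_0 (x) v_q (x) 1\<close> and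
  \<open>v_p (x) v_0 (x) 1\<close>: the inner label with its scalar if the product stays in the
  layer, zero if it drops.\<close>

definition Phi :: "nat \<Rightarrow> nat \<Rightarrow> nat \<Rightarrow> nat \<Rightarrow> 'k" where
  "Phi l q p = (if lay (m (ix l 0 q 0) (ix l p 0 0)) = l
     then (\<lambda>h. \<kappa> (ix l 0 q 0) (ix l p 0 0) * delta (hh (m (ix l 0 q 0) (ix l p 0 0))) h) else (\<lambda>_. 0))"

text \<open>Vanishing coordinates are easier to test than membership in a span;
  \<open>J_eq_span\<close> recovers the spans of the target definition.\<close>

definition J :: "nat \<Rightarrow> 'a set" where
  "J l = {a \<in> carrier A. \<forall>t<N. l < lay t \<longrightarrow> c a t = 0}"

lemma nb_pos: "\<lbrakk>1 \<le> l; l \<le> n\<rbrakk> \<Longrightarrow> 0 < nb l"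
  using B_monoid twisted_monoid.N_pos by blast

lemma ix_eq_iff:
  assumes "1 \<le> l" "l \<le> n" "p < np l" "q < np l" "h < nb l" and "t < N" "lay t = l"
  shows "ix l p q h = t \<longleftrightarrow> pp t = p \<and> qq t = q \<and> h = hh t"
  using ix[OF assms(1-5)] co[OF assms(6)] assms(7) by metis

text \<open>The right-handed version of the assumption \<open>left\<close> is obtained by applying \<open>\<iota>\<close>; together they
  determine the products within a layer.\<close>

lemma mid:
  assumes l: "1 \<le> l" "l \<le> n" "p < np l" "q < np l" "h < nb l" and l': "p' < np l" "q' < np l" "h' < nb l"
  shows "if lay (m (ix l 0 q 0) (ix l p' 0 0)) = l
    then m (ix l p q h) (ix l p' q' h') = ix l p q' (mb (mb h (hh (m (ix l 0 q 0) (ix l p' 0 0)))) h') \<and>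
         \<kappa> (ix l p q h) (ix l p' q' h') = \<kappa> (ix l 0 q 0) (ix l p' 0 0)
    else lay (m (ix l p q h) (ix l p' q' h')) \<noteq> l"
proof -
  interpret B: twisted_monoid "nb l" mb "\<lambda>_ _. 1 :: 'k" using B_monoid l by simp
  note pos = np_pos[OF l(1,2)] nb_pos[OF l(1,2)]
  define r where "r = m (ix l 0 q 0) (ix l p' 0 0)"
  \<comment> \<open>In \<open>u\<close> the right factor is stripped to its base column;
    \<open>left\<close> attaches \<open>q'\<close> and \<open>h'\<close> afterwards. The effect of
    \<open>p\<close> and \<open>h\<close> is found from \<open>\<iota> u\<close>, where these labels
    sit on the right and \<open>left\<close> applies again.\<close>
  define u where "u = m (ix l p q h) (ix l p' 0 0)"
  define v where "v = m (ix l 0 p' 0) (ix l q 0 0)"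
  have less: "ix l p q h < N" "ix l 0 q 0 < N" "ix l p' 0 0 < N" "ix l 0 p' 0 < N" "ix l q 0 0 < N"
    "ix l q p (jb h) < N"
    using ix l l' pos jb by simp_all
  have rN: "r < N" and uN: "u < N" and vN: "v < N" unfolding r_def u_def v_def using less m_less by simp_all
  have iota_co: "lay (\<iota> t) = lay t \<and> pp (\<iota> t) = qq t \<and> qq (\<iota> t) = pp t \<and> hh (\<iota> t) = jb (hh t)" if "t < N" for t
    using co[OF that] iota_ix[of "lay t" "pp t" "qq t" "hh t"] jb[of "lay t" "hh t"]
      ix[of "lay t" "qq t" "pp t" "jb (hh t)"] by simp
  have iu: "\<iota> u = m (ix l 0 p' 0) (ix l q p (jb h))" and ir: "\<iota> r = v"
    unfolding u_def r_def v_def using less l l' pos by (simp_all add: iota_m iota_ix jb_0)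
  have ku: "\<kappa> (ix l p q h) (ix l p' 0 0) = \<kappa> (ix l 0 p' 0) (ix l q p (jb h))"
    and kr: "\<kappa> (ix l 0 q 0) (ix l p' 0 0) = \<kappa> (ix l 0 p' 0) (ix l q 0 0)"
    using iota_kappa[OF less(1,3)] iota_kappa[OF less(2,3)] l l' pos by (simp_all add: iota_ix jb_0)
  have jh: "jb h < nb l" "jb (jb h) = h" using jb[OF l(1,2,5)] by simp_all
  have right: "if lay v = l then \<iota> u = ix l (pp v) p (mb (hh v) (jb h)) \<and>
      \<kappa> (ix l 0 p' 0) (ix l q p (jb h)) = \<kappa> (ix l 0 p' 0) (ix l q 0 0) else lay (\<iota> u) \<noteq> l"
    unfolding iu v_def by (rule left[OF less(4) l(1,2,4,3) jh(1)])
  have fac: "if lay u = l then m (ix l p q h) (ix l p' q' h') = ix l (pp u) q' (mb (hh u) h') \<and>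
      \<kappa> (ix l p q h) (ix l p' q' h') = \<kappa> (ix l p q h) (ix l p' 0 0)
    else lay (m (ix l p q h) (ix l p' q' h')) \<noteq> l"
    unfolding u_def by (rule left[OF less(1) l(1,2) l'])
  show ?thesis
  proof (cases "lay r = l")
    case True
    then have lv: "lay v = l" and hv: "hh v = jb (hh r)" using iota_co[OF rN] ir by simp_all
    have hr: "hh r < nb l" using co[OF rN] True by simp
    have v_co: "pp v < np l" "hh v < nb l" using co[OF vN] lv by simp_all
    have g: "mb (hh v) (jb h) < nb l" using B.m_less v_co jh by simp
    have iu_eq: "\<iota> u = ix l (pp v) p (mb (hh v) (jb h))"
      and kv: "\<kappa> (ix l 0 p' 0) (ix l q p (jb h)) = \<kappa> (ix l 0 p' 0) (ix l q 0 0)" using right lv by simp_all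
    have iu_co: "lay (\<iota> u) = l" "qq (\<iota> u) = p" "hh (\<iota> u) = mb (hh v) (jb h)"
      unfolding iu_eq using ix[OF l(1,2) v_co(1) l(3) g] by simp_all
    have lu: "lay u = l" and pu: "pp u = p" using iota_co[OF uN] iu_co by simp_all
    have hu: "hh u < nb l" using co[OF uN] lu by simp
    have "jb (hh u) = mb (hh v) (jb h)" using iota_co[OF uN] iu_co by simp
    then have "hh u = jb (mb (hh v) (jb h))" using jb[OF l(1,2) hu] by simp
    also have "\<dots> = mb h (hh r)"
      using jb_mb[OF l(1,2) v_co(2) jh(1)] jh(2) jb[OF l(1,2) hr] hv by simp
    finally show ?thesis using fac lu pu True ku kr kv by (simp add: r_def[symmetric])
  next
    case False
    then have "lay (\<iota> u) \<noteq> l" using right iota_co[OF rN] ir by simp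
    then show ?thesis using fac iota_co[OF uN] False by (simp add: r_def)
  qed
qed

section \<open>Layer embeddings and the ideals they span\<close>

lemma Theta_in [simp]: "Theta l p q x \<in> carrier A"
  and c_Theta: "c (Theta l p q x) t =
    (if t < N \<and> lay t = l \<and> pp t = p \<and> qq t = q then x (hh t) else 0)"
proof -
  have "(\<lambda>t. if t < N \<and> lay t = l \<and> pp t = p \<and> qq t = q then x (hh t) else 0) \<in> fsupp N"
    by (auto simp: fsupp_def)
  from vec[OF this] show "Theta l p q x \<in> carrier A"
    "c (Theta l p q x) t = (if t < N \<and> lay t = l \<and> pp t = p \<and> qq t = q then x (hh t) else 0)"
    unfolding Theta_def by auto
qed

lemma sum_Theta:
  assumes l: "1 \<le> l" "l \<le> n" "p < np l" "q < np l"
  shows "(\<Sum>t<N. c (Theta l p q x) t * F t) = (\<Sum>h<nb l. x h * F (ix l p q h))"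
proof -
  have inj: "inj_on (ix l p q) {..<nb l}"
    using ix[OF l] by (metis inj_onI lessThan_iff)
  have "(\<Sum>t<N. c (Theta l p q x) t * F t) = (\<Sum>t\<in>ix l p q ` {..<nb l}. c (Theta l p q x) t * F t)"
  proof (rule sum.mono_neutral_right)
    show "\<forall>t\<in>{..<N} - ix l p q ` {..<nb l}. c (Theta l p q x) t * F t = 0"
      unfolding c_Theta using co by (auto simp: image_iff) (metis lessThan_iff)
  qed (use ix[OF l] in auto)
  also have "\<dots> = (\<Sum>h<nb l. x h * F (ix l p q h))"
    unfolding sum.reindex[OF inj] using ix[OF l] by (intro sum.cong refl) (simp add: c_Theta)
  finally show ?thesis .
qed

lemma c_mult_Theta:
  assumes a: "a \<in> carrier A" and l: "1 \<le> l" "l \<le> n" "p < np l" "q < np l"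
  shows "c (a \<otimes>\<^bsub>A\<^esub> Theta l p q x) t =
    (\<Sum>s<N. c a s * (\<Sum>h<nb l. x h * (if m s (ix l p q h) = t then \<kappa> s (ix l p q h) else 0)))"
proof -
  have "c (a \<otimes>\<^bsub>A\<^esub> Theta l p q x) t =
    (\<Sum>s<N. c a s * (\<Sum>u<N. c (Theta l p q x) u * (if m s u = t then \<kappa> s u else 0)))"
    using a by (simp add: c_mult tmul_def sum_distrib_left) (intro sum.cong refl, auto)
  then show ?thesis by (simp add: sum_Theta[OF l])
qed

text \<open>The supports of the embedded summands are disjoint, so at coordinate \<open>t\<close>
  only the summand labelled by \<open>t\<close> survives. The cut-off \<open>L\<close> serves the
  ideals and, with \<open>L = n\<close>, the whole algebra.\<close>

lemma sum_lay_delta: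
  assumes "t < N"
  shows "(\<Sum>(l, p, q)\<in>{(l, p, q). l \<in> {1..L} \<and> p < np l \<and> q < np l}. c (Theta l p q (X l p q)) t) =
    (if lay t \<le> L then X (lay t) (pp t) (qq t) (hh t) else 0)" (is "sum ?f ?I = _")
proof -
  have I: "?I = (SIGMA l:{1..L}. {..<np l} \<times> {..<np l})" by auto
  have fin: "finite ?I" unfolding I by auto
  have "sum ?f ?I = (\<Sum>k\<in>?I. if k = (lay t, pp t, qq t) then X (lay t) (pp t) (qq t) (hh t) else 0)"
    by (intro sum.cong refl) (auto simp: c_Theta assms split: if_splits)
  also have "\<dots> = (if lay t \<le> L then X (lay t) (pp t) (qq t) (hh t) else 0)"
    using co[OF assms] by (subst sum.delta[OF fin]) auto
  finally show ?thesis .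
qed

lemma decomp:
  assumes "a \<in> J L"
  shows "a = finsum A (\<lambda>(l, p, q). Theta l p q (\<lambda>h. if h < nb l then c a (ix l p q h) else 0))
    {(l, p, q). l \<in> {1..L} \<and> p < np l \<and> q < np l}" (is "a = finsum A ?f ?I")
proof (rule c_eqI)
  show "a \<in> carrier A" using assms by (simp add: J_def)
  show "finsum A ?f ?I \<in> carrier A" by (rule finsum_in) auto
  fix t assume t: "t < N"
  have "c (finsum A ?f ?I) t = (\<Sum>(l, p, q)\<in>?I. c (Theta l p q
      ((\<lambda>l p q h. if h < nb l then c a (ix l p q h) else 0) l p q)) t)"
    by (subst c_finsum) (auto intro!: sum.cong)
  also have "\<dots> = c a t"
    using assms co[OF t] t unfolding sum_lay_delta[OF t] by (simp add: J_def)
  finally show "c a t = c (finsum A ?f ?I) t" by simp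
qed

lemma J_eq_span: "span_fam A (\<lambda>(l, p, q, x). Theta l p q x)
    {(l, p, q, x). 1 \<le> l \<and> l \<le> L \<and> p \<in> {..<np l} \<and> q \<in> {..<np l} \<and> x \<in> carrier (B l)} = J L"
  (is "span_fam A ?T ?K = _")
proof (intro equalityI subsetI)
  fix a assume "a \<in> span_fam A ?T ?K"
  then obtain r F where F: "F \<subseteq> ?K" and a: "a = finsum A (\<lambda>k. r k \<odot>\<^bsub>A\<^esub> ?T k) F"
    by (auto simp: span_fam_def)
  have in_A: "(\<lambda>k. r k \<odot>\<^bsub>A\<^esub> ?T k) \<in> F \<rightarrow> carrier A" by (auto simp: closed)
  have "c a t = 0" if "t < N" "L < lay t" for t
    unfolding a c_finsum[OF in_A] using F that
    by (intro sum.neutral) (auto simp: c_smult c_Theta)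
  then show "a \<in> J L" using finsum_in[OF in_A] by (simp add: J_def a)
next
  fix a assume a: "a \<in> J L"
  let ?X = "\<lambda>l p q h. if h < nb l then c a (ix l p q h) else 0"
  let ?I = "{(l, p, q). l \<in> {1..L} \<and> p < np l \<and> q < np l}"
  \<comment> \<open>The spanning family is indexed by the vectors \<open>x\<close> themselves, so
    each component of \<open>a\<close> is placed in its own index and taken with scalar 1.\<close>
  let ?g = "\<lambda>(l, p, q). (l, p, q, ?X l p q)"
  have "?I = (SIGMA l:{1..L}. {..<np l} \<times> {..<np l})" by auto
  then have fin: "finite ?I" by auto
  have inj: "inj_on ?g ?I" by (auto simp: inj_on_def)
  have in_A: "(\<lambda>k. 1 \<odot>\<^bsub>A\<^esub> ?T k) \<in> ?g ` ?I \<rightarrow> carrier A" by (auto simp: closed)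
  have "a = finsum A (\<lambda>k. (\<lambda>_. 1) k \<odot>\<^bsub>A\<^esub> ?T k) (?g ` ?I)"
  proof (rule c_eqI[OF _ finsum_in[OF in_A]])
    show "a \<in> carrier A" using a by (simp add: J_def)
    fix t assume t: "t < N"
    have "c (finsum A (\<lambda>k. 1 \<odot>\<^bsub>A\<^esub> ?T k) (?g ` ?I)) t = (\<Sum>(l, p, q)\<in>?I. c (Theta l p q (?X l p q)) t)"
      unfolding c_finsum[OF in_A] sum.reindex[OF inj]
      by (intro sum.cong refl) (auto simp: c_smult)
    also have "\<dots> = c a t"
      using a co[OF t] t unfolding sum_lay_delta[OF t, of ?X] by (simp add: J_def)
    finally show "c a t = c (finsum A (\<lambda>k. 1 \<odot>\<^bsub>A\<^esub> ?T k) (?g ` ?I)) t" by simp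
  qed
  moreover have "?g ` ?I \<subseteq> ?K" by (auto simp: fsupp_def)
  ultimately show "a \<in> span_fam A ?T ?K"
    using fin by (intro span_famI[where r = "\<lambda>_. 1" and F = "?g ` ?I"]) auto
qed

text \<open>By \<open>lay_m\<close> a product lies no higher than either factor, so a coordinate
  above \<open>L\<close> only involves coordinates of \<open>a\<close> above
  \<open>L\<close>.\<close>

lemma ideal_J: "ideal (J L) A"
proof (rule idealI[OF ring_A])
  interpret abelian_group A by (rule abelian_group_A)
  show "subgroup (J L) (add_monoid A)"
  proof (rule add.subgroupI)
    fix a assume a: "a \<in> J L"
    have "c (\<ominus>\<^bsub>A\<^esub> a) t = - c a t" if "t < N" for t
    proof -
      have "c (\<zero>\<^bsub>A\<^esub> \<ominus>\<^bsub>A\<^esub> a) t = - c a t" using a by (simp add: c_minus closed c_zero J_def)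
      then show ?thesis using a by (simp add: a_minus_def J_def)
    qed
    then show "\<ominus>\<^bsub>A\<^esub> a \<in> J L" using a by (simp add: J_def)
  qed (auto simp: J_def c_simps intro: exI[of _ "\<zero>\<^bsub>A\<^esub>"])
next
  fix a x assume a: "a \<in> J L" and x: "x \<in> carrier A"
  have "c (x \<otimes>\<^bsub>A\<^esub> a) t = 0" "c (a \<otimes>\<^bsub>A\<^esub> x) t = 0" if "t < N" "L < lay t" for t
  proof -
    have "c a s = 0" if "s < N" "lay t \<le> lay s" for s
      using a that \<open>L < lay t\<close> by (simp add: J_def)
    then show "c (x \<otimes>\<^bsub>A\<^esub> a) t = 0" "c (a \<otimes>\<^bsub>A\<^esub> x) t = 0"
      using a x lay_m by (auto simp: J_def c_mult tmul_def intro!: sum.neutral)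
  qed
  then show "x \<otimes>\<^bsub>A\<^esub> a \<in> J L" "a \<otimes>\<^bsub>A\<^esub> x \<in> J L"
    using a x by (auto simp: J_def closed)
qed

text \<open>Reduces the congruences modulo lower layers in the inflation axioms to a comparison of
  coordinates in the layers from \<open>l\<close> upwards.\<close>

lemma diff_in_J:
  assumes "x \<in> carrier A" "y \<in> carrier A" "1 \<le> l"
    and "\<And>t. t < N \<Longrightarrow> l < lay t \<Longrightarrow> c x t = 0 \<and> c y t = 0"
    and "\<And>t. t < N \<Longrightarrow> lay t = l \<Longrightarrow> c x t = c y t"
  shows "x \<ominus>\<^bsub>A\<^esub> y \<in> J (l - 1)"
proof -
  have "c x t = c y t" if "t < N" "l - 1 < lay t" for t
    using that assms(3) assms(4,5)[of t] by (cases "lay t = l") auto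
  then show ?thesis by (auto simp: J_def assms(1,2) minus_in c_minus)
qed

lemma c_mult_Theta_above:
  assumes "a \<in> carrier A" and "t < N" "l < lay t"
  shows "c (a \<otimes>\<^bsub>A\<^esub> Theta l p q x) t = 0"
proof -
  have "m s u \<noteq> t" if "s < N" "u < N" "lay u = l" for s u
    using lay_m[OF that(1,2)] that assms by auto
  then show ?thesis using assms by (auto simp: c_mult tmul_def c_Theta intro!: sum.neutral)
qed

text \<open>By \<open>mid\<close> the product of two basis elements is governed by the middle
  product \<open>u\<close>. If \<open>u\<close> stays in layer \<open>l\<close>, the factor
  \<open>k * delta (hh u)\<close> appears between \<open>x\<close> and \<open>y\<close>; otherwise
  both sides vanish on the layer.\<close>

lemma inflation_mult:
  assumes l: "1 \<le> l" "l \<le> n" "p < np l" "q < np l" and l': "p' < np l" "q' < np l"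
  shows "Theta l p q x \<otimes>\<^bsub>A\<^esub> Theta l p' q' y \<ominus>\<^bsub>A\<^esub>
      Theta l p q' (bm l (bm l x (Phi l q p')) y) \<in> J (l - 1)"
proof (rule diff_in_J)
  interpret B: twisted_monoid "nb l" mb "\<lambda>_ _. 1 :: 'k" using B_monoid l by simp
  fix t assume t: "t < N" and lt: "lay t = l"
  define u where "u = m (ix l 0 q 0) (ix l p' 0 0)"
  define k where "k = \<kappa> (ix l 0 q 0) (ix l p' 0 0)"
  have u_less: "u < N" unfolding u_def using l l' np_pos nb_pos ix m_less by simp
  have lhs: "c (Theta l p q x \<otimes>\<^bsub>A\<^esub> Theta l p' q' y) t = (\<Sum>h<nb l. x h * (\<Sum>h'<nb l. y h' *
      (if m (ix l p q h) (ix l p' q' h') = t then \<kappa> (ix l p q h) (ix l p' q' h') else 0)))"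
    unfolding c_mult_Theta[OF Theta_in l(1,2) l'] sum_Theta[OF l] ..
  show "c (Theta l p q x \<otimes>\<^bsub>A\<^esub> Theta l p' q' y) t =
    c (Theta l p q' (bm l (bm l x (Phi l q p')) y)) t"
  proof (cases "lay u = l")
    case True
    then have g: "hh u < nb l" using co[OF u_less] by simp
    have Phi: "Phi l q p' = (\<lambda>h. k * delta (hh u) h)"
      using True by (simp add: Phi_def u_def k_def)
    have eq: "m (ix l p q h) (ix l p' q' h') = t \<longleftrightarrow> pp t = p \<and> qq t = q' \<and> mb (mb h (hh u)) h' = hh t"
      "\<kappa> (ix l p q h) (ix l p' q' h') = k" if "h < nb l" "h' < nb l" for h h'
    proof -
      have *: "m (ix l p q h) (ix l p' q' h') = ix l p q' (mb (mb h (hh u)) h')"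
          "\<kappa> (ix l p q h) (ix l p' q' h') = k"
        using mid[OF l that(1) l' that(2)] True by (simp_all add: u_def k_def)
      have "mb (mb h (hh u)) h' < nb l" using that g B.m_less by simp
      then show "m (ix l p q h) (ix l p' q' h') = t \<longleftrightarrow>
            pp t = p \<and> qq t = q' \<and> mb (mb h (hh u)) h' = hh t"
          "\<kappa> (ix l p q h) (ix l p' q' h') = k"
        using ix_eq_iff[OF l(1,2,3) l'(2) _ t lt] * by simp_all
    qed
    have "bm l (bm l x (Phi l q p')) y v =
      (\<Sum>h<nb l. x h * (\<Sum>h'<nb l. y h' * (if mb (mb h (hh u)) h' = v then k else 0)))" for v
    proof -
      have "bm l (bm l x (Phi l q p')) y v =
        k * (\<Sum>s<nb l. bm l x (delta (hh u)) s * (\<Sum>h'<nb l. if mb s h' = v then y h' else 0))"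
        unfolding Phi tmul_linear
        unfolding tmul_def[of _ _ _ "bm l x (delta (hh u))"] sum_distrib_left
        by (intro sum.cong refl) auto
      also have "\<dots> = k * (\<Sum>h<nb l. \<Sum>g<nb l. if g = hh u then
          x h * (\<Sum>h'<nb l. if mb (mb h (hh u)) h' = v then y h' else 0) else 0)"
        unfolding B.sum_tmul
        by (intro arg_cong[where f = "(*) k"] sum.cong refl) (auto simp: delta_def)
      also have "\<dots> = (\<Sum>h<nb l. x h * (\<Sum>h'<nb l. y h' * (if mb (mb h (hh u)) h' = v then k else 0)))"
        using g by (simp add: sum_distrib_left) (intro sum.cong refl, auto)
      finally show ?thesis .
    qed
    moreover have "c (Theta l p q x \<otimes>\<^bsub>A\<^esub> Theta l p' q' y) t = (\<Sum>h<nb l. x h * (\<Sum>h'<nb l. y h' *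
      (if pp t = p \<and> qq t = q' \<and> mb (mb h (hh u)) h' = hh t then k else 0)))"
      unfolding lhs by (intro sum.cong refl arg_cong2[where f = "(*)"]) (simp add: eq)
    ultimately show ?thesis
      unfolding c_Theta using t lt
      by (cases "pp t = p \<and> qq t = q'") (simp, auto intro!: sum.neutral)
  next
    case False
    then have Phi: "Phi l q p' = (\<lambda>_. 0)" by (simp add: Phi_def u_def)
    have "m (ix l p q h) (ix l p' q' h') \<noteq> t" if "h < nb l" "h' < nb l" for h h'
      using mid[OF l that(1) l' that(2)] False lt by (auto simp: u_def)
    then have "c (Theta l p q x \<otimes>\<^bsub>A\<^esub> Theta l p' q' y) t = 0"
      unfolding lhs by (auto intro!: sum.neutral)
    then show ?thesis unfolding c_Theta Phi by (auto simp: tmul_def intro!: sum.neutral)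
  qed
qed (use l c_mult_Theta_above in \<open>auto simp: closed c_Theta\<close>)

text \<open>Since the action ignores the second label and commutes with right multiplication by
  \<open>B l\<close>, its coefficient in row \<open>p'\<close> can be read off at
  \<open>q = 0\<close> and \<open>x = 1\<close>.\<close>

definition left_coeff :: "'a \<Rightarrow> nat \<Rightarrow> nat \<Rightarrow> nat \<Rightarrow> nat \<Rightarrow> 'k" where
  "left_coeff a l p p' h =
     (if h < nb l then c (a \<otimes>\<^bsub>A\<^esub> Theta l p 0 (delta 0)) (ix l p' 0 h) else 0)"

lemma left_action:
  assumes a: "a \<in> carrier A" and l: "1 \<le> l" "l \<le> n" "p < np l" "q < np l"
  shows "a \<otimes>\<^bsub>A\<^esub> Theta l p q x \<ominus>\<^bsub>A\<^esub>
      finsum A (\<lambda>p'. Theta l p' q (bm l (left_coeff a l p p') x)) {..<np l} \<in> J (l - 1)"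
    (is "_ \<ominus>\<^bsub>A\<^esub> finsum A ?f _ \<in> _")
proof (rule diff_in_J)
  interpret B: twisted_monoid "nb l" mb "\<lambda>_ _. 1 :: 'k" using B_monoid l by simp
  have f_in: "?f \<in> {..<np l} \<rightarrow> carrier A" by simp
  show "finsum A ?f {..<np l} \<in> carrier A" by (rule finsum_in[OF f_in])
  {
    fix t assume "t < N" "l < lay t"
    then show "c (a \<otimes>\<^bsub>A\<^esub> Theta l p q x) t = 0 \<and> c (finsum A ?f {..<np l}) t = 0"
      using c_mult_Theta_above[OF a] by (auto simp: c_finsum[OF f_in] c_Theta)
  }
  fix t assume t: "t < N" and lt: "lay t = l"
  define u where "u s = m s (ix l p 0 0)" for s
  define k where "k s = \<kappa> s (ix l p 0 0)" for s
  \<comment> \<open>\<open>G h1\<close> is the coordinate at \<open>hh t\<close> of the product of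
    basis element \<open>h1\<close> with \<open>x\<close> in \<open>B l\<close>.\<close>
  define G where "G h1 = (\<Sum>h<nb l. if mb h1 h = hh t then x h else 0)" for h1
  have pos: "0 < np l" "0 < nb l" using l np_pos nb_pos by auto
  have u_less: "u s < N" if "s < N" for s unfolding u_def using that l pos ix m_less by simp
  have cot: "pp t < np l" "qq t < np l" "hh t < nb l" "ix l (pp t) (qq t) (hh t) = t"
    using co[OF t] lt by auto
  have u_eq: "u s = ix l (pp (u s)) 0 (hh (u s))" "hh (u s) < nb l" "pp (u s) < np l"
    if "s < N" "lay (u s) = l" for s
  proof -
    show h: "hh (u s) < nb l" "pp (u s) < np l" using co[OF u_less] that by auto
    have "u s = ix l (pp (u s)) 0 (mb (hh (u s)) 0)"
      using left[OF that(1) l(1,2,3) pos] that(2) by (simp add: u_def)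
    then show "u s = ix l (pp (u s)) 0 (hh (u s))" using B.m_unit h by simp
  qed
  have coeff: "left_coeff a l p p' h1 =
      (\<Sum>s<N. if lay (u s) = l \<and> pp (u s) = p' \<and> hh (u s) = h1 then k s * c a s else 0)"
    if p': "p' < np l" and h1: "h1 < nb l" for p' h1
  proof -
    have "left_coeff a l p p' h1 = (\<Sum>s<N. c a s * (\<Sum>h<nb l. delta 0 h *
        (if m s (ix l p 0 h) = ix l p' 0 h1 then \<kappa> s (ix l p 0 h) else 0)))"
      unfolding left_coeff_def c_mult_Theta[OF a l(1,2,3) pos(1)] using h1 by simp
    also have "\<dots> = (\<Sum>s<N. c a s * (\<Sum>h<nb l. if h = 0 then
        (if u s = ix l p' 0 h1 then k s else 0) else 0))"
      by (intro sum.cong refl arg_cong2[where f = "(*)"]) (auto simp: delta_def u_def k_def)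
    also have "\<dots> = (\<Sum>s<N. if u s = ix l p' 0 h1 then k s * c a s else 0)"
      using pos by (intro sum.cong refl) auto
    also have "\<dots> = (\<Sum>s<N. if lay (u s) = l \<and> pp (u s) = p' \<and> hh (u s) = h1 then k s * c a s else 0)"
    proof (intro sum.cong refl)
      fix s assume "s \<in> {..<N}"
      then have "u s = ix l p' 0 h1 \<longleftrightarrow> lay (u s) = l \<and> pp (u s) = p' \<and> hh (u s) = h1"
        using u_eq[of s] ix[OF l(1,2) p' pos(1) h1] by auto
      then show "(if u s = ix l p' 0 h1 then k s * c a s else 0) =
          (if lay (u s) = l \<and> pp (u s) = p' \<and> hh (u s) = h1 then k s * c a s else 0)" by simp
    qed
    finally show ?thesis .
  qed
  have "bm l (left_coeff a l p (pp t)) x (hh t) = (\<Sum>h1<nb l. left_coeff a l p (pp t) h1 * G h1)"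
    unfolding tmul_def G_def sum_distrib_left by (intro sum.cong refl) auto
  also have "\<dots> = (\<Sum>h1<nb l. \<Sum>s<N.
      if lay (u s) = l \<and> pp (u s) = pp t \<and> hh (u s) = h1 then k s * c a s * G h1 else 0)"
    by (intro sum.cong refl) (auto simp: coeff cot sum_distrib_right intro!: sum.cong)
  also have "\<dots> = (\<Sum>s<N. \<Sum>h1<nb l.
      if lay (u s) = l \<and> pp (u s) = pp t \<and> hh (u s) = h1 then k s * c a s * G h1 else 0)"
    by (rule sum.swap)
  also have "\<dots> = (\<Sum>s<N. \<Sum>h1<nb l. if h1 = hh (u s) then
      (if lay (u s) = l \<and> pp (u s) = pp t then k s * c a s * G (hh (u s)) else 0) else 0)"
    by (intro sum.cong refl) auto
  also have "\<dots> = (\<Sum>s<N. if lay (u s) = l \<and> pp (u s) = pp t then k s * c a s * G (hh (u s)) else 0)"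
    using u_eq(2) by (intro sum.cong refl) auto
  finally have rhs: "bm l (left_coeff a l p (pp t)) x (hh t) =
    (\<Sum>s<N. if lay (u s) = l \<and> pp (u s) = pp t then k s * c a s * G (hh (u s)) else 0)" .
  have "c (a \<otimes>\<^bsub>A\<^esub> Theta l p q x) t = (\<Sum>s<N. if lay (u s) = l \<and> pp (u s) = pp t \<and> qq t = q
      then k s * c a s * G (hh (u s)) else 0)"
    unfolding c_mult_Theta[OF a l]
  proof (intro sum.cong refl)
    fix s assume "s \<in> {..<N}"
    then have s: "s < N" by simp
    show "c a s * (\<Sum>h<nb l. x h * (if m s (ix l p q h) = t then \<kappa> s (ix l p q h) else 0)) =
      (if lay (u s) = l \<and> pp (u s) = pp t \<and> qq t = q then k s * c a s * G (hh (u s)) else 0)"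
    proof (cases "lay (u s) = l")
      case True
      have *: "m s (ix l p q h) = t \<longleftrightarrow> pp (u s) = pp t \<and> qq t = q \<and> mb (hh (u s)) h = hh t"
        "\<kappa> s (ix l p q h) = k s" if "h < nb l" for h
      proof -
        have "m s (ix l p q h) = ix l (pp (u s)) q (mb (hh (u s)) h)"
          "\<kappa> s (ix l p q h) = k s"
          using left[OF s l that] True by (simp_all add: u_def k_def)
        moreover have "mb (hh (u s)) h < nb l" using that u_eq(2)[OF s True] B.m_less by simp
        ultimately show "m s (ix l p q h) = t \<longleftrightarrow> pp (u s) = pp t \<and> qq t = q \<and> mb (hh (u s)) h = hh t"
          "\<kappa> s (ix l p q h) = k s"
          using ix_eq_iff[OF l(1,2) u_eq(3)[OF s True] l(4) _ t lt] by auto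
      qed
      have "(\<Sum>h<nb l. x h * (if m s (ix l p q h) = t then \<kappa> s (ix l p q h) else 0)) =
          (\<Sum>h<nb l. (if pp (u s) = pp t \<and> qq t = q then k s else 0) * (if mb (hh (u s)) h = hh t then x h else 0))"
        by (intro sum.cong refl) (simp add: *)
      also have "\<dots> = (if pp (u s) = pp t \<and> qq t = q then k s else 0) * G (hh (u s))"
        unfolding G_def by (rule sum_distrib_left[symmetric])
      finally show ?thesis using True by simp
    next
      case False
      then have "m s (ix l p q h) \<noteq> t" if "h < nb l" for h
        using left[OF s l that] lt by (auto simp: u_def)
      then show ?thesis using False by (auto intro!: sum.neutral)
    qed
  qed
  also have "\<dots> = (if qq t = q then bm l (left_coeff a l p (pp t)) x (hh t) else 0)"
    unfolding rhs by simp
  also have "\<dots> = (\<Sum>p'<np l. if p' = pp t then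
      (if qq t = q then bm l (left_coeff a l p (pp t)) x (hh t) else 0) else 0)"
    using cot by simp
  also have "\<dots> = c (finsum A ?f {..<np l}) t"
    unfolding c_finsum[OF f_in] using t lt by (intro sum.cong refl) (auto simp: c_Theta)
  finally show "c (a \<otimes>\<^bsub>A\<^esub> Theta l p q x) t = c (finsum A ?f {..<np l}) t" .
qed (use a l closed in auto)

text \<open>The two elements are even equal: \<open>i\<close> permutes coordinates, and
  \<open>\<iota>\<close> exchanges \<open>p\<close> and \<open>q\<close> without leaving the
  layer.\<close>

lemma inflation_inv:
  assumes l: "1 \<le> l" "l \<le> n" "p < np l" "q < np l"
  shows "i (Theta l p q x) \<ominus>\<^bsub>A\<^esub> Theta l q p (j l x) \<in> J (l - 1)"
proof -
  have i_in: "i y \<in> carrier A" if "y \<in> carrier A" for y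
    using anti_inv that by (auto simp: anti_inv_def lin_map_def)
  have "c (i (Theta l p q x)) t = c (Theta l q p (j l x)) t" if t: "t < N" for t
  proof -
    have "\<iota> t = ix (lay t) (qq t) (pp t) (jb (hh t))" using iota_ix co[OF t] by metis
    then have "\<iota> t < N \<and> lay (\<iota> t) = lay t \<and> pp (\<iota> t) = qq t \<and> qq (\<iota> t) = pp t \<and> hh (\<iota> t) = jb (hh t)"
      using ix co[OF t] jb by simp
    then show ?thesis using co[OF t] t by (auto simp: c_i c_Theta j_def)
  qed
  then have "i (Theta l p q x) = Theta l q p (j l x)"
    by (intro c_eqI) (auto simp: i_in)
  then show ?thesis using l by (intro diff_in_J) (auto simp: c_Theta)
qed

text \<open>Symmetry of the form holds because \<open>\<iota>\<close> carries the product defining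
  \<open>Phi l p q\<close> to the one defining \<open>Phi l q p\<close>.\<close>

lemma Phi_in: "\<lbrakk>1 \<le> l; l \<le> n; p < np l; q < np l\<rbrakk> \<Longrightarrow> Phi l p q \<in> fsupp (nb l)"
  and j_Phi: "\<lbrakk>1 \<le> l; l \<le> n; p < np l; q < np l\<rbrakk> \<Longrightarrow> j l (Phi l p q) = Phi l q p"
proof -
  assume l: "1 \<le> l" "l \<le> n" "p < np l" "q < np l"
  define u where "u p q = m (ix l 0 p 0) (ix l q 0 0)" for p q
  have pos: "0 < np l" "0 < nb l" using l np_pos nb_pos by auto
  have u_less: "u p q < N" unfolding u_def using l pos ix m_less by simp
  have iu: "\<iota> (u p q) = u q p"
    unfolding u_def using l pos ix by (simp add: iota_m iota_ix jb_0)
  moreover have "\<iota> (u p q) = ix (lay (u p q)) (qq (u p q)) (pp (u p q)) (jb (hh (u p q)))"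
    using iota_ix co[OF u_less] by metis
  ultimately have lay: "lay (u q p) = lay (u p q)" and hh: "hh (u q p) = jb (hh (u p q))"
    using ix[of "lay (u p q)" "qq (u p q)" "pp (u p q)" "jb (hh (u p q))"] co[OF u_less]
      jb[of "lay (u p q)" "hh (u p q)"] by metis+
  have kap: "\<kappa> (ix l 0 q 0) (ix l p 0 0) = \<kappa> (ix l 0 p 0) (ix l q 0 0)"
    using iota_kappa[of "ix l 0 p 0" "ix l q 0 0"] l pos ix by (simp add: iota_ix jb_0)
  show "Phi l p q \<in> fsupp (nb l)"
    using co[OF u_less] by (auto simp: Phi_def fsupp_def delta_def u_def)
  have "jb h = hh (u p q) \<longleftrightarrow> h = jb (hh (u p q))" if "h < nb l" "lay (u p q) = l" for h
    using jb[OF l(1,2)] co[OF u_less] that by metis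
  moreover have "jb (hh (u p q)) < nb l" if "lay (u p q) = l"
    using jb[OF l(1,2)] co[OF u_less] that by metis
  ultimately show "j l (Phi l p q) = Phi l q p"
    using lay hh kap by (auto simp: fun_eq_iff Phi_def j_def u_def[symmetric] delta_def)
qed

definition e :: "nat \<Rightarrow> 'a" where
  "e l = Theta l 0 0 (\<lambda>h. inverse (w l) * delta 0 h)"

lemma c_e: "\<lbrakk>1 \<le> l; l \<le> n\<rbrakk> \<Longrightarrow> c (e l) = (\<lambda>t. inverse (w l) * delta (ix l 0 0 0) t)"
proof
  fix t assume l: "1 \<le> l" "l \<le> n"
  have "ix l 0 0 0 < N" using ix np_pos nb_pos l by simp
  moreover have "t = ix l 0 0 0 \<longleftrightarrow> lay t = l \<and> pp t = 0 \<and> qq t = 0 \<and> hh t = 0" if "t < N"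
    using ix[of l 0 0 0] np_pos nb_pos l co[OF that] by auto
  ultimately show "c (e l) t = inverse (w l) * delta (ix l 0 0 0) t"
    by (auto simp: e_def c_Theta delta_def)
qed

text \<open>The product of two base elements carries the scalar \<open>w l\<close> of the higher
  layer, which cancels the normalisation of \<open>e l\<close> and leaves
  \<open>e k\<close>.\<close>

lemma e_mult:
  assumes "1 \<le> k" "k \<le> l" "l \<le> n"
  shows "e l \<otimes>\<^bsub>A\<^esub> e k = e k" "e k \<otimes>\<^bsub>A\<^esub> e l = e k"
proof -
  have less: "ix l 0 0 0 < N" "ix k 0 0 0 < N" using ix np_pos nb_pos assms by simp_all
  have "c (e l \<otimes>\<^bsub>A\<^esub> e k) = c (e k)" "c (e k \<otimes>\<^bsub>A\<^esub> e l) = c (e k)"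
    using assms less idem[OF assms] w_nonzero[of l]
    by (simp_all add: c_mult c_e e_def[symmetric] Theta_in[of _ 0 0, folded e_def] tmul_linear tmul_delta_delta)
      (simp_all add: e_def c_mult c_e[unfolded e_def] tmul_linear tmul_delta_delta fun_eq_iff)
  then show "e l \<otimes>\<^bsub>A\<^esub> e k = e k" "e k \<otimes>\<^bsub>A\<^esub> e l = e k"
    by (auto intro!: c_eqI simp: closed e_def)
qed

theorem cell_strat_A: "cell_strat A i"
proof -
  let ?P = "\<lambda>l. {..<np l}"
  let ?u = "\<lambda>(l::nat) (p::nat). if p = 0 then 1 else 0 :: 'k"
  let ?v = "\<lambda>l (q::nat). if q = 0 then inverse (w l) else 0 :: 'k"
  have e_eq: "finsum A (\<lambda>(p, q). Theta l p q ((?u l p * ?v l q) \<odot>\<^bsub>B l\<^esub> \<one>\<^bsub>B l\<^esub>)) (?P l \<times> ?P l) = e l"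
    if "1 \<le> l" "l \<le> n" for l
  proof (rule c_eqI)
    fix t assume t: "t < N"
    have "c (finsum A (\<lambda>(p, q). Theta l p q ((?u l p * ?v l q) \<odot>\<^bsub>B l\<^esub> \<one>\<^bsub>B l\<^esub>)) (?P l \<times> ?P l)) t
      = (\<Sum>(p, q)\<in>?P l \<times> ?P l. c (Theta l p q (\<lambda>h. (?u l p * ?v l q) * delta 0 h)) t)"
      by (subst c_finsum) (auto intro!: sum.cong)
    also have "\<dots> = (\<Sum>k\<in>?P l \<times> ?P l. if k = (0, 0) then c (e l) t else 0)"
      by (intro sum.cong refl) (auto simp: e_def c_Theta split: if_splits)
    also have "\<dots> = c (e l) t" using np_pos[OF that] by (subst sum.delta) auto
    finally show "c (finsum A (\<lambda>(p, q). Theta l p q ((?u l p * ?v l q) \<odot>\<^bsub>B l\<^esub> \<one>\<^bsub>B l\<^esub>)) (?P l \<times> ?P l)) t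
      = c (e l) t" .
  next
    show "finsum A (\<lambda>(p, q). Theta l p q ((?u l p * ?v l q) \<odot>\<^bsub>B l\<^esub> \<one>\<^bsub>B l\<^esub>)) (?P l \<times> ?P l) \<in> carrier A"
      by (rule finsum_in) auto
  qed (simp add: e_def)
  have cell: "cellular (B l) (j l)" if "1 \<le> l" "l \<le> n" for l
    using B_cellular[OF that] by (simp add: j_def[abs_def])
  have lin: "lin_map (B l) A (Theta l p q)" for l p q
    unfolding lin_map_def by (auto intro!: c_eqI simp: c_simps c_Theta)
  have Idx: "{(l, p, q). l \<in> {1..n} \<and> p \<in> ?P l \<and> q \<in> ?P l} =
      {(l, p, q). l \<in> {1..n} \<and> p < np l \<and> q < np l}" by auto
  have spans: "\<exists>X. (\<forall>(l, p, q)\<in>{(l, p, q). l \<in> {1..n} \<and> p < np l \<and> q < np l}. X l p q \<in> carrier (B l)) \<and>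
      a = finsum A (\<lambda>(l, p, q). Theta l p q (X l p q)) {(l, p, q). l \<in> {1..n} \<and> p < np l \<and> q < np l}"
    if "a \<in> carrier A" for a
  proof -
    have "a \<in> J n" using that co by (force simp: J_def)
    from decomp[OF this] show ?thesis
      by (intro exI[of _ "\<lambda>l p q h. if h < nb l then c a (ix l p q h) else 0"]) (auto simp: fsupp_def)
  qed
  have direct: "X l p q = (\<lambda>_. 0)"
    if X: "\<forall>(l, p, q)\<in>{(l, p, q). l \<in> {1..n} \<and> p < np l \<and> q < np l}. X l p q \<in> fsupp (nb l)"
      and 0: "finsum A (\<lambda>(l, p, q). Theta l p q (X l p q))
        {(l, p, q). l \<in> {1..n} \<and> p < np l \<and> q < np l} = \<zero>\<^bsub>A\<^esub>"
      and l: "1 \<le> l" "l \<le> n" "p < np l" "q < np l" for X l p q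
  proof
    fix h
    show "X l p q h = 0"
    proof (cases "h < nb l")
      case True
      let ?t = "ix l p q h"
      have t: "?t < N" using ix[OF l True] by simp
      have "0 = c (finsum A (\<lambda>(l, p, q). Theta l p q (X l p q))
          {(l, p, q). l \<in> {1..n} \<and> p < np l \<and> q < np l}) ?t" unfolding 0 by (simp add: c_zero)
      also have "\<dots> = (\<Sum>(l, p, q)\<in>{(l, p, q). l \<in> {1..n} \<and> p < np l \<and> q < np l}.
          c (Theta l p q (X l p q)) ?t)"
        by (subst c_finsum) (auto intro!: sum.cong)
      also have "\<dots> = X l p q h"
        unfolding sum_lay_delta[OF t] using ix[OF l True] l by simp
      finally show ?thesis by simp
    next
      case False
      have "X l p q \<in> fsupp (nb l)" using X l by auto
      then show ?thesis using False by (simp add: fsupp_def)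
    qed
  qed
  show ?thesis
    unfolding cell_strat_def
    apply (intro conjI kalg_A anti_inv fin_dim_A)
    apply (rule exI[of _ n], rule exI[of _ B], rule exI[of _ j], rule exI[of _ ?P], rule exI[of _ Phi],
        rule exI[of _ Theta], rule exI[of _ ?u], rule exI[of _ ?v])
    apply (unfold Let_def J_eq_span Idx)
    apply (intro conjI)
    subgoal by (auto simp: Phi_in j_Phi lin cell)
    subgoal using spans by blast
    subgoal
    proof (intro allI impI ballI, elim conjE)
      fix X k
      assume X: "\<forall>(l, p, q)\<in>{(l, p, q). l \<in> {1..n} \<and> p < np l \<and> q < np l}. X l p q \<in> carrier (B l)"
        and 0: "finsum A (\<lambda>(l, p, q). Theta l p q (X l p q))
          {(l, p, q). l \<in> {1..n} \<and> p < np l \<and> q < np l} = \<zero>\<^bsub>A\<^esub>"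
        and k: "k \<in> {(l, p, q). l \<in> {1..n} \<and> p < np l \<and> q < np l}"
      obtain l p q where "k = (l, p, q)" by (cases k)
      with k direct[OF X[unfolded talg_simps] 0, of l p q]
      show "case k of (l, p, q) \<Rightarrow> X l p q = \<zero>\<^bsub>B l\<^esub>" by simp
    qed
    subgoal using ideal_J by blast
    subgoal using inflation_mult by auto
    subgoal
    proof (intro ballI)
      fix a l p assume *: "a \<in> carrier A" "l \<in> {1..n}" "p \<in> ?P l"
      then show "\<exists>y. (\<forall>p'\<in>?P l. y p' \<in> carrier (B l)) \<and> (\<forall>q\<in>?P l. \<forall>x\<in>carrier (B l).
          a \<otimes>\<^bsub>A\<^esub> Theta l p q x \<ominus>\<^bsub>A\<^esub>
            finsum A (\<lambda>p'. Theta l p' q (y p' \<otimes>\<^bsub>B l\<^esub> x)) (?P l) \<in> J (l - 1))"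
        using left_action[of a l p]
        by (intro exI[of _ "left_coeff a l p"]) (simp add: left_coeff_def[abs_def] fsupp_def)
    qed
    subgoal using inflation_inv by auto
    subgoal
    proof (intro ballI conjI)
      fix l assume "l \<in> {1..n}"
      then have l: "1 \<le> l" "l \<le> n" by auto
      show "\<exists>p\<in>?P l. ?u l p \<noteq> 0" "\<exists>q\<in>?P l. ?v l q \<noteq> 0"
        using np_pos[OF l] w_nonzero by (auto intro!: bexI[of _ 0])
      show "finsum A (\<lambda>(p, q). Theta l p q ((?u l p * ?v l q) \<odot>\<^bsub>B l\<^esub> \<one>\<^bsub>B l\<^esub>)) (?P l \<times> ?P l) \<otimes>\<^bsub>A\<^esub>
          finsum A (\<lambda>(p, q). Theta l p q ((?u l p * ?v l q) \<odot>\<^bsub>B l\<^esub> \<one>\<^bsub>B l\<^esub>)) (?P l \<times> ?P l) =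
          finsum A (\<lambda>(p, q). Theta l p q ((?u l p * ?v l q) \<odot>\<^bsub>B l\<^esub> \<one>\<^bsub>B l\<^esub>)) (?P l \<times> ?P l)"
        unfolding e_eq[OF l] using e_mult l by simp
    qed
    subgoal
    proof (intro ballI impI)
      fix l k assume "l \<in> {1..n}" "k \<in> {1..n}" "k < l"
      then have l: "1 \<le> l" "l \<le> n" and k: "1 \<le> k" "k \<le> n" and kl: "k \<le> l" by auto
      let ?e = "\<lambda>l. finsum A (\<lambda>(p, q). Theta l p q ((?u l p * ?v l q) \<odot>\<^bsub>B l\<^esub> \<one>\<^bsub>B l\<^esub>)) (?P l \<times> ?P l)"
      show "?e l \<otimes>\<^bsub>A\<^esub> ?e k = ?e k \<and> ?e k \<otimes>\<^bsub>A\<^esub> ?e l = ?e k"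
        unfolding e_eq[OF l] e_eq[OF k] using e_mult[OF k(1) kl l(2)] by simp
    qed
    done
qed

end

section \<open>Cellular bases of monoid algebras\<close>

text \<open>Cellularity as matrix identities. Row \<open>i\<close> of \<open>C\<close> expands cell
  element \<open>i\<close> in the monoid basis and \<open>D\<close> is the inverse matrix, so
  \<open>\<Sum>h<N. C i h * D (m g h) k\<close> is the coefficient of cell element \<open>k\<close>
  in \<open>g\<close> times cell element \<open>i\<close>. The label of \<open>i\<close> is
  \<open>(sh i, row i, row (jb i))\<close>, as in the Robinson-Schensted correspondence, where
  inversion exchanges the two tableaux.\<close>

locale cell_matrix = twisted_monoid N m "\<lambda>_ _. 1 :: 'k::field" for N m +
  fixes C D :: "nat \<Rightarrow> nat \<Rightarrow> 'k::field" and jb sh row :: "nat \<Rightarrow> nat" and ci :: "nat \<Rightarrow> nat \<Rightarrow> nat \<Rightarrow> nat"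
  assumes CD: "\<lbrakk>i < N; k < N\<rbrakk> \<Longrightarrow> (\<Sum>g<N. C i g * D g k) = (if i = k then 1 else 0)"
    and DC: "\<lbrakk>g < N; h < N\<rbrakk> \<Longrightarrow> (\<Sum>i<N. D g i * C i h) = (if g = h then 1 else 0)"
    and jb: "i < N \<Longrightarrow> jb i < N \<and> jb (jb i) = i \<and> sh (jb i) = sh i"
    and jb_m: "\<lbrakk>g < N; h < N\<rbrakk> \<Longrightarrow> jb (m g h) = m (jb h) (jb g)"
    and jb_C: "\<lbrakk>i < N; g < N\<rbrakk> \<Longrightarrow> C (jb i) (jb g) = C i g"
    and ci: "i < N \<Longrightarrow> ci (sh i) (row i) (row (jb i)) = i"
    and ci_mix: "\<lbrakk>i < N; k < N; sh i = sh k\<rbrakk> \<Longrightarrow> ci (sh i) (row i) (row k) < N \<and>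
      sh (ci (sh i) (row i) (row k)) = sh i \<and> row (ci (sh i) (row i) (row k)) = row i \<and>
      row (jb (ci (sh i) (row i) (row k))) = row k"
    and triangular: "\<lbrakk>g < N; i < N; k < N; (\<Sum>h<N. C i h * D (m g h) k) \<noteq> 0\<rbrakk> \<Longrightarrow>
      sh k < sh i \<or> (sh k = sh i \<and> row (jb k) = row (jb i))"
    and column_indep: "\<lbrakk>g < N; i < N; k < N; i' < N; k' < N; sh i = sh k; sh i' = sh i; sh k' = sh k;
        row i = row i'; row k = row k'; row (jb i) = row (jb k); row (jb i') = row (jb k')\<rbrakk> \<Longrightarrow>
      (\<Sum>h<N. C i h * D (m g h) k) = (\<Sum>h<N. C i' h * D (m g h) k')"
begin

abbreviation B :: "('k, nat \<Rightarrow> 'k) module" where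
  "B \<equiv> talg N m (\<lambda>_ _. 1)"

sublocale B: coord_alg N m "\<lambda>_ _. 1" B "\<lambda>x. x"
  by (rule coord_alg_talg)

definition cell_vec :: "nat \<Rightarrow> nat \<Rightarrow> 'k" where
  "cell_vec i = (\<lambda>g. if g < N then C i g else 0)"

definition coeff :: "(nat \<Rightarrow> 'k) \<Rightarrow> nat \<Rightarrow> 'k" where
  "coeff f k = (\<Sum>g<N. f g * D g k)"

definition triple :: "nat \<Rightarrow> nat \<times> nat \<times> nat" where
  "triple i = (sh i, row i, row (jb i))"

abbreviation cell_fam :: "nat \<times> nat \<times> nat \<Rightarrow> nat \<Rightarrow> 'k" where
  "cell_fam \<equiv> \<lambda>(lam, S, T). cell_vec (ci lam S T)"

definition rows :: "nat \<Rightarrow> nat set" where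
  "rows lam = row ` {i. i < N \<and> sh i = lam}"

lemma cell_vec_in: "cell_vec i \<in> carrier B"
  by (simp add: cell_vec_def fsupp_def)

lemma cell_fam_triple: "i < N \<Longrightarrow> cell_fam (triple i) = cell_vec i"
  by (simp add: triple_def ci)

lemma inj_triple: "inj_on triple {..<N}"
  by (rule inj_onI) (metis ci lessThan_iff prod.inject triple_def)

lemma triple_cases:
  assumes "lam \<in> sh ` {..<N}" "S \<in> rows lam" "T \<in> rows lam"
  obtains i where "i < N" "triple i = (lam, S, T)" "ci lam S T = i"
proof -
  obtain i k where "i < N" "k < N" "sh i = lam" "sh k = lam" "S = row i" "T = row k"
    using assms by (auto simp: rows_def)
  then show thesis using ci_mix[of i k] that[of "ci lam S T"] by (simp add: triple_def)
qed

text \<open>The predicate \<open>P\<close> lets one identity describe both the full index set and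
  the part below a given shape.\<close>

lemma triples_eq: "{(lam, S, T). lam \<in> sh ` {..<N} \<and> P lam \<and> S \<in> rows lam \<and> T \<in> rows lam} =
    triple ` {i. i < N \<and> P (sh i)}"
proof (intro equalityI subsetI)
  fix x assume "x \<in> {(lam, S, T). lam \<in> sh ` {..<N} \<and> P lam \<and> S \<in> rows lam \<and> T \<in> rows lam}"
  then obtain lam S T where x: "x = (lam, S, T)" "P lam" "lam \<in> sh ` {..<N}" "S \<in> rows lam" "T \<in> rows lam"
    by auto
  from triple_cases[OF x(3-5)] obtain i where "i < N" "triple i = (lam, S, T)" by metis
  then have "x = triple i" "i \<in> {i. i < N \<and> P (sh i)}" using x by (auto simp: triple_def)
  then show "x \<in> triple ` {i. i < N \<and> P (sh i)}" by blast
next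
  fix x assume "x \<in> triple ` {i. i < N \<and> P (sh i)}"
  then obtain i where i: "i < N" "P (sh i)" "x = (sh i, row i, row (jb i))" by (auto simp: triple_def)
  moreover have "row (jb i) \<in> rows (sh i)" "row i \<in> rows (sh i)"
    using jb[OF i(1)] i(1) by (auto simp: rows_def)
  ultimately show "x \<in> {(lam, S, T). lam \<in> sh ` {..<N} \<and> P lam \<and> S \<in> rows lam \<and> T \<in> rows lam}"
    by auto
qed

lemma coeff_cell_vec: "\<lbrakk>i < N; k < N\<rbrakk> \<Longrightarrow> coeff (cell_vec i) k = (if i = k then 1 else 0)"
  by (simp add: coeff_def cell_vec_def CD)

lemma coeff_mult:
  assumes "i < N"
  shows "coeff (tmul N m (\<lambda>_ _. 1) a (cell_vec i)) k =
    (\<Sum>g<N. a g * (\<Sum>h<N. C i h * D (m g h) k))"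
  unfolding coeff_def sum_tmul sum_distrib_left
  by (intro sum.cong refl) (simp add: cell_vec_def)

lemma coeff_expansion:
  assumes "f \<in> fsupp N" "h < N"
  shows "(\<Sum>i<N. coeff f i * C i h) = f h"
proof -
  have "(\<Sum>i<N. coeff f i * C i h) = (\<Sum>i<N. \<Sum>g<N. f g * (D g i * C i h))"
    by (simp add: coeff_def sum_distrib_right mult.assoc)
  also have "\<dots> = (\<Sum>g<N. f g * (\<Sum>i<N. D g i * C i h))"
    unfolding sum_distrib_left by (rule sum.swap)
  also have "\<dots> = (\<Sum>g<N. if g = h then f h else 0)"
    using assms by (intro sum.cong refl) (simp add: DC)
  also have "\<dots> = f h" using assms by simp
  finally show ?thesis .
qed

text \<open>Turns membership in a span of cell elements into the vanishing of the remaining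
  coefficients, which is how the error term in the cellular axiom is handled.\<close>

lemma in_span_cell:
  assumes f: "f \<in> fsupp N" and K: "K \<subseteq> {..<N}" and 0: "\<And>i. \<lbrakk>i < N; i \<notin> K\<rbrakk> \<Longrightarrow> coeff f i = 0"
  shows "f \<in> span_fam B cell_fam (triple ` K)"
proof (rule span_famI)
  let ?r = "\<lambda>(lam, S, T). coeff f (ci lam S T)"
  have in_B: "(\<lambda>x. ?r x \<odot>\<^bsub>B\<^esub> cell_fam x) \<in> triple ` K \<rightarrow> carrier B"
    by (auto simp: cell_vec_def fsupp_def)
  have K': "i < N" if "i \<in> K" for i using K that by auto
  have inj: "inj_on triple K" using inj_triple K by (rule inj_on_subset)
  show "finite (triple ` K)" using K finite_subset by blast
  show "f = finsum B (\<lambda>x. ?r x \<odot>\<^bsub>B\<^esub> cell_fam x) (triple ` K)"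
  proof (rule B.c_eqI)
    fix h assume h: "h < N"
    have "finsum B (\<lambda>x. ?r x \<odot>\<^bsub>B\<^esub> cell_fam x) (triple ` K) h =
        (\<Sum>i\<in>K. coeff f i * C i h)"
      unfolding B.c_finsum[OF in_B] sum.reindex[OF inj] using K' h
      by (intro sum.cong refl) (simp add: triple_def ci cell_vec_def)
    also have "\<dots> = (\<Sum>i<N. coeff f i * C i h)"
      using K 0 by (intro sum.mono_neutral_left) auto
    also have "\<dots> = f h" using f h by (rule coeff_expansion)
    finally show "f h = finsum B (\<lambda>x. ?r x \<odot>\<^bsub>B\<^esub> cell_fam x) (triple ` K) h" by simp
  qed (use f B.finsum_in[OF in_B] in auto)
qed simp

lemma basis_cell: "basis_fam B cell_fam (triple ` {..<N})"
  unfolding basis_fam_def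
proof (intro conjI)
  show "cell_fam ` triple ` {..<N} \<subseteq> carrier B"
    using cell_vec_in by (auto simp: triple_def)
  show "span_fam B cell_fam (triple ` {..<N}) = carrier B"
  proof (intro equalityI subsetI)
    fix f assume "f \<in> span_fam B cell_fam (triple ` {..<N})"
    then obtain r F where "f = finsum B (\<lambda>x. r x \<odot>\<^bsub>B\<^esub> cell_fam x) F" by (auto simp: span_fam_def)
    moreover have "(\<lambda>x. r x \<odot>\<^bsub>B\<^esub> cell_fam x) \<in> F \<rightarrow> carrier B" by (auto simp: cell_vec_def fsupp_def)
    ultimately show "f \<in> carrier B" using B.finsum_in by blast
  next
    fix f assume "f \<in> carrier B"
    then show "f \<in> span_fam B cell_fam (triple ` {..<N})" by (intro in_span_cell) auto
  qed
  show "lin_indep_fam B cell_fam (triple ` {..<N})"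
    unfolding lin_indep_fam_def
  proof (intro allI impI ballI, elim conjE)
    fix r F x
    assume fin: "finite F" and F: "F \<subseteq> triple ` {..<N}" and x: "x \<in> F"
      and 0: "finsum B (\<lambda>x. r x \<odot>\<^bsub>B\<^esub> cell_fam x) F = \<zero>\<^bsub>B\<^esub>"
    have in_B: "(\<lambda>x. r x \<odot>\<^bsub>B\<^esub> cell_fam x) \<in> F \<rightarrow> carrier B" by (auto simp: cell_vec_def fsupp_def)
    obtain k where k: "k < N" "x = triple k" using F x by auto
    have "0 = (\<Sum>g<N. finsum B (\<lambda>x. r x \<odot>\<^bsub>B\<^esub> cell_fam x) F g * D g k)" unfolding 0 by simp
    also have "\<dots> = (\<Sum>g<N. \<Sum>y\<in>F. r y * (cell_fam y g * D g k))"
      unfolding B.c_finsum[OF in_B] by (simp add: sum_distrib_right mult.assoc)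
    also have "\<dots> = (\<Sum>y\<in>F. r y * coeff (cell_fam y) k)"
      unfolding coeff_def sum_distrib_left by (rule sum.swap)
    also have "\<dots> = (\<Sum>y\<in>F. if y = x then r x else 0)"
    proof (intro sum.cong refl)
      fix y assume "y \<in> F"
      then obtain i where i: "i < N" "y = triple i" using F by auto
      then have "i = k \<longleftrightarrow> y = x" using k inj_triple by (auto simp: inj_on_def)
      then show "r y * coeff (cell_fam y) k = (if y = x then r x else 0)"
        using i k by (simp add: cell_fam_triple coeff_cell_vec)
    qed
    also have "\<dots> = r x" using fin x by simp
    finally show "r x = 0" by simp
  qed
qed

text \<open>The structure coefficients may not depend on \<open>T\<close>, so they are taken from
  column \<open>S\<close>, and \<open>column_indep\<close> carries them to column \<open>T\<close>.
  At shapes not below \<open>lam\<close>, \<open>triangular\<close> kills all coefficients of the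
  product except those of shape \<open>lam\<close> in column \<open>T\<close>, and these
  match.\<close>

lemma cell_action:
  assumes a: "a \<in> fsupp N" and lam: "lam \<in> sh ` {..<N}" and S: "S \<in> rows lam" and T: "T \<in> rows lam"
  shows "a \<otimes>\<^bsub>B\<^esub> cell_vec (ci lam S T) \<ominus>\<^bsub>B\<^esub>
      finsum B (\<lambda>S'. (\<Sum>g<N. a g * (\<Sum>h<N. C (ci lam S S) h * D (m g h) (ci lam S' S)))
        \<odot>\<^bsub>B\<^esub> cell_vec (ci lam S' T)) (rows lam)
    \<in> span_fam B cell_fam (triple ` {i. i < N \<and> sh i < lam})"
    (is "_ \<ominus>\<^bsub>B\<^esub> finsum B (\<lambda>S'. ?r S' \<odot>\<^bsub>B\<^esub> _) _ \<in> _")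
proof (rule in_span_cell)
  obtain i where i: "i < N" "triple i = (lam, S, T)" "ci lam S T = i" by (rule triple_cases[OF lam S T])
  obtain i0 where i0: "i0 < N" "triple i0 = (lam, S, S)" "ci lam S S = i0" by (rule triple_cases[OF lam S S])
  let ?x = "a \<otimes>\<^bsub>B\<^esub> cell_vec (ci lam S T)"
  let ?y = "finsum B (\<lambda>S'. ?r S' \<odot>\<^bsub>B\<^esub> cell_vec (ci lam S' T)) (rows lam)"
  have x_in: "?x \<in> carrier B" by (simp add: tmul_in)
  have in_B: "(\<lambda>S'. ?r S' \<odot>\<^bsub>B\<^esub> cell_vec (ci lam S' T)) \<in> rows lam \<rightarrow> carrier B"
    by (auto simp: cell_vec_def fsupp_def)
  then have y_in: "?y \<in> carrier B" by (rule B.finsum_in)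
  show "?x \<ominus>\<^bsub>B\<^esub> ?y \<in> fsupp N" using B.minus_in[OF x_in y_in] by simp
  fix k assume k: "k < N" "k \<notin> {i. i < N \<and> sh i < lam}"
  have "coeff ?y k = (\<Sum>g<N. \<Sum>S'\<in>rows lam. ?r S' * (cell_vec (ci lam S' T) g * D g k))"
    unfolding coeff_def B.c_finsum[OF in_B] by (simp add: sum_distrib_right mult.assoc)
  also have "\<dots> = (\<Sum>S'\<in>rows lam. ?r S' * coeff (cell_vec (ci lam S' T)) k)"
    unfolding coeff_def sum_distrib_left by (rule sum.swap)
  also have "\<dots> = (\<Sum>S'\<in>rows lam. if S' = row k then (if sh k = lam \<and> row (jb k) = T then ?r (row k) else 0) else 0)"
  proof (intro sum.cong refl)
    fix S' assume S': "S' \<in> rows lam"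
    obtain e where e: "e < N" "triple e = (lam, S', T)" "ci lam S' T = e" by (rule triple_cases[OF lam S' T])
    have "e = k \<longleftrightarrow> triple e = triple k" using e(1) k(1) inj_triple by (auto simp: inj_on_def)
    also have "\<dots> \<longleftrightarrow> sh k = lam \<and> row k = S' \<and> row (jb k) = T" using e(2) by (auto simp: triple_def)
    finally show "?r S' * coeff (cell_vec (ci lam S' T)) k =
        (if S' = row k then (if sh k = lam \<and> row (jb k) = T then ?r (row k) else 0) else 0)"
      using e(1,3) k(1) by (auto simp: coeff_cell_vec)
  qed
  also have "\<dots> = (if sh k = lam \<and> row (jb k) = T then ?r (row k) else 0)"
  proof -
    have "finite (rows lam)" by (simp add: rows_def)
    moreover have "row k \<in> rows lam" if "sh k = lam" using that k(1) by (auto simp: rows_def)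
    ultimately show ?thesis by (auto simp: sum.delta)
  qed
  finally have y: "coeff ?y k = (if sh k = lam \<and> row (jb k) = T then ?r (row k) else 0)" .
  have x: "coeff ?x k = (\<Sum>g<N. a g * (\<Sum>h<N. C i h * D (m g h) k))"
    using coeff_mult[OF i(1)] i(3) by simp
  have ti: "sh i = lam" "row i = S" "row (jb i) = T" using i(2) by (simp_all add: triple_def)
  have "coeff ?x k = coeff ?y k"
  proof (cases "sh k = lam \<and> row (jb k) = T")
    case True
    have "row k \<in> rows lam" using True k(1) by (auto simp: rows_def)
    from triple_cases[OF lam this S] obtain e where e: "e < N" "triple e = (lam, row k, S)" "ci lam (row k) S = e"
      by metis
    have "coeff ?x k = ?r (row k)"
      unfolding x i0(3) e(3)
      using True e(1,2) i0(1,2) ti i(1) k(1)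
      by (intro sum.cong refl arg_cong2[where f = "(*)"] column_indep) (auto simp: triple_def)
    then show ?thesis unfolding y using True by simp
  next
    case False
    have "\<not> sh k < sh i" "\<not> (sh k = sh i \<and> row (jb k) = row (jb i))" using k False ti by auto
    then have "(\<Sum>h<N. C i h * D (m g h) k) = 0" if "g < N" for g
      using triangular[OF that i(1) k(1)] by blast
    then show ?thesis unfolding x y if_not_P[OF False] by simp
  qed
  then show "coeff (?x \<ominus>\<^bsub>B\<^esub> ?y) k = 0"
    unfolding coeff_def B.c_minus[OF x_in y_in] by (simp add: left_diff_distrib sum_subtractf)
qed auto

theorem cellular_B: "cellular B (\<lambda>x h. if h < N then x (jb h) else 0)"
  unfolding cellular_def
proof (intro conjI B.kalg_A)
  show "anti_inv B (\<lambda>x h. if h < N then x (jb h) else 0)"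
    by (rule B.anti_inv_coordI[where \<iota> = jb]) (auto simp: jb jb_m fsupp_def)
  let ?Lam = "sh ` {..<N}"
  let ?C = "\<lambda>lam S T. cell_vec (ci lam S T)"
  have all: "{(lam, S, T). lam \<in> ?Lam \<and> S \<in> rows lam \<and> T \<in> rows lam} = triple ` {..<N}"
    using triples_eq[of "\<lambda>_. True"] by (simp add: lessThan_def)
  have lower: "{(mu, U, V). mu \<in> ?Lam \<and> mu \<le> lam \<and> mu \<noteq> lam \<and> U \<in> rows mu \<and> V \<in> rows mu} =
      triple ` {i. i < N \<and> sh i < lam}" for lam
    using triples_eq[of "\<lambda>mu. mu < lam"] by (simp add: order_less_le conj_assoc)
  have flip: "(\<lambda>h. if h < N then ?C lam S T (jb h) else 0) = ?C lam T S"
    if x: "lam \<in> ?Lam" "S \<in> rows lam" "T \<in> rows lam" for lam S T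
  proof -
    obtain i where i: "i < N" "triple i = (lam, S, T)" "ci lam S T = i" by (rule triple_cases[OF x])
    have "ci lam T S = jb i" using i(2) jb[OF i(1)] ci[of "jb i"] by (simp add: triple_def)
    moreover have "C i (jb h) = C (jb i) h" if "h < N" for h
      using jb_C[OF i(1), of "jb h"] jb[OF that] by simp
    ultimately show ?thesis unfolding i(3) using jb by (simp add: cell_vec_def fun_eq_iff)
  qed
  show "\<exists>(Lam::nat set) le M Ca. finite Lam \<and> (\<forall>x\<in>Lam. le x x) \<and>
      (\<forall>x\<in>Lam. \<forall>y\<in>Lam. le x y \<and> le y x \<longrightarrow> x = y) \<and>
      (\<forall>x\<in>Lam. \<forall>y\<in>Lam. \<forall>z\<in>Lam. le x y \<and> le y z \<longrightarrow> le x z) \<and>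
      (\<forall>lam\<in>Lam. finite (M lam)) \<and>
      basis_fam B (\<lambda>(lam, S, T). Ca lam S T) {(lam, S, T). lam \<in> Lam \<and> S \<in> M lam \<and> T \<in> M lam} \<and>
      (\<forall>lam\<in>Lam. \<forall>S\<in>M lam. \<forall>T\<in>M lam. (\<lambda>h. if h < N then Ca lam S T (jb h) else 0) = Ca lam T S) \<and>
      (\<forall>a\<in>carrier B. \<forall>lam\<in>Lam. \<forall>S\<in>M lam. \<exists>r::nat \<Rightarrow> 'k. \<forall>T\<in>M lam.
         a \<otimes>\<^bsub>B\<^esub> Ca lam S T \<ominus>\<^bsub>B\<^esub> finsum B (\<lambda>S'. r S' \<odot>\<^bsub>B\<^esub> Ca lam S' T) (M lam)
           \<in> span_fam B (\<lambda>(mu, U, V). Ca mu U V)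
               {(mu, U, V). mu \<in> Lam \<and> le mu lam \<and> mu \<noteq> lam \<and> U \<in> M mu \<and> V \<in> M mu})"
  \<comment> \<open>Shapes are numbered compatibly with the cell order, so the usual order of the
    naturals serves as the partial order.\<close>
  proof (rule exI[of _ ?Lam], rule exI[of _ "(\<le>)"], rule exI[of _ rows], rule exI[of _ ?C],
      unfold all lower, intro conjI)
    show "basis_fam B cell_fam (triple ` {..<N})" by (rule basis_cell)
    show "\<forall>lam\<in>?Lam. \<forall>S\<in>rows lam. \<forall>T\<in>rows lam. (\<lambda>h. if h < N then ?C lam S T (jb h) else 0) = ?C lam T S"
      using flip by blast
    show "\<forall>a\<in>carrier B. \<forall>lam\<in>?Lam. \<forall>S\<in>rows lam. \<exists>r. \<forall>T\<in>rows lam.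
         a \<otimes>\<^bsub>B\<^esub> ?C lam S T \<ominus>\<^bsub>B\<^esub> finsum B (\<lambda>S'. r S' \<odot>\<^bsub>B\<^esub> ?C lam S' T) (rows lam)
           \<in> span_fam B cell_fam (triple ` {i. i < N \<and> sh i < lam})"
    proof (intro ballI)
      fix a lam S assume *: "a \<in> carrier B" "lam \<in> ?Lam" "S \<in> rows lam"
      show "\<exists>r. \<forall>T\<in>rows lam.
         a \<otimes>\<^bsub>B\<^esub> ?C lam S T \<ominus>\<^bsub>B\<^esub> finsum B (\<lambda>S'. r S' \<odot>\<^bsub>B\<^esub> ?C lam S' T) (rows lam)
           \<in> span_fam B cell_fam (triple ` {i. i < N \<and> sh i < lam})"
        by (intro exI ballI) (rule cell_action[OF *(1)[unfolded talg_simps] *(2,3)])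
    qed
  qed (auto simp: rows_def)
qed

end

section \<open>The 39 basis words\<close>

text \<open>The product of the generator \<open>g\<close> with basis word number \<open>t\<close> is \<open>d ^ left_exp g t\<close> times basis word
  number \<open>left_tab g ! t\<close>; reversing a basis word gives, modulo the relations, basis word number
  \<open>rev_tab ! t\<close>. The numbering is explained by \<open>ix\<close> below.\<close>

definition word_tab :: "gen list list" where
  "word_tab = [
     [], [R0, R1, R0, R1, R0, R1], [R0], [R1, R0, R1, R0, R1], [R1, R0, R1], [R0, R1, R0],
     [R0, R1, R0, R1], [R1, R0], [R1, R0, R1, R0], [R0, R1], [R0, R1, R0, R1, R0], [R1], [E1],
     [E1, R0, E1], [E1, R0], [E1, R0, E1, R0], [E1, R0, R1], [E1, R0, R1, R0], [R0, E1],
     [R0, E1, R0, E1], [R0, E1, R0], [R0, E1, R0, E1, R0], [R0, E1, R0, R1],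
     [R0, E1, R0, R1, R0], [R1, R0, E1], [R0, R1, R0, E1], [R1, R0, E1, R0],
     [R0, R1, R0, E1, R0], [R1, R0, E1, R0, R1], [R0, R1, R0, E1, R0, R1], [E1, E0, E1],
     [E1, E0, R1], [E1, E0], [R1, E0, E1], [R1, E0, R1], [R1, E0], [E0, E1], [E0, R1], [E0]]"

fun left_tab :: "gen \<Rightarrow> nat list" where
  "left_tab R0 = [
     2, 3, 0, 1, 6, 7, 4, 5, 10, 11, 8, 9, 18, 19, 20, 21, 22, 23, 12, 13, 14, 15, 16, 17, 25,
     24, 27, 26, 29, 28, 33, 34, 35, 30, 31, 32, 36, 37, 38]" |
  "left_tab R1 = [
     11, 10, 7, 6, 9, 8, 3, 2, 5, 4, 1, 0, 12, 13, 14, 15, 16, 17, 24, 25, 26, 27, 28, 29, 18,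
     19, 20, 21, 22, 23, 30, 31, 32, 36, 37, 38, 33, 34, 35]" |
  "left_tab E0 = [
     38, 38, 38, 38, 36, 36, 36, 36, 37, 37, 37, 37, 36, 36, 37, 37, 38, 38, 36, 36, 37, 37,
     38, 38, 36, 36, 37, 37, 38, 38, 36, 37, 38, 36, 37, 38, 36, 37, 38]" |
  "left_tab E1 = [
     12, 13, 14, 15, 16, 17, 15, 14, 17, 16, 13, 12, 12, 13, 14, 15, 16, 17, 13, 12, 15, 14,
     17, 16, 13, 12, 15, 14, 17, 16, 30, 31, 32, 30, 31, 32, 30, 31, 32]"

definition rev_tab :: "nat list" where
  "rev_tab = [
     0, 1, 2, 3, 4, 5, 8, 9, 6, 7, 10, 11, 12, 13, 18, 19, 24, 25, 14, 15, 20, 21, 26, 27, 16,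
     17, 22, 23, 28, 29, 30, 33, 36, 31, 34, 37, 32, 35, 38]"

fun left_exp :: "gen \<Rightarrow> nat \<Rightarrow> nat" where
  "left_exp E0 t = (if t < 24 then 0 else if t < 30 then 1 else if t < 36 then 2 else 3)"
| "left_exp E1 t = (if 12 \<le> t \<and> t < 18 \<or> 30 \<le> t \<and> t < 33 then 1 else 0)"
| "left_exp _ t = 0"

text \<open>Spelling out the range turns a bounded quantifier into 39 closed instances for the
  simplifier.\<close>

lemma lessThan_39: "{..<39::nat} = {
     38, 37, 36, 35, 34, 33, 32, 31, 30, 29, 28, 27, 26, 25, 24, 23, 22, 21, 20, 19, 18, 17,
     16, 15, 14, 13, 12, 11, 10, 9, 8, 7, 6, 5, 4, 3, 2, 1, 0}"
  by (simp add: lessThan_nat_numeral lessThan_Suc)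

text \<open>Table entries as rewrite rules with numeral indices: a lookup is one step and never
  walks down the list.\<close>

lemma tab_simps:
  "left_tab R0 ! 0 = 2" "left_tab R0 ! 1 = 3" "left_tab R0 ! 2 = 0" "left_tab R0 ! 3 = 1"
  "left_tab R0 ! 4 = 6" "left_tab R0 ! 5 = 7" "left_tab R0 ! 6 = 4" "left_tab R0 ! 7 = 5"
  "left_tab R0 ! 8 = 10" "left_tab R0 ! 9 = 11" "left_tab R0 ! 10 = 8" "left_tab R0 ! 11 = 9"
  "left_tab R0 ! 12 = 18" "left_tab R0 ! 13 = 19" "left_tab R0 ! 14 = 20" "left_tab R0 ! 15 = 21"
  "left_tab R0 ! 16 = 22" "left_tab R0 ! 17 = 23" "left_tab R0 ! 18 = 12" "left_tab R0 ! 19 = 13"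
  "left_tab R0 ! 20 = 14" "left_tab R0 ! 21 = 15" "left_tab R0 ! 22 = 16" "left_tab R0 ! 23 = 17"
  "left_tab R0 ! 24 = 25" "left_tab R0 ! 25 = 24" "left_tab R0 ! 26 = 27" "left_tab R0 ! 27 = 26"
  "left_tab R0 ! 28 = 29" "left_tab R0 ! 29 = 28" "left_tab R0 ! 30 = 33" "left_tab R0 ! 31 = 34"
  "left_tab R0 ! 32 = 35" "left_tab R0 ! 33 = 30" "left_tab R0 ! 34 = 31" "left_tab R0 ! 35 = 32"
  "left_tab R0 ! 36 = 36" "left_tab R0 ! 37 = 37" "left_tab R0 ! 38 = 38" "left_tab R1 ! 0 = 11"
  "left_tab R1 ! 1 = 10" "left_tab R1 ! 2 = 7" "left_tab R1 ! 3 = 6" "left_tab R1 ! 4 = 9"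
  "left_tab R1 ! 5 = 8" "left_tab R1 ! 6 = 3" "left_tab R1 ! 7 = 2" "left_tab R1 ! 8 = 5"
  "left_tab R1 ! 9 = 4" "left_tab R1 ! 10 = 1" "left_tab R1 ! 11 = 0" "left_tab R1 ! 12 = 12"
  "left_tab R1 ! 13 = 13" "left_tab R1 ! 14 = 14" "left_tab R1 ! 15 = 15" "left_tab R1 ! 16 = 16"
  "left_tab R1 ! 17 = 17" "left_tab R1 ! 18 = 24" "left_tab R1 ! 19 = 25" "left_tab R1 ! 20 = 26"
  "left_tab R1 ! 21 = 27" "left_tab R1 ! 22 = 28" "left_tab R1 ! 23 = 29" "left_tab R1 ! 24 = 18"
  "left_tab R1 ! 25 = 19" "left_tab R1 ! 26 = 20" "left_tab R1 ! 27 = 21" "left_tab R1 ! 28 = 22"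
  "left_tab R1 ! 29 = 23" "left_tab R1 ! 30 = 30" "left_tab R1 ! 31 = 31" "left_tab R1 ! 32 = 32"
  "left_tab R1 ! 33 = 36" "left_tab R1 ! 34 = 37" "left_tab R1 ! 35 = 38" "left_tab R1 ! 36 = 33"
  "left_tab R1 ! 37 = 34" "left_tab R1 ! 38 = 35" "left_tab E0 ! 0 = 38" "left_tab E0 ! 1 = 38"
  "left_tab E0 ! 2 = 38" "left_tab E0 ! 3 = 38" "left_tab E0 ! 4 = 36" "left_tab E0 ! 5 = 36"
  "left_tab E0 ! 6 = 36" "left_tab E0 ! 7 = 36" "left_tab E0 ! 8 = 37" "left_tab E0 ! 9 = 37"
  "left_tab E0 ! 10 = 37" "left_tab E0 ! 11 = 37" "left_tab E0 ! 12 = 36" "left_tab E0 ! 13 = 36"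
  "left_tab E0 ! 14 = 37" "left_tab E0 ! 15 = 37" "left_tab E0 ! 16 = 38" "left_tab E0 ! 17 = 38"
  "left_tab E0 ! 18 = 36" "left_tab E0 ! 19 = 36" "left_tab E0 ! 20 = 37" "left_tab E0 ! 21 = 37"
  "left_tab E0 ! 22 = 38" "left_tab E0 ! 23 = 38" "left_tab E0 ! 24 = 36" "left_tab E0 ! 25 = 36"
  "left_tab E0 ! 26 = 37" "left_tab E0 ! 27 = 37" "left_tab E0 ! 28 = 38" "left_tab E0 ! 29 = 38"
  "left_tab E0 ! 30 = 36" "left_tab E0 ! 31 = 37" "left_tab E0 ! 32 = 38" "left_tab E0 ! 33 = 36"
  "left_tab E0 ! 34 = 37" "left_tab E0 ! 35 = 38" "left_tab E0 ! 36 = 36" "left_tab E0 ! 37 = 37"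
  "left_tab E0 ! 38 = 38" "left_tab E1 ! 0 = 12" "left_tab E1 ! 1 = 13" "left_tab E1 ! 2 = 14"
  "left_tab E1 ! 3 = 15" "left_tab E1 ! 4 = 16" "left_tab E1 ! 5 = 17" "left_tab E1 ! 6 = 15"
  "left_tab E1 ! 7 = 14" "left_tab E1 ! 8 = 17" "left_tab E1 ! 9 = 16" "left_tab E1 ! 10 = 13"
  "left_tab E1 ! 11 = 12" "left_tab E1 ! 12 = 12" "left_tab E1 ! 13 = 13" "left_tab E1 ! 14 = 14"
  "left_tab E1 ! 15 = 15" "left_tab E1 ! 16 = 16" "left_tab E1 ! 17 = 17" "left_tab E1 ! 18 = 13"
  "left_tab E1 ! 19 = 12" "left_tab E1 ! 20 = 15" "left_tab E1 ! 21 = 14" "left_tab E1 ! 22 = 17"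
  "left_tab E1 ! 23 = 16" "left_tab E1 ! 24 = 13" "left_tab E1 ! 25 = 12" "left_tab E1 ! 26 = 15"
  "left_tab E1 ! 27 = 14" "left_tab E1 ! 28 = 17" "left_tab E1 ! 29 = 16" "left_tab E1 ! 30 = 30"
  "left_tab E1 ! 31 = 31" "left_tab E1 ! 32 = 32" "left_tab E1 ! 33 = 30" "left_tab E1 ! 34 = 31"
  "left_tab E1 ! 35 = 32" "left_tab E1 ! 36 = 30" "left_tab E1 ! 37 = 31" "left_tab E1 ! 38 = 32"
  "rev_tab ! 0 = 0" "rev_tab ! 1 = 1" "rev_tab ! 2 = 2" "rev_tab ! 3 = 3" "rev_tab ! 4 = 4"
  "rev_tab ! 5 = 5" "rev_tab ! 6 = 8" "rev_tab ! 7 = 9" "rev_tab ! 8 = 6" "rev_tab ! 9 = 7"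
  "rev_tab ! 10 = 10" "rev_tab ! 11 = 11" "rev_tab ! 12 = 12" "rev_tab ! 13 = 13"
  "rev_tab ! 14 = 18" "rev_tab ! 15 = 19" "rev_tab ! 16 = 24" "rev_tab ! 17 = 25"
  "rev_tab ! 18 = 14" "rev_tab ! 19 = 15" "rev_tab ! 20 = 20" "rev_tab ! 21 = 21"
  "rev_tab ! 22 = 26" "rev_tab ! 23 = 27" "rev_tab ! 24 = 16" "rev_tab ! 25 = 17"
  "rev_tab ! 26 = 22" "rev_tab ! 27 = 23" "rev_tab ! 28 = 28" "rev_tab ! 29 = 29"
  "rev_tab ! 30 = 30" "rev_tab ! 31 = 33" "rev_tab ! 32 = 36" "rev_tab ! 33 = 31"
  "rev_tab ! 34 = 34" "rev_tab ! 35 = 37" "rev_tab ! 36 = 32" "rev_tab ! 37 = 35"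
  "rev_tab ! 38 = 38" "word_tab ! 0 = []" "word_tab ! 1 = [R0, R1, R0, R1, R0, R1]"
  "word_tab ! 2 = [R0]" "word_tab ! 3 = [R1, R0, R1, R0, R1]" "word_tab ! 4 = [R1, R0, R1]"
  "word_tab ! 5 = [R0, R1, R0]" "word_tab ! 6 = [R0, R1, R0, R1]" "word_tab ! 7 = [R1, R0]"
  "word_tab ! 8 = [R1, R0, R1, R0]" "word_tab ! 9 = [R0, R1]"
  "word_tab ! 10 = [R0, R1, R0, R1, R0]" "word_tab ! 11 = [R1]" "word_tab ! 12 = [E1]"
  "word_tab ! 13 = [E1, R0, E1]" "word_tab ! 14 = [E1, R0]" "word_tab ! 15 = [E1, R0, E1, R0]"
  "word_tab ! 16 = [E1, R0, R1]" "word_tab ! 17 = [E1, R0, R1, R0]" "word_tab ! 18 = [R0, E1]"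
  "word_tab ! 19 = [R0, E1, R0, E1]" "word_tab ! 20 = [R0, E1, R0]"
  "word_tab ! 21 = [R0, E1, R0, E1, R0]" "word_tab ! 22 = [R0, E1, R0, R1]"
  "word_tab ! 23 = [R0, E1, R0, R1, R0]" "word_tab ! 24 = [R1, R0, E1]"
  "word_tab ! 25 = [R0, R1, R0, E1]" "word_tab ! 26 = [R1, R0, E1, R0]"
  "word_tab ! 27 = [R0, R1, R0, E1, R0]" "word_tab ! 28 = [R1, R0, E1, R0, R1]"
  "word_tab ! 29 = [R0, R1, R0, E1, R0, R1]" "word_tab ! 30 = [E1, E0, E1]"
  "word_tab ! 31 = [E1, E0, R1]" "word_tab ! 32 = [E1, E0]" "word_tab ! 33 = [R1, E0, E1]"
  "word_tab ! 34 = [R1, E0, R1]" "word_tab ! 35 = [R1, E0]" "word_tab ! 36 = [E0, E1]"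
  "word_tab ! 37 = [E0, R1]" "word_tab ! 38 = [E0]"
  by (simp_all add: rev_tab_def word_tab_def)

declare left_tab.simps [simp del]

text \<open>A pair \<open>(t, k)\<close> stands for \<open>d ^ k\<close> times basis word
  \<open>t\<close>.\<close>

definition lact :: "gen \<Rightarrow> nat \<times> nat \<Rightarrow> nat \<times> nat" where
  "lact g x = (left_tab g ! fst x, left_exp g (fst x) + snd x)"

definition flip :: "nat \<times> nat \<Rightarrow> nat \<times> nat" where
  "flip x = (rev_tab ! fst x, snd x)"

text \<open>Right multiplication as reversal, left multiplication and reversal again, so that one
  table serves both sides.\<close>

definition ract :: "gen \<Rightarrow> nat \<times> nat \<Rightarrow> nat \<times> nat" where
  "ract g x = flip (lact g (flip x))"

definition wval :: "gen list \<Rightarrow> nat \<times> nat" where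
  "wval w = foldr lact w (0, 0)"

definition mu :: "nat \<Rightarrow> nat \<Rightarrow> nat" where
  "mu s t = fst (foldr lact (word_tab ! s) (t, 0))"

definition ex :: "nat \<Rightarrow> nat \<Rightarrow> nat" where
  "ex s t = snd (foldr lact (word_tab ! s) (t, 0))"

section \<open>Associativity from commuting left and right multiplications\<close>

lemma all_gen: "(\<forall>g. P g) \<longleftrightarrow> P R0 \<and> P R1 \<and> P E0 \<and> P E1"
  using gen.exhaust by metis

lemma left_tab_less: "\<forall>t\<in>{..<39}. \<forall>g. left_tab g ! t < 39"
  unfolding lessThan_39 all_gen by (simp add: tab_simps del: One_nat_def)

lemma rev_tab_check: "\<forall>t\<in>{..<39}. rev_tab ! t < 39 \<and> rev_tab ! (rev_tab ! t) = t"
  unfolding lessThan_39 by (simp add: tab_simps del: One_nat_def)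

text \<open>The finite core of associativity: generators acting from opposite sides commute on each
  word. These are 39 * 16 cases, in place of 39 * 39 * 39 triples of basis words.\<close>

lemma lact_ract_check: "\<forall>t\<in>{..<39}. \<forall>g h. lact g (ract h (t, 0)) = ract h (lact g (t, 0))"
  unfolding lessThan_39 all_gen by (simp add: lact_def ract_def flip_def tab_simps del: One_nat_def)

lemma lact_ract_0: "\<forall>g. lact g (0, 0) = ract g (0, 0)"
  unfolding all_gen by (simp add: lact_def ract_def flip_def tab_simps del: One_nat_def)

lemma wval_word_check: "\<forall>t\<in>{..<39}. wval (word_tab ! t) = (t, 0)"
  unfolding lessThan_39 by (simp add: wval_def lact_def tab_simps del: One_nat_def)

lemma wval_word: "t < 39 \<Longrightarrow> wval (word_tab ! t) = (t, 0)"
  using wval_word_check by simp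

lemma flip_flip: "fst x < 39 \<Longrightarrow> flip (flip x) = x"
  using rev_tab_check by (simp add: flip_def)

lemma act_less:
  "fst x < 39 \<Longrightarrow> fst (lact g x) < 39" "fst x < 39 \<Longrightarrow> fst (flip x) < 39"
  "fst x < 39 \<Longrightarrow> fst (ract g x) < 39"
  using left_tab_less rev_tab_check by (simp_all add: lact_def flip_def ract_def)

lemma foldr_lact_less: "fst x < 39 \<Longrightarrow> fst (foldr lact w x) < 39"
  by (induction w) (auto intro: act_less)

lemma wval_less: "fst (wval w) < 39"
  unfolding wval_def by (rule foldr_lact_less) simp

definition shift :: "nat \<Rightarrow> nat \<times> nat \<Rightarrow> nat \<times> nat" where
  "shift k x = (fst x, snd x + k)"

lemma act_shift:
  "lact g (shift k x) = shift k (lact g x)" "ract g (shift k x) = shift k (ract g x)"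
  by (simp_all add: lact_def ract_def flip_def shift_def)

lemma foldr_lact_shift: "foldr lact w (shift k x) = shift k (foldr lact w x)"
  by (induction w) (simp_all add: act_shift)

lemma lact_ract: "fst x < 39 \<Longrightarrow> lact g (ract h x) = ract h (lact g x)"
proof -
  assume "fst x < 39"
  then have "lact g (ract h (fst x, 0)) = ract h (lact g (fst x, 0))"
    using lact_ract_check by simp
  moreover have "x = shift (snd x) (fst x, 0)" by (simp add: shift_def)
  ultimately show ?thesis by (metis act_shift)
qed

lemma foldr_lact_ract: "fst x < 39 \<Longrightarrow> foldr lact w (ract h x) = ract h (foldr lact w x)"
  by (induction w) (simp_all add: lact_ract foldr_lact_less)

text \<open>\<open>wval\<close> is built from left multiplications. The last letter acts first, on
  the empty word, where both actions agree by \<open>lact_ract_0\<close>; as a right multiplication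
  it then moves out past all the others.\<close>

lemma wval_snoc: "wval (w @ [h]) = ract h (wval w)"
  using lact_ract_0 by (simp add: wval_def foldr_lact_ract)

lemma wval_rev: "wval (rev w) = flip (wval w)"
proof (induction w)
  case Nil
  then show ?case by (simp add: wval_def flip_def tab_simps)
next
  case (Cons g w)
  then show ?case
    using wval_snoc[of "rev w" g] by (simp add: ract_def flip_flip wval_less) (simp add: wval_def)
qed

text \<open>Left and right multiplications commute, so the value of a product only depends on the
  values of the factors.\<close>

lemma wval_append:
  "wval (x @ y) = (mu (fst (wval x)) (fst (wval y)),
     ex (fst (wval x)) (fst (wval y)) + snd (wval x) + snd (wval y))"
proof -
  let ?s = "fst (wval x)" and ?t = "fst (wval y)"
  have fold: "wval (u @ v) = fold ract v (wval u)" for u v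
  proof (induction v rule: rev_induct)
    case (snoc h v)
    then show ?case using wval_snoc[of "u @ v" h] by simp
  qed simp
  have fold_shift: "fold ract v (shift k z) = shift k (fold ract v z)" for v k z
    by (induction v arbitrary: z) (simp_all add: act_shift)
  have eq: "z = shift (snd z) (fst z, 0)" for z by (simp add: shift_def)
  have "wval (x @ y) = foldr lact x (wval y)" by (simp add: wval_def)
  also have "\<dots> = shift (snd (wval y)) (foldr lact x (?t, 0))"
    using eq[of "wval y"] foldr_lact_shift by metis
  also have "foldr lact x (?t, 0) = wval (x @ word_tab ! ?t)"
    using wval_word[OF wval_less[of y]] by (simp add: wval_def)
  also have "\<dots> = fold ract (word_tab ! ?t) (wval x)" by (rule fold)
  also have "\<dots> = shift (snd (wval x)) (fold ract (word_tab ! ?t) (wval (word_tab ! ?s)))"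
    using eq[of "wval x"] fold_shift wval_word[OF wval_less[of x]] by metis
  also have "fold ract (word_tab ! ?t) (wval (word_tab ! ?s)) = wval (word_tab ! ?s @ word_tab ! ?t)"
    by (rule fold[symmetric])
  also have "\<dots> = foldr lact (word_tab ! ?s) (?t, 0)"
    using wval_word[OF wval_less[of y]] by (simp add: wval_def)
  finally show ?thesis by (simp add: shift_def mu_def ex_def)
qed

lemma mu_less: "\<lbrakk>s < 39; t < 39\<rbrakk> \<Longrightarrow> mu s t < 39"
  by (simp add: mu_def foldr_lact_less)

text \<open>The same concatenation of three words is evaluated by \<open>wval_append\<close> in two
  ways; the exponents give the cocycle identity.\<close>

lemma mu_assoc: "\<lbrakk>s < 39; t < 39; u < 39\<rbrakk> \<Longrightarrow> mu (mu s t) u = mu s (mu t u)"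
  and ex_assoc: "\<lbrakk>s < 39; t < 39; u < 39\<rbrakk> \<Longrightarrow> ex s t + ex (mu s t) u = ex t u + ex s (mu t u)"
proof -
  assume "s < 39" "t < 39" "u < 39"
  moreover from this have
    "wval ((word_tab ! s @ word_tab ! t) @ word_tab ! u) = (mu (mu s t) u, ex (mu s t) u + ex s t)"
    "wval (word_tab ! s @ (word_tab ! t @ word_tab ! u)) = (mu s (mu t u), ex s (mu t u) + ex t u)"
    by (simp_all only: wval_append wval_word fst_conv snd_conv) simp_all
  ultimately show "mu (mu s t) u = mu s (mu t u)" "ex s t + ex (mu s t) u = ex t u + ex s (mu t u)"
    by simp_all
qed

lemma mu_0: "t < 39 \<Longrightarrow> mu 0 t = t" "t < 39 \<Longrightarrow> mu t 0 = t"
  and ex_0: "t < 39 \<Longrightarrow> ex 0 t = 0" "t < 39 \<Longrightarrow> ex t 0 = 0"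
  using wval_word[of t] by (simp_all add: mu_def ex_def tab_simps wval_def)

lemma rev_mu: "\<lbrakk>s < 39; t < 39\<rbrakk> \<Longrightarrow> rev_tab ! mu s t = mu (rev_tab ! t) (rev_tab ! s)"
  and rev_ex: "\<lbrakk>s < 39; t < 39\<rbrakk> \<Longrightarrow> ex (rev_tab ! t) (rev_tab ! s) = ex s t"
proof -
  assume st: "s < 39" "t < 39"
  have w: "wval (rev (word_tab ! u)) = (rev_tab ! u, 0)" if "u < 39" for u
    using that by (simp add: wval_rev wval_word flip_def)
  have "wval (rev (word_tab ! s @ word_tab ! t)) = flip (mu s t, ex s t)"
    unfolding wval_rev wval_append using st by (simp add: wval_word)
  moreover have "wval (rev (word_tab ! s @ word_tab ! t)) =
      (mu (rev_tab ! t) (rev_tab ! s), ex (rev_tab ! t) (rev_tab ! s))"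
    unfolding rev_append wval_append using st by (simp add: w)
  ultimately show "rev_tab ! mu s t = mu (rev_tab ! t) (rev_tab ! s)"
    "ex (rev_tab ! t) (rev_tab ! s) = ex s t"
    by (simp_all add: flip_def)
qed

lemma twisted_monoid_mu: "twisted_monoid 39 mu (\<lambda>s t. (d::'k::field) ^ ex s t)"
proof
  fix s t u :: nat assume "s < 39" "t < 39" "u < 39"
  then show "d ^ ex s t * d ^ ex (mu s t) u = d ^ ex t u * d ^ ex s (mu t u)"
    using ex_assoc by (simp add: power_add[symmetric])
qed (simp_all add: mu_less mu_assoc mu_0 ex_0)

text \<open>Basis word \<open>ix l p q h\<close>: layer 3 is the Weyl group, layer 2 consists of the words
  \<open>w\<^sub>p E1 z\<^sup>h w\<^sub>q\<^sup>-\<^sup>1\<close> with \<open>w = (1, R0, R1 R0)\<close> and \<open>z = (R0 R1)\<^sup>3\<close>, and layer 1 of the words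
  \<open>v\<^sub>p E0 v\<^sub>q\<^sup>-\<^sup>1\<close> with \<open>v = (R0 R1, R1, 1)\<close>.\<close>

definition np :: "nat \<Rightarrow> nat" where
  "np l = (if l = 3 then 1 else 3)"

definition nb :: "nat \<Rightarrow> nat" where
  "nb l = (if l = 3 then 12 else if l = 2 then 2 else 1)"

definition ix :: "nat \<Rightarrow> nat \<Rightarrow> nat \<Rightarrow> nat \<Rightarrow> nat" where
  "ix l p q h = (if l = 3 then h else if l = 2 then 12 + 6 * p + 2 * q + h else 30 + 3 * p + q)"

definition lay :: "nat \<Rightarrow> nat" where
  "lay t = (if t < 12 then 3 else if t < 30 then 2 else 1)"

definition pp :: "nat \<Rightarrow> nat" where
  "pp t = (if t < 12 then 0 else if t < 30 then (t - 12) div 6 else (t - 30) div 3)"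

definition qq :: "nat \<Rightarrow> nat" where
  "qq t = (if t < 12 then 0 else if t < 30 then (t - 12) div 2 mod 3 else (t - 30) mod 3)"

definition hh :: "nat \<Rightarrow> nat" where
  "hh t = (if t < 12 then t else if t < 30 then (t - 12) mod 2 else 0)"

section \<open>Layers and their behaviour under multiplication\<close>

lemmas ix_defs = np_def nb_def ix_def lay_def pp_def qq_def hh_def

lemma co_check: "\<forall>t\<in>{..<39}. 1 \<le> lay t \<and> lay t \<le> 3 \<and> pp t < np (lay t) \<and> qq t < np (lay t) \<and>
    hh t < nb (lay t) \<and> ix (lay t) (pp t) (qq t) (hh t) = t"
  unfolding lessThan_39 by (simp add: ix_defs del: One_nat_def)

lemma ix_co:
  assumes "1 \<le> l" "l \<le> 3" "p < np l" "q < np l" "h < nb l"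
  shows "ix l p q h < 39 \<and> lay (ix l p q h) = l \<and> pp (ix l p q h) = p \<and>
    qq (ix l p q h) = q \<and> hh (ix l p q h) = h"
proof -
  have "l = 1 \<or> l = 2 \<or> l = 3" using assms by auto
  then show ?thesis
  proof (elim disjE)
    assume l: "l = 2"
    have "(6 * p + (2 * q + h)) div 6 = p" "(6 * p + (2 * q + h)) div 2 mod 3 = q" "(6 * p + (2 * q + h)) mod 2 = h"
      using assms l by (simp_all add: np_def nb_def) presburger+
    then show ?thesis using assms l by (simp add: ix_defs)
  next
    assume l: "l = 1"
    have "(3 * p + q) div 3 = p" "(3 * p + q) mod 3 = q" using assms l by (simp_all add: np_def)
    then show ?thesis using assms l by (simp add: ix_defs)
  qed (use assms in \<open>simp add: ix_defs\<close>)
qed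

text \<open>The inner label \<open>h\<close> is itself the number of a Weyl group word, 0 for the
  identity and 1 for \<open>z\<close> in layer 2, so \<open>rev_tab\<close> and \<open>mu\<close>
  apply to it as well.\<close>

lemma rev_ix_check: "\<forall>t\<in>{..<39}. rev_tab ! t = ix (lay t) (qq t) (pp t) (rev_tab ! hh t) \<and>
    rev_tab ! hh t < nb (lay t)"
  unfolding lessThan_39 by (simp add: ix_defs tab_simps del: One_nat_def)

lemma mu_2_check: "\<forall>s\<in>{0, 1}. \<forall>t\<in>{0, 1}. mu s t < 2"
  by (simp add: mu_def lact_def tab_simps del: One_nat_def)

lemma mu_12_check: "\<forall>s\<in>{..<12}. \<forall>t\<in>{..<12}. mu s t < 12"
proof -
  have "{..<12::nat} = {11, 10, 9, 8, 7, 6, 5, 4, 3, 2, 1, 0}"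
    by (simp add: lessThan_nat_numeral lessThan_Suc)
  then show ?thesis by (simp add: mu_def lact_def tab_simps del: One_nat_def)
qed

lemma lay_left_check: "\<forall>t\<in>{..<39}. \<forall>g. lay (left_tab g ! t) \<le> lay t"
  unfolding lessThan_39 all_gen by (simp add: lay_def tab_simps del: One_nat_def)

text \<open>The layer axiom for a single generator, stated over all basis words so that it is a
  table check; \<open>left_word\<close> extends it to products of generators.\<close>

lemma left_check: "\<forall>t\<in>{..<39}. \<forall>g.
    (if lay (left_tab g ! ix (lay t) (pp t) 0 0) = lay t
     then left_tab g ! t = ix (lay t) (pp (left_tab g ! ix (lay t) (pp t) 0 0)) (qq t)
            (mu (hh (left_tab g ! ix (lay t) (pp t) 0 0)) (hh t)) \<and>
          left_exp g t = left_exp g (ix (lay t) (pp t) 0 0)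
     else lay (left_tab g ! t) \<noteq> lay t)"
  unfolding lessThan_39 all_gen by (simp add: mu_def lact_def tab_simps ix_defs del: One_nat_def)

lemma mu_nb_less:
  assumes "1 \<le> l" "l \<le> 3" "s < nb l" "t < nb l"
  shows "mu s t < nb l"
proof -
  have "l = 1 \<or> l = 2 \<or> l = 3" using assms by auto
  then show ?thesis
  proof (elim disjE)
    assume "l = 2"
    then show ?thesis using assms mu_2_check by (auto simp: nb_def less_2_cases_iff)
  qed (use assms mu_12_check mu_0 in \<open>auto simp: nb_def\<close>)
qed

lemma lay_foldr: "t < 39 \<Longrightarrow> lay (fst (foldr lact w (t, 0))) \<le> lay t"
proof (induction w)
  case (Cons g w)
  have "fst (foldr lact w (t, 0)) < 39" using Cons by (simp add: foldr_lact_less)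
  then have "lay (fst (foldr lact (g # w) (t, 0))) \<le> lay (fst (foldr lact w (t, 0)))"
    using lay_left_check by (simp add: lact_def)
  then show ?case using Cons by simp
qed simp

lemma co:
  assumes "t < 39"
  shows "1 \<le> lay t \<and> lay t \<le> 3 \<and> pp t < np (lay t) \<and> qq t < np (lay t) \<and>
    hh t < nb (lay t) \<and> ix (lay t) (pp t) (qq t) (hh t) = t"
  using co_check assms by simp

lemma nb_less: "h < nb l \<Longrightarrow> h < 39" and nb_pos: "0 < nb l" and np_pos: "0 < np l"
  by (auto simp: nb_def np_def split: if_splits)

lemma left_gen:
  assumes "1 \<le> l" "l \<le> 3" "p < np l" "q < np l" "h < nb l"
  shows "if lay (left_tab g ! ix l p 0 0) = l
    then left_tab g ! ix l p q h = ix l (pp (left_tab g ! ix l p 0 0)) q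
        (mu (hh (left_tab g ! ix l p 0 0)) h) \<and>
      left_exp g (ix l p q h) = left_exp g (ix l p 0 0)
    else lay (left_tab g ! ix l p q h) \<noteq> l"
proof -
  have t: "ix l p q h \<in> {..<39}" and c: "lay (ix l p q h) = l" "pp (ix l p q h) = p"
    "qq (ix l p q h) = q" "hh (ix l p q h) = h"
    using ix_co[OF assms] by simp_all
  show ?thesis using bspec[OF left_check t, THEN spec, of g] unfolding c .
qed

text \<open>The extra invariant \<open>qq (fst (u w)) = 0\<close> identifies
  \<open>fst (u w)\<close> with some \<open>ix l p1 0 h1\<close>, to which the generator case
  applies again; associativity of \<open>mu\<close> collects the inner labels.\<close>

lemma left_word:
  assumes l: "1 \<le> l" "l \<le> 3" "p < np l" "q < np l" "h < nb l"
  defines "u w \<equiv> foldr lact w (ix l p 0 0, 0)" and "v w \<equiv> foldr lact w (ix l p q h, 0)"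
  shows "if lay (fst (u w)) = l
    then fst (v w) = ix l (pp (fst (u w))) q (mu (hh (fst (u w))) h) \<and> qq (fst (u w)) = 0 \<and>
      snd (v w) = snd (u w)
    else lay (fst (v w)) \<noteq> l"
proof (induction w)
  case Nil
  have "h < 39" using l(5) by (rule nb_less)
  then show ?case
    using ix_co[OF l(1,2,3) np_pos nb_pos] l by (simp add: u_def v_def mu_0)
next
  case (Cons g w)
  have step: "fst (u (g # w)) = left_tab g ! fst (u w)" "fst (v (g # w)) = left_tab g ! fst (v w)"
    "snd (u (g # w)) = left_exp g (fst (u w)) + snd (u w)"
    "snd (v (g # w)) = left_exp g (fst (v w)) + snd (v w)"
    by (simp_all add: u_def v_def lact_def)
  have less: "fst (u w) < 39" "fst (v w) < 39"
    unfolding u_def v_def using ix_co[OF l] ix_co[OF l(1,2,3) np_pos nb_pos]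
    by (simp_all add: foldr_lact_less)
  show ?case
  proof (cases "lay (fst (u w)) = l")
    case True
    define p1 h1 where "p1 = pp (fst (u w))" and "h1 = hh (fst (u w))"
    define b where "b = left_tab g ! ix l p1 0 0"
    have p1: "p1 < np l" and h1: "h1 < nb l"
      using co[OF less(1)] True by (simp_all add: p1_def h1_def)
    have vw: "fst (v w) = ix l p1 q (mu h1 h)" "snd (v w) = snd (u w)" and uw: "fst (u w) = ix l p1 0 h1"
      using Cons True co[OF less(1)] by (simp_all add: p1_def h1_def)
    have h1h: "mu h1 h < nb l" using mu_nb_less l h1 by simp
    have b39: "b < 39" unfolding b_def
      using ix_co[OF l(1,2) p1 np_pos nb_pos] left_tab_less by simp
    note gu = left_gen[OF l(1,2) p1 np_pos h1, of g] and gv = left_gen[OF l(1,2) p1 l(4) h1h, of g]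
    show ?thesis
    proof (cases "lay b = l")
      case b: True
      have hb: "hh b < nb l" "pp b < np l" using co[OF b39] b by simp_all
      have u': "fst (u (g # w)) = ix l (pp b) 0 (mu (hh b) h1)"
        "fst (v (g # w)) = ix l (pp b) q (mu (hh b) (mu h1 h))" "snd (v (g # w)) = snd (u (g # w))"
        using gu gv b by (simp_all add: step uw vw b_def)
      moreover have "mu (hh b) h1 < nb l" using mu_nb_less l hb h1 by simp
      moreover have "mu (mu (hh b) h1) h = mu (hh b) (mu h1 h)"
        using mu_assoc nb_less hb(1) h1 l(5) by blast
      ultimately show ?thesis using ix_co[OF l(1,2) hb(2) np_pos] by simp
    next
      case False
      then show ?thesis using gu gv by (simp add: step uw vw b_def)
    qed
  next
    \<comment> \<open>Once below layer \<open>l\<close>, no further letter leads back up.\<close>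
    case False
    have "lay (fst (u w)) \<le> l" "lay (fst (v w)) \<le> l"
      unfolding u_def v_def using ix_co[OF l] ix_co[OF l(1,2,3) np_pos nb_pos] lay_foldr by metis+
    then have "lay (fst (u w)) < l" "lay (fst (v w)) < l" using False Cons by simp_all
    then have "lay (fst (u (g # w))) < l" "lay (fst (v (g # w))) < l"
      unfolding step using lay_left_check less by (meson le_less_trans lessThan_iff)+
    then show ?thesis by simp
  qed
qed

lemma left:
  assumes "s < 39" "1 \<le> l" "l \<le> 3" "p < np l" "q < np l" "h < nb l"
  shows "if lay (mu s (ix l p 0 0)) = l
    then mu s (ix l p q h) = ix l (pp (mu s (ix l p 0 0))) q (mu (hh (mu s (ix l p 0 0))) h) \<and>
      ex s (ix l p q h) = ex s (ix l p 0 0)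
    else lay (mu s (ix l p q h)) \<noteq> l"
  using left_word[OF assms(2-6), of "word_tab ! s"] by (simp add: mu_def ex_def split: if_splits)

lemma rev_ix:
  assumes "1 \<le> l" "l \<le> 3" "p < np l" "q < np l" "h < nb l"
  shows "rev_tab ! ix l p q h = ix l q p (rev_tab ! h)" "rev_tab ! h < nb l"
proof -
  have t: "ix l p q h \<in> {..<39}" and c: "lay (ix l p q h) = l" "pp (ix l p q h) = p"
    "qq (ix l p q h) = q" "hh (ix l p q h) = h"
    using ix_co[OF assms] by simp_all
  show "rev_tab ! ix l p q h = ix l q p (rev_tab ! h)" "rev_tab ! h < nb l"
    using bspec[OF rev_ix_check t] unfolding c by simp_all
qed

text \<open>Left multiplication never raises the layer of the right factor; the bound by the left
  factor is the mirror image, since reversal preserves layers.\<close>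

lemma lay_mu:
  assumes "s < 39" "t < 39"
  shows "lay (mu s t) \<le> lay s \<and> lay (mu s t) \<le> lay t"
proof -
  have le: "lay (mu s t) \<le> lay t" if "t < 39" for s t
    using lay_foldr[OF that] by (simp add: mu_def)
  have lay_rev: "lay (rev_tab ! t) = lay t" if "t < 39" for t
    using rev_ix[of "lay t" "pp t" "qq t" "hh t"] co[OF that] ix_co by metis
  have "lay (mu s t) = lay (mu (rev_tab ! t) (rev_tab ! s))"
    using lay_rev[OF mu_less[OF assms]] rev_mu[OF assms] by simp
  also have "\<dots> \<le> lay s" using le lay_rev rev_tab_check assms by (metis lessThan_iff)
  finally show ?thesis using le assms by simp
qed

text \<open>The base word of layer 1 is number 30, \<open>E1 E0 E1\<close>, which equals
  \<open>R0 R1 E0 R1 R0\<close>. Multiplying it by \<open>E1\<close> on either side only gives a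
  factor \<open>d\<close>, as the chain condition with the layer 2 idempotent demands.
  \<open>E0\<close> would not do as base word: \<open>E1 E0\<close> is a different basis
  word.\<close>

lemma idem_check: "\<forall>l\<in>{1, 2, 3}. \<forall>k\<in>{1, 2, 3}. k \<le> l \<longrightarrow>
    mu (ix l 0 0 0) (ix k 0 0 0) = ix k 0 0 0 \<and> mu (ix k 0 0 0) (ix l 0 0 0) = ix k 0 0 0 \<and>
    ex (ix l 0 0 0) (ix k 0 0 0) = (if l = 1 then 3 else if l = 2 then 1 else 0) \<and>
    ex (ix k 0 0 0) (ix l 0 0 0) = (if l = 1 then 3 else if l = 2 then 1 else 0)"
  by (simp add: mu_def ex_def lact_def tab_simps ix_def del: One_nat_def)

section \<open>Kazhdan-Lusztig cells\<close>

text \<open>In this numbering the reflections \<open>s = R0\<close> and \<open>t = R1 R0 R1\<close>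
  are 2 and 4, the central involution is 1, and adding 1 to an even number multiplies by it.\<close>

lemma mu_12:
  "mu 0 0 = 0" "mu 0 1 = 1" "mu 0 2 = 2" "mu 0 3 = 3" "mu 0 4 = 4" "mu 0 5 = 5" "mu 0 6 = 6"
  "mu 0 7 = 7" "mu 0 8 = 8" "mu 0 9 = 9" "mu 0 10 = 10" "mu 0 11 = 11" "mu 1 0 = 1" "mu 1 1 = 0"
  "mu 1 2 = 3" "mu 1 3 = 2" "mu 1 4 = 5" "mu 1 5 = 4" "mu 1 6 = 7" "mu 1 7 = 6" "mu 1 8 = 9"
  "mu 1 9 = 8" "mu 1 10 = 11" "mu 1 11 = 10" "mu 2 0 = 2" "mu 2 1 = 3" "mu 2 2 = 0" "mu 2 3 = 1"
  "mu 2 4 = 6" "mu 2 5 = 7" "mu 2 6 = 4" "mu 2 7 = 5" "mu 2 8 = 10" "mu 2 9 = 11" "mu 2 10 = 8"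
  "mu 2 11 = 9" "mu 3 0 = 3" "mu 3 1 = 2" "mu 3 2 = 1" "mu 3 3 = 0" "mu 3 4 = 7" "mu 3 5 = 6"
  "mu 3 6 = 5" "mu 3 7 = 4" "mu 3 8 = 11" "mu 3 9 = 10" "mu 3 10 = 9" "mu 3 11 = 8" "mu 4 0 = 4"
  "mu 4 1 = 5" "mu 4 2 = 8" "mu 4 3 = 9" "mu 4 4 = 0" "mu 4 5 = 1" "mu 4 6 = 10" "mu 4 7 = 11"
  "mu 4 8 = 2" "mu 4 9 = 3" "mu 4 10 = 6" "mu 4 11 = 7" "mu 5 0 = 5" "mu 5 1 = 4" "mu 5 2 = 9"
  "mu 5 3 = 8" "mu 5 4 = 1" "mu 5 5 = 0" "mu 5 6 = 11" "mu 5 7 = 10" "mu 5 8 = 3" "mu 5 9 = 2"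
  "mu 5 10 = 7" "mu 5 11 = 6" "mu 6 0 = 6" "mu 6 1 = 7" "mu 6 2 = 10" "mu 6 3 = 11" "mu 6 4 = 2"
  "mu 6 5 = 3" "mu 6 6 = 8" "mu 6 7 = 9" "mu 6 8 = 0" "mu 6 9 = 1" "mu 6 10 = 4" "mu 6 11 = 5"
  "mu 7 0 = 7" "mu 7 1 = 6" "mu 7 2 = 11" "mu 7 3 = 10" "mu 7 4 = 3" "mu 7 5 = 2" "mu 7 6 = 9"
  "mu 7 7 = 8" "mu 7 8 = 1" "mu 7 9 = 0" "mu 7 10 = 5" "mu 7 11 = 4" "mu 8 0 = 8" "mu 8 1 = 9"
  "mu 8 2 = 4" "mu 8 3 = 5" "mu 8 4 = 10" "mu 8 5 = 11" "mu 8 6 = 0" "mu 8 7 = 1" "mu 8 8 = 6"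
  "mu 8 9 = 7" "mu 8 10 = 2" "mu 8 11 = 3" "mu 9 0 = 9" "mu 9 1 = 8" "mu 9 2 = 5" "mu 9 3 = 4"
  "mu 9 4 = 11" "mu 9 5 = 10" "mu 9 6 = 1" "mu 9 7 = 0" "mu 9 8 = 7" "mu 9 9 = 6" "mu 9 10 = 3"
  "mu 9 11 = 2" "mu 10 0 = 10" "mu 10 1 = 11" "mu 10 2 = 6" "mu 10 3 = 7" "mu 10 4 = 8"
  "mu 10 5 = 9" "mu 10 6 = 2" "mu 10 7 = 3" "mu 10 8 = 4" "mu 10 9 = 5" "mu 10 10 = 0"
  "mu 10 11 = 1" "mu 11 0 = 11" "mu 11 1 = 10" "mu 11 2 = 7" "mu 11 3 = 6" "mu 11 4 = 9"
  "mu 11 5 = 8" "mu 11 6 = 3" "mu 11 7 = 2" "mu 11 8 = 5" "mu 11 9 = 4" "mu 11 10 = 1"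
  "mu 11 11 = 0"
  by (simp_all add: mu_def lact_def tab_simps del: One_nat_def)

lemma lessThan_12: "{..<12::nat} = {11, 10, 9, 8, 7, 6, 5, 4, 3, 2, 1, 0}"
  by (simp add: lessThan_nat_numeral lessThan_Suc)

lemma sum_lessThan_12:
  "(\<Sum>h<12. f h) = f 0 + f 1 + f 2 + f 3 + f 4 + f 5 + f 6 + f 7 + f 8 + f 9 + f 10 + f (11::nat)"
  for f :: "nat \<Rightarrow> 'a::comm_monoid_add"
  by (simp add: numeral_eq_Suc)

text \<open>The monoid of the top layer is \<open>S\<^sub>3 \<times> \<int>/2\<close>, the element number \<open>2 * \<sigma> + \<zeta>\<close> having components
  \<open>\<sigma> \<in> {1, s, t, st, ts, sts}\<close> and \<open>\<zeta>\<close>; those of the other layers are its submonoids \<open>{0, 1}\<close>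
  and \<open>{0}\<close>. The cellular basis is the Kazhdan-Lusztig basis at \<open>q = 1\<close>: all Kazhdan-Lusztig
  polynomials are 1, so each basis element is the sum over a Bruhat interval.\<close>

definition len3 :: "nat \<Rightarrow> nat" where
  "len3 s = (if s = 0 then 0 else if s \<le> 2 then 1 else if s \<le> 4 then 2 else 3)"

text \<open>In a dihedral group such as \<open>S\<^sub>3\<close>, an element lies strictly below
  another exactly when it is shorter; the order on the product is componentwise.\<close>

definition bruhat :: "nat \<Rightarrow> nat \<Rightarrow> bool" where
  "bruhat g i \<longleftrightarrow> g mod 2 \<le> i mod 2 \<and> (g div 2 = i div 2 \<or> len3 (g div 2) < len3 (i div 2))"

definition kl :: "nat \<Rightarrow> nat \<Rightarrow> int" where
  "kl i g = (if bruhat g i then 1 else 0)"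

text \<open>The Moebius function of the Bruhat order, a sign given by the parity of the length
  difference. It inverts \<open>kl\<close> because that is the incidence matrix of the
  order.\<close>

definition kl_inv :: "nat \<Rightarrow> nat \<Rightarrow> int" where
  "kl_inv g i = (if bruhat i g
     then (if even (len3 (g div 2) + g mod 2 + len3 (i div 2) + i mod 2) then 1 else - 1) else 0)"

text \<open>Numbers the two-sided cells from the bottom: the longest element of
  \<open>S\<^sub>3\<close>, then the four middle elements, then the identity, each split by the
  central component, whose nontrivial element is lower.\<close>

definition shape :: "nat \<Rightarrow> nat" where
  "shape i = 2 * (if i div 2 = 0 then 2 else if i div 2 = 5 then 0 else 1) + (1 - i mod 2)"

text \<open>In the middle cell the row is the left descent, 0 for \<open>s\<close> and 1 for
  \<open>t\<close>; the row of the inverse is then the right descent, which is constant on left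
  cells.\<close>

definition trow :: "nat \<Rightarrow> nat" where
  "trow i = (if i div 2 = 2 \<or> i div 2 = 4 then 1 else 0)"

definition cell_ix :: "nat \<Rightarrow> nat \<Rightarrow> nat \<Rightarrow> nat" where
  "cell_ix lam S T = 2 * (if lam div 2 = 2 then 0 else if lam div 2 = 0 then 5
     else if S = 0 then (if T = 0 then 1 else 3) else (if T = 0 then 4 else 2)) + (1 - lam mod 2)"

text \<open>The conditional in place of a 0-1 factor lets the simplifier discard terms without
  evaluating \<open>mu\<close>.\<close>

definition kl_mult :: "nat \<Rightarrow> nat \<Rightarrow> nat \<Rightarrow> nat \<Rightarrow> int" where
  "kl_mult N g i k = (\<Sum>h<N. if bruhat h i then kl_inv (mu g h) k else 0)"

lemma kl_mult_eq: "kl_mult N g i k = (\<Sum>h<N. kl i h * kl_inv (mu g h) k)"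
  unfolding kl_mult_def by (intro sum.cong) (auto simp: kl_def)

definition same_col :: "nat \<Rightarrow> nat \<Rightarrow> bool" where
  "same_col i k \<longleftrightarrow> shape k = shape i \<and> trow (rev_tab ! k) = trow (rev_tab ! i)"

text \<open>Conditions of \<open>cell_matrix\<close> as closed integer statements. Column
  independence is tested against column 0, through which any two columns are compared; the nested
  conditionals skip the unconstrained coefficients.\<close>

definition cell_check :: "nat \<Rightarrow> bool" where
  "cell_check N \<longleftrightarrow>
    (\<forall>i\<in>{..<N}. \<forall>k\<in>{..<N}. (\<Sum>g<N. kl i g * kl_inv g k) = (if i = k then 1 else 0) \<and>
       (\<Sum>g<N. kl_inv i g * kl g k) = (if i = k then 1 else 0)) \<and>
    (\<forall>i\<in>{..<N}. rev_tab ! i < N \<and> shape (rev_tab ! i) = shape i \<and>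
       cell_ix (shape i) (trow i) (trow (rev_tab ! i)) = i) \<and>
    (\<forall>i\<in>{..<N}. \<forall>k\<in>{..<N}. kl (rev_tab ! i) (rev_tab ! k) = kl i k) \<and>
    (\<forall>i\<in>{..<N}. \<forall>k\<in>{..<N}. if shape i = shape k then cell_ix (shape i) (trow i) (trow k) < N \<and>
       shape (cell_ix (shape i) (trow i) (trow k)) = shape i \<and>
       trow (cell_ix (shape i) (trow i) (trow k)) = trow i \<and>
       trow (rev_tab ! cell_ix (shape i) (trow i) (trow k)) = trow k else True) \<and>
    (\<forall>g\<in>{..<N}. \<forall>i\<in>{..<N}. \<forall>k\<in>{..<N}.
       if shape k < shape i then True else if same_col i k
       then kl_mult N g i k = kl_mult N g (cell_ix (shape i) (trow i) 0) (cell_ix (shape k) (trow k) 0)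
       else kl_mult N g i k = 0)"

lemma bruhat_table:
  "bruhat 0 0 = True" "bruhat 0 1 = True" "bruhat 0 2 = True" "bruhat 0 3 = True"
  "bruhat 0 4 = True" "bruhat 0 5 = True" "bruhat 0 6 = True" "bruhat 0 7 = True"
  "bruhat 0 8 = True" "bruhat 0 9 = True" "bruhat 0 10 = True" "bruhat 0 11 = True"
  "bruhat 1 0 = False" "bruhat 1 1 = True" "bruhat 1 2 = False" "bruhat 1 3 = True"
  "bruhat 1 4 = False" "bruhat 1 5 = True" "bruhat 1 6 = False" "bruhat 1 7 = True"
  "bruhat 1 8 = False" "bruhat 1 9 = True" "bruhat 1 10 = False" "bruhat 1 11 = True"
  "bruhat 2 0 = False" "bruhat 2 1 = False" "bruhat 2 2 = True" "bruhat 2 3 = True"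
  "bruhat 2 4 = False" "bruhat 2 5 = False" "bruhat 2 6 = True" "bruhat 2 7 = True"
  "bruhat 2 8 = True" "bruhat 2 9 = True" "bruhat 2 10 = True" "bruhat 2 11 = True"
  "bruhat 3 0 = False" "bruhat 3 1 = False" "bruhat 3 2 = False" "bruhat 3 3 = True"
  "bruhat 3 4 = False" "bruhat 3 5 = False" "bruhat 3 6 = False" "bruhat 3 7 = True"
  "bruhat 3 8 = False" "bruhat 3 9 = True" "bruhat 3 10 = False" "bruhat 3 11 = True"
  "bruhat 4 0 = False" "bruhat 4 1 = False" "bruhat 4 2 = False" "bruhat 4 3 = False"
  "bruhat 4 4 = True" "bruhat 4 5 = True" "bruhat 4 6 = True" "bruhat 4 7 = True"
  "bruhat 4 8 = True" "bruhat 4 9 = True" "bruhat 4 10 = True" "bruhat 4 11 = True"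
  "bruhat 5 0 = False" "bruhat 5 1 = False" "bruhat 5 2 = False" "bruhat 5 3 = False"
  "bruhat 5 4 = False" "bruhat 5 5 = True" "bruhat 5 6 = False" "bruhat 5 7 = True"
  "bruhat 5 8 = False" "bruhat 5 9 = True" "bruhat 5 10 = False" "bruhat 5 11 = True"
  "bruhat 6 0 = False" "bruhat 6 1 = False" "bruhat 6 2 = False" "bruhat 6 3 = False"
  "bruhat 6 4 = False" "bruhat 6 5 = False" "bruhat 6 6 = True" "bruhat 6 7 = True"
  "bruhat 6 8 = False" "bruhat 6 9 = False" "bruhat 6 10 = True" "bruhat 6 11 = True"
  "bruhat 7 0 = False" "bruhat 7 1 = False" "bruhat 7 2 = False" "bruhat 7 3 = False"
  "bruhat 7 4 = False" "bruhat 7 5 = False" "bruhat 7 6 = False" "bruhat 7 7 = True"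
  "bruhat 7 8 = False" "bruhat 7 9 = False" "bruhat 7 10 = False" "bruhat 7 11 = True"
  "bruhat 8 0 = False" "bruhat 8 1 = False" "bruhat 8 2 = False" "bruhat 8 3 = False"
  "bruhat 8 4 = False" "bruhat 8 5 = False" "bruhat 8 6 = False" "bruhat 8 7 = False"
  "bruhat 8 8 = True" "bruhat 8 9 = True" "bruhat 8 10 = True" "bruhat 8 11 = True"
  "bruhat 9 0 = False" "bruhat 9 1 = False" "bruhat 9 2 = False" "bruhat 9 3 = False"
  "bruhat 9 4 = False" "bruhat 9 5 = False" "bruhat 9 6 = False" "bruhat 9 7 = False"
  "bruhat 9 8 = False" "bruhat 9 9 = True" "bruhat 9 10 = False" "bruhat 9 11 = True"
  "bruhat 10 0 = False" "bruhat 10 1 = False" "bruhat 10 2 = False" "bruhat 10 3 = False"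
  "bruhat 10 4 = False" "bruhat 10 5 = False" "bruhat 10 6 = False" "bruhat 10 7 = False"
  "bruhat 10 8 = False" "bruhat 10 9 = False" "bruhat 10 10 = True" "bruhat 10 11 = True"
  "bruhat 11 0 = False" "bruhat 11 1 = False" "bruhat 11 2 = False" "bruhat 11 3 = False"
  "bruhat 11 4 = False" "bruhat 11 5 = False" "bruhat 11 6 = False" "bruhat 11 7 = False"
  "bruhat 11 8 = False" "bruhat 11 9 = False" "bruhat 11 10 = False" "bruhat 11 11 = True"
  by (simp_all add: bruhat_def len3_def del: One_nat_def)

lemma kl_inv_table:
  "kl_inv 0 0 = 1" "kl_inv 0 1 = 0" "kl_inv 0 2 = 0" "kl_inv 0 3 = 0" "kl_inv 0 4 = 0"
  "kl_inv 0 5 = 0" "kl_inv 0 6 = 0" "kl_inv 0 7 = 0" "kl_inv 0 8 = 0" "kl_inv 0 9 = 0"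
  "kl_inv 0 10 = 0" "kl_inv 0 11 = 0" "kl_inv 1 0 = -1" "kl_inv 1 1 = 1" "kl_inv 1 2 = 0"
  "kl_inv 1 3 = 0" "kl_inv 1 4 = 0" "kl_inv 1 5 = 0" "kl_inv 1 6 = 0" "kl_inv 1 7 = 0"
  "kl_inv 1 8 = 0" "kl_inv 1 9 = 0" "kl_inv 1 10 = 0" "kl_inv 1 11 = 0" "kl_inv 2 0 = -1"
  "kl_inv 2 1 = 0" "kl_inv 2 2 = 1" "kl_inv 2 3 = 0" "kl_inv 2 4 = 0" "kl_inv 2 5 = 0"
  "kl_inv 2 6 = 0" "kl_inv 2 7 = 0" "kl_inv 2 8 = 0" "kl_inv 2 9 = 0" "kl_inv 2 10 = 0"
  "kl_inv 2 11 = 0" "kl_inv 3 0 = 1" "kl_inv 3 1 = -1" "kl_inv 3 2 = -1" "kl_inv 3 3 = 1"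
  "kl_inv 3 4 = 0" "kl_inv 3 5 = 0" "kl_inv 3 6 = 0" "kl_inv 3 7 = 0" "kl_inv 3 8 = 0"
  "kl_inv 3 9 = 0" "kl_inv 3 10 = 0" "kl_inv 3 11 = 0" "kl_inv 4 0 = -1" "kl_inv 4 1 = 0"
  "kl_inv 4 2 = 0" "kl_inv 4 3 = 0" "kl_inv 4 4 = 1" "kl_inv 4 5 = 0" "kl_inv 4 6 = 0"
  "kl_inv 4 7 = 0" "kl_inv 4 8 = 0" "kl_inv 4 9 = 0" "kl_inv 4 10 = 0" "kl_inv 4 11 = 0"
  "kl_inv 5 0 = 1" "kl_inv 5 1 = -1" "kl_inv 5 2 = 0" "kl_inv 5 3 = 0" "kl_inv 5 4 = -1"
  "kl_inv 5 5 = 1" "kl_inv 5 6 = 0" "kl_inv 5 7 = 0" "kl_inv 5 8 = 0" "kl_inv 5 9 = 0"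
  "kl_inv 5 10 = 0" "kl_inv 5 11 = 0" "kl_inv 6 0 = 1" "kl_inv 6 1 = 0" "kl_inv 6 2 = -1"
  "kl_inv 6 3 = 0" "kl_inv 6 4 = -1" "kl_inv 6 5 = 0" "kl_inv 6 6 = 1" "kl_inv 6 7 = 0"
  "kl_inv 6 8 = 0" "kl_inv 6 9 = 0" "kl_inv 6 10 = 0" "kl_inv 6 11 = 0" "kl_inv 7 0 = -1"
  "kl_inv 7 1 = 1" "kl_inv 7 2 = 1" "kl_inv 7 3 = -1" "kl_inv 7 4 = 1" "kl_inv 7 5 = -1"
  "kl_inv 7 6 = -1" "kl_inv 7 7 = 1" "kl_inv 7 8 = 0" "kl_inv 7 9 = 0" "kl_inv 7 10 = 0"
  "kl_inv 7 11 = 0" "kl_inv 8 0 = 1" "kl_inv 8 1 = 0" "kl_inv 8 2 = -1" "kl_inv 8 3 = 0"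
  "kl_inv 8 4 = -1" "kl_inv 8 5 = 0" "kl_inv 8 6 = 0" "kl_inv 8 7 = 0" "kl_inv 8 8 = 1"
  "kl_inv 8 9 = 0" "kl_inv 8 10 = 0" "kl_inv 8 11 = 0" "kl_inv 9 0 = -1" "kl_inv 9 1 = 1"
  "kl_inv 9 2 = 1" "kl_inv 9 3 = -1" "kl_inv 9 4 = 1" "kl_inv 9 5 = -1" "kl_inv 9 6 = 0"
  "kl_inv 9 7 = 0" "kl_inv 9 8 = -1" "kl_inv 9 9 = 1" "kl_inv 9 10 = 0" "kl_inv 9 11 = 0"
  "kl_inv 10 0 = -1" "kl_inv 10 1 = 0" "kl_inv 10 2 = 1" "kl_inv 10 3 = 0" "kl_inv 10 4 = 1"
  "kl_inv 10 5 = 0" "kl_inv 10 6 = -1" "kl_inv 10 7 = 0" "kl_inv 10 8 = -1" "kl_inv 10 9 = 0"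
  "kl_inv 10 10 = 1" "kl_inv 10 11 = 0" "kl_inv 11 0 = 1" "kl_inv 11 1 = -1" "kl_inv 11 2 = -1"
  "kl_inv 11 3 = 1" "kl_inv 11 4 = -1" "kl_inv 11 5 = 1" "kl_inv 11 6 = 1" "kl_inv 11 7 = -1"
  "kl_inv 11 8 = 1" "kl_inv 11 9 = -1" "kl_inv 11 10 = -1" "kl_inv 11 11 = 1"
  by (simp_all add: kl_inv_def bruhat_table len3_def del: One_nat_def)

lemma shape_table:
  "shape 0 = 5" "shape 1 = 4" "shape 2 = 3" "shape 3 = 2" "shape 4 = 3" "shape 5 = 2"
  "shape 6 = 3" "shape 7 = 2" "shape 8 = 3" "shape 9 = 2" "shape 10 = 1" "shape 11 = 0"
  "trow 0 = 0" "trow 1 = 0" "trow 2 = 0" "trow 3 = 0" "trow 4 = 1" "trow 5 = 1" "trow 6 = 0"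
  "trow 7 = 0" "trow 8 = 1" "trow 9 = 1" "trow 10 = 0" "trow 11 = 0"
  by (simp_all add: shape_def trow_def del: One_nat_def)

lemmas cell_simps = kl_def kl_mult_def bruhat_table kl_inv_table shape_table cell_ix_def same_col_def
  mu_12 tab_simps

lemma cell_check_12: "cell_check 12"
  unfolding cell_check_def sum_lessThan_12 unfolding lessThan_12 ball_simps ball_empty simp_thms
  by (intro conjI; simp add: sum_lessThan_12 cell_simps del: One_nat_def)

lemma cell_check_2: "cell_check 2"
proof -
  have "{..<2::nat} = {1, 0}" by auto
  then show ?thesis
    unfolding cell_check_def by (simp add: cell_simps del: One_nat_def)
qed

lemma cell_check_1: "cell_check 1"
proof -
  have "{..<1::nat} = {0}" by auto
  then show ?thesis
    unfolding cell_check_def by (simp add: cell_simps del: One_nat_def)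
qed

section \<open>The free algebra and its ideal of relations\<close>

text \<open>Guarantees that the sum defining \<open>fa_mul\<close> is a genuine finite sum and not
  the default value 0.\<close>

lemma finite_splits: "finite {(x, y). x @ y = w}"
proof (rule finite_surj)
  show "{(x, y). x @ y = w} \<subseteq> (\<lambda>k. (take k w, drop k w)) ` {..length w}"
  proof clarify
    fix x y
    show "(x, y) \<in> (\<lambda>k. (take k (x @ y), drop k (x @ y))) ` {..length (x @ y)}"
      by (rule image_eqI[of _ _ "length x"]) simp_all
  qed
qed simp

lemma fa_word_in: "fa_word w \<in> fa_carrier"
  by (simp add: fa_carrier_def fa_word_def)

lemma fa_zero_in: "fa_zero \<in> fa_carrier"
  by (simp add: fa_carrier_def fa_zero_def)

lemma fa_add_in: "f \<in> fa_carrier \<Longrightarrow> g \<in> fa_carrier \<Longrightarrow> fa_add f g \<in> fa_carrier"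
proof -
  assume "f \<in> fa_carrier" "g \<in> fa_carrier"
  then have "finite ({w. f w \<noteq> 0} \<union> {w. g w \<noteq> 0})" by (simp add: fa_carrier_def)
  then show ?thesis
    unfolding fa_carrier_def fa_add_def mem_Collect_eq by (rule rev_finite_subset) auto
qed

lemma fa_smul_in: "f \<in> fa_carrier \<Longrightarrow> fa_smul a f \<in> fa_carrier"
  unfolding fa_carrier_def fa_smul_def mem_Collect_eq by (erule rev_finite_subset) auto

lemma fa_rev_in: "f \<in> fa_carrier \<Longrightarrow> fa_rev f \<in> fa_carrier"
proof -
  assume "f \<in> fa_carrier"
  then have "finite (rev ` {w. f w \<noteq> 0})" by (simp add: fa_carrier_def)
  moreover have "{w. f (rev w) \<noteq> 0} \<subseteq> rev ` {w. f w \<noteq> 0}"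
    by (auto intro: image_eqI[where x = "rev w" for w])
  ultimately show ?thesis unfolding fa_carrier_def fa_rev_def mem_Collect_eq by (rule rev_finite_subset)
qed

lemma fa_mul_supp: "{w. fa_mul f g w \<noteq> 0} \<subseteq> (\<lambda>(x, y). x @ y) ` ({w. f w \<noteq> 0} \<times> {w. g w \<noteq> 0})"
proof
  fix w assume "w \<in> {w. fa_mul f g w \<noteq> 0}"
  then obtain x y where "x @ y = w" "f x * g y \<noteq> 0"
    unfolding fa_mul_def by (auto elim!: sum.not_neutral_contains_not_neutral)
  then show "w \<in> (\<lambda>(x, y). x @ y) ` ({w. f w \<noteq> 0} \<times> {w. g w \<noteq> 0})" by force
qed

lemma fa_mul_in: "f \<in> fa_carrier \<Longrightarrow> g \<in> fa_carrier \<Longrightarrow> fa_mul f g \<in> fa_carrier"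
  unfolding fa_carrier_def mem_Collect_eq by (rule finite_subset[OF fa_mul_supp]) simp

lemmas fa_in = fa_word_in fa_zero_in fa_add_in fa_smul_in fa_rev_in fa_mul_in

lemma fa_mul_diff:
  "fa_mul h (\<lambda>x. f x - k * g x) = (\<lambda>x. fa_mul h f x - k * fa_mul h g x)"
  "fa_mul (\<lambda>x. f x - k * g x) h = (\<lambda>x. fa_mul f h x - k * fa_mul g h x)"
  unfolding fa_mul_def sum_distrib_left sum_subtractf[symmetric]
  by (rule ext, intro sum.cong refl, force simp: algebra_simps)+

lemma fa_mul_word: "fa_mul (fa_word u) (fa_word v) = fa_word (u @ v)"
proof
  fix w
  have "fa_mul (fa_word u) (fa_word v) w = (\<Sum>p\<in>{(x, y). x @ y = w}. if p = (u, v) then 1 else 0)"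
    unfolding fa_mul_def fa_word_def by (intro sum.cong refl) (auto split: if_splits)
  then show "fa_mul (fa_word u) (fa_word v) w = fa_word (u @ v) w"
    by (auto simp: fa_word_def sum.delta[OF finite_splits])
qed

lemma fa_mul_scalar: "fa_mul (fa_smul k (fa_word [])) f = (\<lambda>x. k * f x)"
proof
  fix w
  have "fa_mul (fa_smul k (fa_word [])) f w =
      (\<Sum>p\<in>{(x, y). x @ y = w}. if p = ([], w) then k * f w else 0)"
    unfolding fa_mul_def fa_word_def fa_smul_def by (intro sum.cong refl) (auto split: if_splits)
  then show "fa_mul (fa_smul k (fa_word [])) f w = k * f w"
    by (simp add: sum.delta[OF finite_splits])
qed

text \<open>The inductive definition has no rule for scalars; a scalar acts as left multiplication
  by a multiple of the empty word.\<close>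

lemma br_ideal_smult: "a \<in> br_ideal d \<Longrightarrow> (\<lambda>x. k * a x) \<in> br_ideal d"
  using br_ideal.lmul[of "fa_smul k (fa_word [])" a d] by (simp add: fa_in fa_mul_scalar)

lemma br_ideal_add: "a \<in> br_ideal d \<Longrightarrow> b \<in> br_ideal d \<Longrightarrow> (\<lambda>x. a x + b x) \<in> br_ideal d"
  using br_ideal.add[of a d b] by (simp add: fa_add_def)

lemma br_ideal_0: "(\<lambda>x. 0) \<in> br_ideal d"
  using br_ideal.zero by (simp add: fa_zero_def)

section \<open>Rewriting modulo the relations\<close>

definition weqv :: "'k::field \<Rightarrow> gen list \<Rightarrow> 'k \<Rightarrow> gen list \<Rightarrow> bool" where
  "weqv d w k v \<longleftrightarrow> (\<lambda>x. fa_word w x - k * fa_word v x) \<in> br_ideal d"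

lemma weqv_refl: "weqv d w 1 w"
  by (simp add: weqv_def br_ideal_0)

lemma weqv_sym: "weqv d w 1 v \<Longrightarrow> weqv d v 1 w"
  unfolding weqv_def by (drule br_ideal_smult[where k = "-1"]) simp

lemma weqv_trans: "\<lbrakk>weqv d w k v; weqv d v k' u\<rbrakk> \<Longrightarrow> weqv d w (k * k') u"
  unfolding weqv_def
  by (drule br_ideal_smult[where a = "\<lambda>x. fa_word v x - k' * fa_word u x" and k = k], drule (1) br_ideal_add)
    (simp add: algebra_simps)

lemma weqv_context: "weqv d w k v \<Longrightarrow> weqv d (x @ w @ y) k (x @ v @ y)"
  unfolding weqv_def
  using br_ideal.lmul[OF fa_word_in[of x]] br_ideal.rmul[OF fa_word_in[of y]]
  by (fastforce simp: fa_mul_diff fa_mul_word)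

lemma weqv_rel:
  "(fa_word w, fa_word v) \<in> set (br_rels d) \<Longrightarrow> weqv d w 1 v"
  "(fa_word w, fa_smul k (fa_word v)) \<in> set (br_rels d) \<Longrightarrow> weqv d w k v"
  unfolding weqv_def by (drule br_ideal.rel, simp add: fa_add_def fa_smul_def)+

text \<open>\<open>(l, e, r)\<close> rewrites \<open>l\<close> to \<open>d ^ e\<close> times
  \<open>r\<close>.\<close>

type_synonym rule = "gen list \<times> nat \<times> gen list"

fun strip :: "gen list \<Rightarrow> gen list \<Rightarrow> gen list option" where
  "strip [] w = Some w"
| "strip (g # l) [] = None"
| "strip (g # l) (h # w) = (if g = h then strip l w else None)"

fun head_red :: "rule list \<Rightarrow> gen list \<Rightarrow> (nat \<times> gen list) option" where
  "head_red [] w = None"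
| "head_red ((l, e, r) # R) w =
     (case strip l w of None \<Rightarrow> head_red R w | Some v \<Rightarrow> Some (e, r @ v))"

fun step_red :: "rule list \<Rightarrow> gen list \<Rightarrow> (nat \<times> gen list) option" where
  "step_red R [] = None"
| "step_red R (g # w) = (case head_red R (g # w) of
     None \<Rightarrow> map_option (\<lambda>(e, v). (e, g # v)) (step_red R w) | Some x \<Rightarrow> Some x)"

text \<open>The counter bounds the number of steps and so makes the recursion terminate; soundness
  holds for every value of it.\<close>

fun red :: "rule list \<Rightarrow> nat \<Rightarrow> gen list \<Rightarrow> nat \<times> gen list" where
  "red R 0 w = (0, w)"
| "red R (Suc n) w = (case step_red R w of None \<Rightarrow> (0, w)
     | Some (e, v) \<Rightarrow> (case red R n v of (e', u) \<Rightarrow> (e + e', u)))"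

definition sound :: "'k::field \<Rightarrow> rule list \<Rightarrow> bool" where
  "sound d R \<longleftrightarrow> (\<forall>(l, e, r)\<in>set R. weqv d l (d ^ e) r)"

lemma strip_Some: "strip l w = Some v \<Longrightarrow> w = l @ v"
  by (induction l w rule: strip.induct) (auto split: if_splits)

lemma head_red_sound: "\<lbrakk>sound d R; head_red R w = Some (e, v)\<rbrakk> \<Longrightarrow> weqv d w (d ^ e) v"
proof (induction R w rule: head_red.induct)
  case (2 l k r R w)
  show ?case
  proof (cases "strip l w")
    case None
    then show ?thesis using 2 by (auto simp: sound_def)
  next
    case (Some u)
    then have "w = [] @ l @ u" "v = [] @ r @ u" "e = k" using 2(3) strip_Some by auto
    moreover have "weqv d l (d ^ k) r" using 2(2) by (simp add: sound_def)
    ultimately show ?thesis using weqv_context by blast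
  qed
qed simp

lemma step_red_sound: "\<lbrakk>sound d R; step_red R w = Some (e, v)\<rbrakk> \<Longrightarrow> weqv d w (d ^ e) v"
proof (induction R w arbitrary: v rule: step_red.induct)
  case (2 R g w)
  show ?case
  proof (cases "head_red R (g # w)")
    case None
    then obtain u where "step_red R w = Some (e, u)" "v = g # u" using 2(3) by auto
    then show ?thesis using 2(1)[OF None 2(2)] weqv_context[of d w _ u "[g]" "[]"] by simp
  next
    case (Some x)
    then show ?thesis using 2 head_red_sound[OF 2(2)] by simp
  qed
qed simp

lemma red_sound: "\<lbrakk>sound d R; red R n w = (e, v)\<rbrakk> \<Longrightarrow> weqv d w (d ^ e) v"
proof (induction R n w arbitrary: e v rule: red.induct)
  case (2 R n w)
  show ?case
  proof (cases "step_red R w")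
    case None
    then show ?thesis using 2 weqv_refl by simp
  next
    case (Some x)
    obtain k u where x: "x = (k, u)" by (cases x)
    obtain k' where "red R n u = (k', v)" "e = k + k'"
      using 2(3) Some x by (auto split: prod.splits)
    then have "weqv d u (d ^ k') v" using 2(1)[OF Some x[symmetric] 2(2)] by simp
    moreover have "weqv d w (d ^ k) u" using step_red_sound[OF 2(2)] Some x by simp
    ultimately show ?thesis using weqv_trans \<open>e = k + k'\<close> by (simp add: power_add)
  qed
qed (use weqv_refl in auto)

text \<open>The relations oriented as rules, except \<open>(R1 R0) ^ 6 = 1\<close>, which enters
  through the last rule of \<open>extra_tab\<close>.\<close>

definition base_tab :: "rule list" where
  "base_tab = [
     ([R0, R0], 0, []), ([R1, R1], 0, []), ([R0, E0], 0, [E0]), ([E0, R0], 0, [E0]),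
     ([R1, E1], 0, [E1]), ([E1, R1], 0, [E1]), ([E0, E0], 3, [E0]), ([E1, E1], 1, [E1]),
     ([R0, E1, E0], 0, [R1, E0]), ([E0, E1, R0], 0, [E0, R1]), ([E0, R1, E0], 2, [E0]),
     ([E1, R0, E1, R0, E1], 0, [E1]), ([E1, R0, E1, R0, R1], 0, [E1, R0, R1, R0]),
     ([R1, R0, E1, R0, E1], 0, [R0, R1, R0, E1])]"

text \<open>The rules added by Knuth-Bendix completion; the words of \<open>word_tab\<close> are the irreducible ones.\<close>

definition extra_tab :: "rule list" where
  "extra_tab = [
     ([R0, R1, E0], 0, [E1, E0]), ([E0, R1, R0], 0, [E0, E1]), ([E0, E1, E0], 2, [E0]),
     ([R1, R0, R1, R0, E1], 0, [R0, E1, R0, E1]), ([E1, R0, R1, R0, R1], 0, [E1, R0, E1, R0]),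
     ([E1, R0, R1, R0, E1], 0, [E1]), ([R1, R0, E1, R0, R1, R0], 0, [R0, R1, R0, E1, R0, R1]),
     ([R1, R0, R1, R0, R1, R0], 0, [R0, R1, R0, R1, R0, R1])]"

lemma sound_base: "sound d base_tab"
  unfolding sound_def base_tab_def
  by (simp, intro conjI)
    (rule weqv_rel(1), simp add: br_rels_def | rule weqv_rel(2), simp add: br_rels_def)+

lemma weqv_replace:
  assumes "weqv d l 1 r" "weqv d (x @ r @ y) k v"
  shows "weqv d (x @ l @ y) k v"
  using weqv_trans[OF weqv_context[OF assms(1)] assms(2)] by simp

text \<open>Each added rule comes from applying a relation backwards (\<open>sym\<close>) and
  reducing the longer word, as in \<open>R0 R1 E0 = R0 R0 E1 E0 = E1 E0\<close>.\<close>

lemma sound_extra: "sound d extra_tab"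
proof -
  note base = sound_base[of d, unfolded sound_def base_tab_def, simplified]
  note red = red_sound[OF sound_base[of d], of 6, unfolded base_tab_def]
  have sym: "weqv d [R1, E0] 1 [R0, E1, E0]" "weqv d [E0, R1] 1 [E0, E1, R0]" "weqv d [E0] 1 [E0, R0]"
    "weqv d [R0, R1, R0, E1] 1 [R1, R0, E1, R0, E1]" "weqv d [E1, R0, R1, R0] 1 [E1, R0, E1, R0, R1]"
    using base weqv_sym by auto
  have r1: "weqv d [R0, R0, E1, E0] (d ^ 0) [E1, E0]" by (rule red) (simp add: eval_nat_numeral)
  have r2: "weqv d [E0, E1, R0, R0] 1 [E0, E1]"
    using weqv_context[of d "[R0, R0]" 1 "[]" "[E0, E1]" "[]"] base by simp
  have r3: "weqv d [E0, R0, E1, E0] 1 [E0, R1, E0]"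
    using weqv_context[of d "[R0, E1, E0]" 1 "[R1, E0]" "[E0]" "[]"] base by simp
  have r4: "weqv d [R1, R1, R0, E1, R0, E1] (d ^ 0) [R0, E1, R0, E1]"
    by (rule red) (simp add: eval_nat_numeral)
  have r5: "weqv d [E1, R0, E1, R0, R1, R1] 1 [E1, R0, E1, R0]"
    using weqv_context[of d "[R1, R1]" 1 "[]" "[E1, R0, E1, R0]" "[]"] base by simp
  have r6: "weqv d [E1, R1, R0, E1, R0, E1] (d ^ 0) [E1]" by (rule red) (simp add: eval_nat_numeral)
  have r7: "weqv d [R1, R0, E1, R0, E1, R0, R1] 1 [R0, R1, R0, E1, R0, R1]"
    using weqv_context[of d "[R1, R0, E1, R0, E1]" 1 "[R0, R1, R0, E1]" "[]" "[R0, R1]"] base by simp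
  have r8: "weqv d [R1, R0, R1, R0, R1, R0, R0, R1, R0, R1, R0, R1] (d ^ 0) []"
    by (rule red) (simp add: eval_nat_numeral)
  have r9: "weqv d [R1, R0, R1, R0, R1, R0, R1, R0, R1, R0, R1, R0] 1 []"
    by (rule weqv_rel) (simp add: br_rels_def eval_nat_numeral)
  have "weqv d [R0, R1, E0] 1 [E1, E0]"
    using weqv_replace[OF sym(1), of "[R0]" "[]"] r1 by simp
  moreover have "weqv d [E0, R1, R0] 1 [E0, E1]"
    using weqv_replace[OF sym(2), of "[]" "[R0]"] r2 by simp
  moreover have "weqv d [E0, E1, E0] (d ^ 2) [E0]"
    using weqv_replace[OF sym(3), of "[]" "[E1, E0]"] weqv_trans[OF r3] base by force
  moreover have "weqv d [R1, R0, R1, R0, E1] 1 [R0, E1, R0, E1]"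
    using weqv_replace[OF sym(4), of "[R1]" "[]"] r4 by simp
  moreover have "weqv d [E1, R0, R1, R0, R1] 1 [E1, R0, E1, R0]"
    using weqv_replace[OF sym(5), of "[]" "[R1]"] r5 by simp
  moreover have "weqv d [E1, R0, R1, R0, E1] 1 [E1]"
    using weqv_replace[OF sym(4), of "[E1]" "[]"] r6 by simp
  moreover have "weqv d [R1, R0, E1, R0, R1, R0] 1 [R0, R1, R0, E1, R0, R1]"
    using weqv_replace[OF sym(5), of "[R1, R0]" "[]"] r7 by simp
  moreover have "weqv d [R1, R0, R1, R0, R1, R0] 1 [R0, R1, R0, R1, R0, R1]"
  proof -
    \<comment> \<open>\<open>(R1 R0) ^ 3\<close> is multiplied by
      \<open>(R1 R0) ^ 3 (R0 R1) ^ 3 = 1\<close>; the left part is then \<open>(R1 R0) ^ 6\<close>,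
      which the relation removes.\<close>
    have "weqv d [R1, R0, R1, R0, R1, R0] 1
        [R1, R0, R1, R0, R1, R0, R1, R0, R1, R0, R1, R0, R0, R1, R0, R1, R0, R1]"
      using weqv_context[OF weqv_sym, of d _ "[]" "[R1, R0, R1, R0, R1, R0]" "[]"] r8 by simp
    moreover have "weqv d [R1, R0, R1, R0, R1, R0, R1, R0, R1, R0, R1, R0, R0, R1, R0, R1, R0, R1] 1
        [R0, R1, R0, R1, R0, R1]"
      using weqv_context[OF r9, of "[]" "[R0, R1, R0, R1, R0, R1]"] by simp
    ultimately show ?thesis using weqv_trans by fastforce
  qed
  ultimately show ?thesis by (simp add: sound_def extra_tab_def)
qed

definition rule_tab :: "rule list" where
  "rule_tab = base_tab @ extra_tab"

lemmas head_red_rule_tab = arg_cong[where f = "\<lambda>R. head_red R w" for w, OF rule_tab_def,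
    unfolded base_tab_def extra_tab_def append.simps head_red.simps]

lemma red_numeral:
  "red R 1 w = (case step_red R w of None \<Rightarrow> (0, w) | Some (e, v) \<Rightarrow> (e, v))"
  "red R (numeral k) w = (case step_red R w of None \<Rightarrow> (0, w)
     | Some (e, v) \<Rightarrow> (case red R (pred_numeral k) v of (e', u) \<Rightarrow> (e + e', u)))"
  by (auto simp: numeral_eq_Suc split: option.splits)

text \<open>Ties the tables to the relations: multiplying a basis word by a generator gives, by at
  most 6 rewriting steps, the tabulated result. Hence the 39 words span the quotient.\<close>

lemma red_check: "\<forall>t\<in>{..<39}. \<forall>g. red rule_tab 6 (g # word_tab ! t) =
    (left_exp g t, word_tab ! (left_tab g ! t))"
  unfolding lessThan_39 ball_simps ball_empty all_gen
  by (simp add: red_numeral head_red_rule_tab tab_simps del: One_nat_def head_red.simps red.simps(2))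

lemma weqv_wval: "weqv d w (d ^ snd (wval w)) (word_tab ! fst (wval w))"
proof (induction w)
  case Nil
  then show ?case using weqv_refl by (simp add: wval_def tab_simps)
next
  case (Cons g w)
  let ?t = "fst (wval w)"
  have "sound d rule_tab"
    using sound_base[of d] sound_extra[of d] by (auto simp: sound_def rule_tab_def)
  moreover have "red rule_tab 6 (g # word_tab ! ?t) =
      (left_exp g ?t, word_tab ! (left_tab g ! ?t))"
    using red_check wval_less[of w] by blast
  ultimately have "weqv d (g # word_tab ! ?t) (d ^ left_exp g ?t) (word_tab ! (left_tab g ! ?t))"
    by (rule red_sound)
  moreover have "weqv d (g # w) (d ^ snd (wval w)) (g # word_tab ! ?t)"
    using weqv_context[OF Cons, of "[g]" "[]"] by simp
  ultimately have "weqv d (g # w) (d ^ snd (wval w) * d ^ left_exp g ?t) (word_tab ! (left_tab g ! ?t))"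
    by (metis weqv_trans)
  then show ?case by (simp add: wval_def lact_def power_add mult.commute)
qed

section \<open>Coordinates on the quotient algebra\<close>

definition chi :: "'k::field \<Rightarrow> gen list \<Rightarrow> nat \<Rightarrow> 'k" where
  "chi d w = (\<lambda>u. d ^ snd (wval w) * delta (fst (wval w)) u)"

definition nf :: "'k::field \<Rightarrow> (gen list \<Rightarrow> 'k) \<Rightarrow> nat \<Rightarrow> 'k" where
  "nf d f = (\<lambda>u. \<Sum>w | f w \<noteq> 0. f w * chi d w u)"

lemma nf_eq: "\<lbrakk>finite S; {w. f w \<noteq> 0} \<subseteq> S\<rbrakk> \<Longrightarrow> nf d f = (\<lambda>u. \<Sum>w\<in>S. f w * chi d w u)"
  unfolding nf_def by (rule ext, rule sum.mono_neutral_left) auto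

lemma nf_in: "nf d f \<in> fsupp 39"
proof -
  have "chi d w u = 0" if "39 \<le> u" for w u
    using wval_less[of w] that by (simp add: chi_def delta_def)
  then show ?thesis by (simp add: fsupp_def nf_def)
qed

lemma nf_word: "nf d (fa_word w) = chi d w"
  by (subst nf_eq[of "{w}"]) (auto simp: fa_word_def)

lemma nf_zero: "nf d fa_zero = (\<lambda>_. 0)"
  by (simp add: nf_def fa_zero_def)

lemma nf_add:
  assumes "f \<in> fa_carrier" "g \<in> fa_carrier"
  shows "nf d (fa_add f g) = (\<lambda>u. nf d f u + nf d g u)"
proof -
  let ?S = "{w. f w \<noteq> 0} \<union> {w. g w \<noteq> 0}"
  have fin: "finite ?S" using assms by (simp add: fa_carrier_def)
  have "nf d (fa_add f g) = (\<lambda>u. \<Sum>w\<in>?S. fa_add f g w * chi d w u)"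
    by (rule nf_eq[OF fin]) (auto simp: fa_add_def)
  moreover have "nf d f = (\<lambda>u. \<Sum>w\<in>?S. f w * chi d w u)" "nf d g = (\<lambda>u. \<Sum>w\<in>?S. g w * chi d w u)"
    by (rule nf_eq[OF fin]; auto)+
  ultimately show ?thesis
    by (simp add: fa_add_def distrib_right sum.distrib)
qed

lemma nf_smul:
  assumes "f \<in> fa_carrier"
  shows "nf d (fa_smul k f) = (\<lambda>u. k * nf d f u)"
proof -
  have fin: "finite {w. f w \<noteq> 0}" using assms by (simp add: fa_carrier_def)
  have "nf d (fa_smul k f) = (\<lambda>u. \<Sum>w | f w \<noteq> 0. fa_smul k f w * chi d w u)"
    by (rule nf_eq[OF fin]) (auto simp: fa_smul_def)
  then show ?thesis by (simp add: nf_def fa_smul_def sum_distrib_left mult.assoc)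
qed

lemma chi_append: "tmul 39 mu (\<lambda>s t. d ^ ex s t) (chi d x) (chi d y) = chi d (x @ y)"
proof -
  interpret twisted_monoid 39 mu "\<lambda>s t. d ^ ex s t" by (rule twisted_monoid_mu)
  show ?thesis
    unfolding chi_def tmul_linear tmul_delta_delta[OF wval_less wval_less] wval_append
    by (simp add: power_add mult_ac)
qed

text \<open>The value of \<open>fa_mul f g\<close> at a word is a sum over its splittings;
  regrouping by pairs of words in the two supports leaves a double sum, to which
  \<open>chi_append\<close> applies.\<close>

lemma nf_mul:
  assumes "f \<in> fa_carrier" "g \<in> fa_carrier"
  shows "nf d (fa_mul f g) = tmul 39 mu (\<lambda>s t. d ^ ex s t) (nf d f) (nf d g)"
proof
  fix u
  let ?F = "{w. f w \<noteq> 0}" and ?G = "{w. g w \<noteq> 0}"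
  let ?S = "(\<lambda>(x, y). x @ y) ` (?F \<times> ?G)"
  have fin: "finite ?F" "finite ?G" using assms by (simp_all add: fa_carrier_def)
  have mul: "fa_mul f g w = (\<Sum>(x, y)\<in>{p \<in> ?F \<times> ?G. (\<lambda>(x, y). x @ y) p = w}. f x * g y)" for w
    unfolding fa_mul_def by (rule sum.mono_neutral_right[OF finite_splits]) auto
  have "nf d (fa_mul f g) u = (\<Sum>w\<in>?S. fa_mul f g w * chi d w u)"
    by (rule fun_cong[OF nf_eq[OF _ fa_mul_supp]]) (use fin in simp)
  also have "\<dots> = (\<Sum>w\<in>?S. \<Sum>p\<in>{p \<in> ?F \<times> ?G. (\<lambda>(x, y). x @ y) p = w}.
      f (fst p) * g (snd p) * chi d (fst p @ snd p) u)"
    unfolding mul sum_distrib_right by (intro sum.cong refl) auto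
  also have "\<dots> = (\<Sum>p\<in>?F \<times> ?G. f (fst p) * g (snd p) * chi d (fst p @ snd p) u)"
    using fin by (intro sum.group) auto
  also have "\<dots> = (\<Sum>x\<in>?F. \<Sum>y\<in>?G. f x * g y * chi d (x @ y) u)"
    unfolding sum.cartesian_product by (intro sum.cong refl) auto
  also have "\<dots> = (\<Sum>x\<in>?F. f x * (\<Sum>y\<in>?G. g y * chi d (x @ y) u))"
    by (simp add: sum_distrib_left mult.assoc)
  also have "\<dots> = tmul 39 mu (\<lambda>s t. d ^ ex s t) (nf d f) (nf d g) u"
    unfolding nf_def tmul_sum_left[OF fin(1)] tmul_sum_right[OF fin(2)] chi_append ..
  finally show "nf d (fa_mul f g) u = tmul 39 mu (\<lambda>s t. d ^ ex s t) (nf d f) (nf d g) u" .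
qed

lemma nf_rev:
  assumes "u < 39"
  shows "nf d (fa_rev f) u = nf d f (rev_tab ! u)"
proof -
  have rev_supp: "{w. fa_rev f w \<noteq> 0} = rev ` {w. f w \<noteq> 0}"
    unfolding fa_rev_def
  proof (intro equalityI subsetI)
    fix w assume "w \<in> {w. f (rev w) \<noteq> 0}"
    then show "w \<in> rev ` {w. f w \<noteq> 0}" by (intro image_eqI[of _ _ "rev w"]) simp_all
  qed auto
  have "u = rev_tab ! fst (wval w) \<longleftrightarrow> rev_tab ! u = fst (wval w)" for w
    using rev_tab_check wval_less assms by (metis lessThan_iff)
  then have chi_rev: "chi d (rev w) u = chi d w (rev_tab ! u)" for w
    by (simp add: chi_def wval_rev flip_def delta_def)
  have "nf d (fa_rev f) u = (\<Sum>w | f w \<noteq> 0. fa_rev f (rev w) * chi d (rev w) u)"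
    unfolding nf_def rev_supp by (subst sum.reindex) (auto simp: inj_on_def)
  then show ?thesis by (simp add: nf_def fa_rev_def chi_rev)
qed

text \<open>The algebra built from the tables satisfies the defining relations, so \<open>nf\<close>
  vanishes on the ideal and no basis words can collapse in the quotient.\<close>

lemma nf_br_rels:
  "\<forall>(x, y)\<in>set (br_rels d). x \<in> fa_carrier \<and> y \<in> fa_carrier \<and> nf d x = nf d y"
proof -
  have rep: "concat (replicate 6 [R1, R0]) = [R1, R0, R1, R0, R1, R0, R1, R0, R1, R0, R1, R0]"
    by (simp add: numeral_eq_Suc)
  show ?thesis
    unfolding br_rels_def rep
    by (simp add: fa_in nf_word nf_smul chi_def wval_def lact_def tab_simps del: One_nat_def)
qed

lemma br_ideal_in: "a \<in> br_ideal d \<Longrightarrow> a \<in> fa_carrier"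
proof (induction rule: br_ideal.induct)
  case (rel x y)
  then have "x \<in> fa_carrier \<and> y \<in> fa_carrier" using nf_br_rels by fastforce
  then show ?case by (simp add: fa_in)
qed (auto simp: fa_in)

lemma nf_br_ideal: "a \<in> br_ideal d \<Longrightarrow> nf d a = (\<lambda>_. 0)"
proof (induction rule: br_ideal.induct)
  case (rel x y)
  then have "x \<in> fa_carrier \<and> y \<in> fa_carrier \<and> nf d x = nf d y" using nf_br_rels by fastforce
  then show ?case by (simp add: nf_add nf_smul fa_in)
next
  case (lmul f a)
  then show ?case by (simp add: nf_mul br_ideal_in tmul_zero)
next
  case (rmul f a)
  then show ?case by (simp add: nf_mul br_ideal_in tmul_zero)
qed (auto simp: nf_zero nf_add br_ideal_in)

lemma reduce_mod_ideal:
  assumes "finite S"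
  shows "(\<lambda>x. (\<Sum>w\<in>S. f w * fa_word w x) -
    (\<Sum>w\<in>S. f w * (d ^ snd (wval w) * fa_word (word_tab ! fst (wval w)) x))) \<in> br_ideal d"
  using assms
proof induction
  case empty
  then show ?case by (simp add: br_ideal_0)
next
  case (insert w S)
  have "(\<lambda>x. f w * (fa_word w x - d ^ snd (wval w) * fa_word (word_tab ! fst (wval w)) x)) \<in> br_ideal d"
    by (rule br_ideal_smult) (use weqv_wval[of d w] in \<open>simp add: weqv_def\<close>)
  from br_ideal_add[OF this insert(3)] show ?case
    using insert(1,2) by (simp add: algebra_simps)
qed

text \<open>Modulo the ideal, \<open>f\<close> is the combination of basis words with coefficients
  \<open>nf d f\<close>, so vanishing coordinates put \<open>f\<close> in the ideal. Rewriting gives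
  this direction and the tables give the other.\<close>

lemma br_ideal_iff:
  assumes "f \<in> fa_carrier"
  shows "f \<in> br_ideal d \<longleftrightarrow> nf d f = (\<lambda>_. 0)"
proof
  assume 0: "nf d f = (\<lambda>_. 0)"
  let ?S = "{w. f w \<noteq> 0}"
  have fin: "finite ?S" using assms by (simp add: fa_carrier_def)
  have "(\<Sum>w\<in>?S. f w * fa_word w x) = f x" for x
  proof -
    have "(\<Sum>w\<in>?S. f w * fa_word w x) = (\<Sum>w\<in>?S. if w = x then f x else 0)"
      by (intro sum.cong refl) (auto simp: fa_word_def)
    then show ?thesis using fin by simp
  qed
  moreover have "(\<Sum>w\<in>?S. f w * (d ^ snd (wval w) * fa_word (word_tab ! fst (wval w)) x)) = 0" for x
  proof -
    have "d ^ snd (wval w) * fa_word (word_tab ! fst (wval w)) x =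
        (\<Sum>t<39. chi d w t * fa_word (word_tab ! t) x)" for w
    proof -
      have "(\<Sum>t<39. chi d w t * fa_word (word_tab ! t) x) = (\<Sum>t<39. if t = fst (wval w)
          then d ^ snd (wval w) * fa_word (word_tab ! fst (wval w)) x else 0)"
        by (intro sum.cong refl) (auto simp: chi_def delta_def)
      then show ?thesis using wval_less[of w] by simp
    qed
    then have "(\<Sum>w\<in>?S. f w * (d ^ snd (wval w) * fa_word (word_tab ! fst (wval w)) x)) =
        (\<Sum>w\<in>?S. \<Sum>t<39. f w * chi d w t * fa_word (word_tab ! t) x)"
      by (simp add: sum_distrib_left mult.assoc)
    also have "\<dots> = (\<Sum>t<39. nf d f t * fa_word (word_tab ! t) x)"
      unfolding nf_def sum_distrib_right by (rule sum.swap)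
    also have "\<dots> = 0" unfolding 0 by simp
    finally show ?thesis .
  qed
  ultimately show "f \<in> br_ideal d" using reduce_mod_ideal[OF fin, of f d] by simp
qed (rule nf_br_ideal)

lemma br_cls_eq: "f \<in> fa_carrier \<Longrightarrow> br_cls d f = {g \<in> fa_carrier. nf d g = nf d f}"
  unfolding br_cls_def
  by (auto simp: br_ideal_iff fa_in nf_add nf_smul fun_eq_iff)

lemma br_rep:
  assumes "X \<in> carrier (BrG2 d)"
  shows "br_rep d X \<in> fa_carrier" "br_cls d (br_rep d X) = X"
proof -
  have "\<exists>f. f \<in> fa_carrier \<and> X = br_cls d f" using assms by (auto simp: BrG2_def)
  from someI_ex[OF this] show "br_rep d X \<in> fa_carrier" "br_cls d (br_rep d X) = X"
    unfolding br_rep_def by auto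
qed

text \<open>Evaluated on the representative chosen by \<open>br_rep\<close>;
  \<open>coord_br_cls\<close> shows that the choice is immaterial.\<close>

definition coord :: "'k::field \<Rightarrow> (gen list \<Rightarrow> 'k) set \<Rightarrow> nat \<Rightarrow> 'k" where
  "coord d X = nf d (br_rep d X)"

lemma br_cls_in: "f \<in> fa_carrier \<Longrightarrow> br_cls d f \<in> carrier (BrG2 d)"
  by (simp add: BrG2_def)

lemma coord_br_cls: "f \<in> fa_carrier \<Longrightarrow> coord d (br_cls d f) = nf d f"
proof -
  assume f: "f \<in> fa_carrier"
  note r = br_rep[OF br_cls_in[OF f, of d]]
  have "br_rep d (br_cls d f) \<in> br_cls d (br_rep d (br_cls d f))"
    using r(1) by (simp add: br_cls_eq)
  then show ?thesis using r(2) f by (simp add: coord_def br_cls_eq)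
qed

lemma coord_bij:
  fixes d :: "'k::field"
  shows "bij_betw (coord d) (carrier (BrG2 d)) (fsupp 39)"
  unfolding bij_betw_def
proof (rule conjI)
  show "inj_on (coord d) (carrier (BrG2 d))"
  proof (rule inj_onI)
    fix X Y assume "X \<in> carrier (BrG2 d)" "Y \<in> carrier (BrG2 d)" "coord d X = coord d Y"
    then show "X = Y" using br_rep br_cls_eq unfolding coord_def by metis
  qed
next
  have "v \<in> coord d ` carrier (BrG2 d)" if v: "v \<in> fsupp 39" for v :: "nat \<Rightarrow> 'k"
  proof -
    define f where "f = (\<lambda>x. \<Sum>t<39. v t * fa_word (word_tab ! t) x)"
    have inj: "inj_on ((!) word_tab) {..<39}"
      using wval_word by (intro inj_onI) (metis lessThan_iff prod.inject)
    have supp: "{w. f w \<noteq> 0} \<subseteq> (!) word_tab ` {..<39}"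
      by (auto simp: f_def fa_word_def elim!: sum.not_neutral_contains_not_neutral split: if_splits)
    then have f_in: "f \<in> fa_carrier" unfolding fa_carrier_def mem_Collect_eq by (rule finite_subset) simp
    have f_word: "f (word_tab ! s) = v s" if "s < 39" for s
    proof -
      have "word_tab ! s = word_tab ! t \<longleftrightarrow> s = t" if "t < 39" for t
        using inj that \<open>s < 39\<close> by (auto simp: inj_on_def)
      then have "f (word_tab ! s) = (\<Sum>t<39. if t = s then v s else 0)"
        unfolding f_def fa_word_def by (intro sum.cong refl) auto
      then show ?thesis using that by simp
    qed
    have "nf d f = v"
    proof
      fix u
      have "nf d f u = (\<Sum>w\<in>(!) word_tab ` {..<39}. f w * chi d w u)"
        using nf_eq[OF _ supp] by simp
      also have "\<dots> = (\<Sum>t<39. if t = u then v u else 0)"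
        unfolding sum.reindex[OF inj] by (intro sum.cong refl) (auto simp: f_word chi_def wval_word delta_def)
      also have "\<dots> = v u" using v by (auto simp: fsupp_def)
      finally show "nf d f u = v u" .
    qed
    then have "v = coord d (br_cls d f)" using f_in by (simp add: coord_br_cls)
    then show ?thesis using br_cls_in[OF f_in] by blast
  qed
  then show "coord d ` carrier (BrG2 d) = fsupp 39" using nf_in by (auto simp: coord_def)
qed

lemma coord_alg_BrG2: "coord_alg 39 mu (\<lambda>s t. d ^ ex s t) (BrG2 d) (coord d)"
proof (intro coord_alg.intro twisted_monoid_mu coord_alg_axioms.intro coord_bij)
  have one: "\<one>\<^bsub>BrG2 d\<^esub> = br_cls d (fa_word [])" and zero: "\<zero>\<^bsub>BrG2 d\<^esub> = br_cls d fa_zero"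
    by (simp_all add: BrG2_def)
  have add: "X \<oplus>\<^bsub>BrG2 d\<^esub> Y = br_cls d (fa_add (br_rep d X) (br_rep d Y))"
    and mult: "X \<otimes>\<^bsub>BrG2 d\<^esub> Y = br_cls d (fa_mul (br_rep d X) (br_rep d Y))"
    and smult: "a \<odot>\<^bsub>BrG2 d\<^esub> X = br_cls d (fa_smul a (br_rep d X))" for X Y a
    by (simp_all add: BrG2_def)
  show "\<zero>\<^bsub>BrG2 d\<^esub> \<in> carrier (BrG2 d)" "\<one>\<^bsub>BrG2 d\<^esub> \<in> carrier (BrG2 d)"
    by (simp_all add: one zero br_cls_in fa_in)
  show "coord d \<zero>\<^bsub>BrG2 d\<^esub> = (\<lambda>_. 0)" "coord d \<one>\<^bsub>BrG2 d\<^esub> = delta 0"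
    by (simp_all add: one zero coord_br_cls fa_in nf_zero nf_word chi_def wval_def)
  fix X Y a assume X: "X \<in> carrier (BrG2 d)"
  show "a \<odot>\<^bsub>BrG2 d\<^esub> X \<in> carrier (BrG2 d)" "coord d (a \<odot>\<^bsub>BrG2 d\<^esub> X) = (\<lambda>t. a * coord d X t)"
    using br_rep(1)[OF X] by (simp_all add: smult br_cls_in fa_in coord_br_cls nf_smul) (simp add: coord_def)
  assume Y: "Y \<in> carrier (BrG2 d)"
  show "X \<oplus>\<^bsub>BrG2 d\<^esub> Y \<in> carrier (BrG2 d)" "coord d (X \<oplus>\<^bsub>BrG2 d\<^esub> Y) = (\<lambda>t. coord d X t + coord d Y t)"
    using br_rep(1)[OF X] br_rep(1)[OF Y]
    by (simp_all add: add br_cls_in fa_in coord_br_cls nf_add) (simp add: coord_def)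
  show "X \<otimes>\<^bsub>BrG2 d\<^esub> Y \<in> carrier (BrG2 d)"
    "coord d (X \<otimes>\<^bsub>BrG2 d\<^esub> Y) = tmul 39 mu (\<lambda>s t. d ^ ex s t) (coord d X) (coord d Y)"
    using br_rep(1)[OF X] br_rep(1)[OF Y]
    by (simp_all add: mult br_cls_in fa_in coord_br_cls nf_mul) (simp add: coord_def)
qed

section \<open>The reversal anti-involution and the verification of the layer data\<close>

lemma br_inv_in: "X \<in> carrier (BrG2 d) \<Longrightarrow> br_inv d X \<in> carrier (BrG2 d)"
  unfolding br_inv_def by (intro br_cls_in fa_rev_in br_rep(1))

lemma coord_br_inv:
  assumes "X \<in> carrier (BrG2 d)" "t < 39"
  shows "coord d (br_inv d X) t = coord d X (rev_tab ! t)"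
  unfolding br_inv_def coord_br_cls[OF fa_rev_in[OF br_rep(1)[OF assms(1)]]] nf_rev[OF assms(2)]
  by (simp add: coord_def)

lemma twisted_monoid_nb:
  assumes "1 \<le> l" "l \<le> 3"
  shows "twisted_monoid (nb l) mu (\<lambda>_ _. 1 :: 'k::field)"
proof
  fix s t u assume "s < nb l" "t < nb l" "u < nb l"
  then show "mu (mu s t) u = mu s (mu t u)" by (intro mu_assoc nb_less)
qed (use assms nb_pos mu_nb_less mu_0 nb_less in auto)

text \<open>The identities hold over the integers and \<open>of_int\<close> carries them to the
  field. For \<open>triangular\<close> the contrapositive is transported: an integer coefficient 0
  stays 0.\<close>

lemma cell_matrix_nb:
  assumes l: "1 \<le> l" "l \<le> 3"
  shows "cell_matrix (nb l) mu (\<lambda>i g. of_int (kl i g) :: 'k::field) (\<lambda>g i. of_int (kl_inv g i))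
    (\<lambda>t. rev_tab ! t) shape trow cell_ix"
proof (intro cell_matrix.intro twisted_monoid_nb l cell_matrix_axioms.intro)
  have "l = 1 \<or> l = 2 \<or> l = 3" using l by auto
  then have "cell_check (nb l)"
    using cell_check_1 cell_check_2 cell_check_12 by (auto simp: nb_def)
  note check = this[unfolded cell_check_def]
  have inv1: "(\<Sum>g<nb l. kl i g * kl_inv g k) = (if i = k then 1 else 0)"
    and inv2: "(\<Sum>g<nb l. kl_inv i g * kl g k) = (if i = k then 1 else 0)"
    and kl_flip: "kl (rev_tab ! i) (rev_tab ! k) = kl i k"
    and mix: "shape i = shape k \<Longrightarrow>
      cell_ix (shape i) (trow i) (trow k) < nb l \<and>
      shape (cell_ix (shape i) (trow i) (trow k)) = shape i \<and>
      trow (cell_ix (shape i) (trow i) (trow k)) = trow i \<and>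
      trow (rev_tab ! cell_ix (shape i) (trow i) (trow k)) = trow k"
    if "i < nb l" "k < nb l" for i k
    using check that by (meson lessThan_iff)+
  have flip: "rev_tab ! i < nb l \<and> shape (rev_tab ! i) = shape i \<and>
      cell_ix (shape i) (trow i) (trow (rev_tab ! i)) = i" if "i < nb l" for i
    using check that by (meson lessThan_iff)
  have act: "if shape k < shape i then True else if same_col i k
      then kl_mult (nb l) g i k = kl_mult (nb l) g (cell_ix (shape i) (trow i) 0) (cell_ix (shape k) (trow k) 0)
      else kl_mult (nb l) g i k = 0" if "g < nb l" "i < nb l" "k < nb l" for g i k
    using check that by (meson lessThan_iff)
  have mult: "(\<Sum>h<nb l. of_int (kl i h) * of_int (kl_inv (mu g h) k)) = (of_int (kl_mult (nb l) g i k) :: 'k)"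
    for g i k by (simp add: kl_mult_eq)
  show "(\<Sum>g<nb l. of_int (kl i g) * of_int (kl_inv g k)) = (if i = k then 1 else 0 :: 'k)"
    if "i < nb l" "k < nb l" for i k
    using arg_cong[OF inv1[OF that], of "of_int :: int \<Rightarrow> 'k"] by (auto split: if_splits)
  show "(\<Sum>i<nb l. of_int (kl_inv g i) * of_int (kl i h)) = (if g = h then 1 else 0 :: 'k)"
    if "g < nb l" "h < nb l" for g h
    using arg_cong[OF inv2[OF that], of "of_int :: int \<Rightarrow> 'k"] by (auto split: if_splits)
  show "rev_tab ! i < nb l \<and> rev_tab ! (rev_tab ! i) = i \<and> shape (rev_tab ! i) = shape i" if "i < nb l" for i
    using flip[OF that] rev_tab_check nb_less[OF that] by simp
  show "rev_tab ! mu g h = mu (rev_tab ! h) (rev_tab ! g)" if "g < nb l" "h < nb l" for g h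
    using rev_mu nb_less that by blast
  show "of_int (kl (rev_tab ! i) (rev_tab ! g)) = (of_int (kl i g) :: 'k)" if "i < nb l" "g < nb l" for i g
    using kl_flip[OF that] by simp
  show "cell_ix (shape i) (trow i) (trow (rev_tab ! i)) = i" if "i < nb l" for i
    using flip[OF that] by simp
  show "cell_ix (shape i) (trow i) (trow k) < nb l \<and>
      shape (cell_ix (shape i) (trow i) (trow k)) = shape i \<and>
      trow (cell_ix (shape i) (trow i) (trow k)) = trow i \<and>
      trow (rev_tab ! cell_ix (shape i) (trow i) (trow k)) = trow k"
    if "i < nb l" "k < nb l" "shape i = shape k" for i k
    using mix[OF that] .
  show "shape k < shape i \<or> (shape k = shape i \<and> trow (rev_tab ! k) = trow (rev_tab ! i))"
    if "g < nb l" "i < nb l" "k < nb l"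
      and "(\<Sum>h<nb l. of_int (kl i h) * of_int (kl_inv (mu g h) k)) \<noteq> (0 :: 'k)" for g i k
    using act[OF that(1-3)] that(4) unfolding mult by (auto simp: same_col_def split: if_splits)
  show "(\<Sum>h<nb l. of_int (kl i h) * of_int (kl_inv (mu g h) k)) =
      (\<Sum>h<nb l. of_int (kl i' h) * of_int (kl_inv (mu g h) k') :: 'k)"
    if "g < nb l" "i < nb l" "k < nb l" "i' < nb l" "k' < nb l" "shape i = shape k" "shape i' = shape i"
      "shape k' = shape k" "trow i = trow i'" "trow k = trow k'"
      "trow (rev_tab ! i) = trow (rev_tab ! k)" "trow (rev_tab ! i') = trow (rev_tab ! k')" for g i k i' k'
    using act[OF that(1-3)] act[OF that(1,4,5)] that(6-) unfolding mult
    by (simp add: same_col_def)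
qed

theorem theorem10p1:
  fixes d :: "'k::field"
  assumes "(2::'k) \<noteq> 0" and "(3::'k) \<noteq> 0" and "d \<noteq> 0"
  shows "cell_strat (BrG2 d) (br_inv d)"
proof -
  \<comment> \<open>The scalars in the squares of the base words: \<open>d ^ 3\<close> for the
    conjugate of \<open>E0\<close>, \<open>d\<close> for \<open>E1\<close>, and 1 for the
    identity.\<close>
  let ?w = "\<lambda>l::nat. d ^ (if l = 1 then 3 else if l = 2 then 1 else 0)"
  interpret A: coord_alg 39 mu "\<lambda>s t. d ^ ex s t" "BrG2 d" "coord d" by (rule coord_alg_BrG2)
  have "anti_inv (BrG2 d) (br_inv d)"
    using br_inv_in coord_br_inv rev_tab_check rev_mu rev_ex
    by (intro A.anti_inv_coordI[where \<iota> = "\<lambda>t. rev_tab ! t"]) auto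
  then interpret layered_alg 39 mu "\<lambda>s t. d ^ ex s t" "BrG2 d" "coord d" "br_inv d"
    "\<lambda>t. rev_tab ! t" "\<lambda>t. rev_tab ! t" mu 3 np nb ix lay pp qq hh ?w
  proof (intro layered_alg.intro coord_alg_BrG2 layered_alg_axioms.intro, goal_cases)
    case (5 l h)
    then show ?case using rev_ix(2)[of l 0 0 h] np_pos rev_tab_check nb_less[of h l] by auto
  next
    case (7 l h h')
    then show ?case using rev_mu nb_less by blast
  next
    case (8 l)
    then show ?case by (intro twisted_monoid_nb)
  next
    case (9 l)
    then show ?case using cell_matrix.cellular_B[OF cell_matrix_nb[of l]] by simp
  next
    case (11 l p q h)
    then show ?case using ix_co by blast
  next
    case (12 t)
    then show ?case using co by blast
  next
    case (13 l p q h)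
    then show ?case using rev_ix(1) by blast
  next
    case (14 s t)
    then show ?case using lay_mu by blast
  next
    case (15 s l p q h)
    then show ?case using left[of s l p q h] by (simp split: if_splits)
  next
    case (17 k l)
    then have k: "k \<in> {1, 2, 3}" and l: "l \<in> {1, 2, 3}" and "k \<le> l" by auto
    from bspec[OF bspec[OF idem_check l] k] this(3) show ?case by presburger
  qed (use coord_br_inv rev_mu rev_ex np_pos \<open>d \<noteq> 0\<close> in \<open>simp_all add: tab_simps\<close>)
  show ?thesis by (rule cell_strat_A)
qed

end
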